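(* Let $\mathbb{B}$ be the operator on $\mathcal{H}$ defined in the context, with parameters $\alpha,\beta$. The semigroup $S(t)=e^{t\mathbb{B}}$ is exponentially stable as long as the parameters $\alpha$ and $\beta$ belong to $[0,1]$; that is, for every $(\alpha,\beta)\in[0,1]^2$ there exist constants $M\ge1$ and $\omega>0$ such that $\|S(t)\|_{\mathcal{L}(\mathcal{H})}\le Me^{-\omega t}$ for all $t\ge0$.
   Context: Fix $l>0$ and real constants $m,b_1,b_2,\kappa_1,\kappa_2,\rho_1,\rho_2,\rho_3,\rho_4,\gamma_1,\gamma_2,\gamma_3,\gamma_4>0$. All function spaces are over $\mathbb{C}$; $\langle\cdot,\cdot\rangle$ and $\|\cdot\|$ are the inner product and norm of $L^2(0,l)$. Let $L^2_*(0,l)=\{u\in L^2(0,l):\int_0^l u\,dx=0\}$. Let $A=-\partial_{xx}$ on $L^2(0,l)$ with domain $D(A)=H^2(0,l)\cap H^1_0(0,l)$, and $A_*=-\partial_{xx}$ on $L^2_*(0,l)$ with domain $D(A_* )=\{v\in H^2(0,l)\cap L^2_*(0,l): v_x(0)=v_x(l)=0\}$. Both are positive self-adjoint with compact inverse, so $A^\sigma,A_*^\sigma$ are defined for all $\sigma\in\mathbb{R}$; $D(A^0)=L^2(0,l)$, $D(A_*^0)=L^2_*(0,l)$, $D(A^{1/2})=H^1_0(0,l)$, $D(A_*^{1/2})=H^1(0,l)\cap L^2_*(0,l)$. The phase space is $\mathcal{H}=[D(A^{1/2})\times D(A^0)\times D(A_*^{1/2})\times D(A_*^0)]^2$, with elements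 $U=(u,\tilde u,v,\tilde v,y,\tilde y,z,\tilde z)^T$, a Hilbert space with the norm (and corresponding inner product) $$\|U\|_{\mathcal{H}}^2=\rho_1\|\tilde u\|^2+\rho_2\|\tilde v\|^2+\rho_3\|\tilde y\|^2+\rho_4\|\tilde z\|^2+\kappa_1\|u_x-v\|^2+\kappa_2\|y_x-z\|^2+m\|y-u\|^2+b_1\|A_*^{1/2}v\|^2+b_2\|A_*^{1/2}z\|^2.$$ The operator $\mathbb{B}$ is $\mathbb{B}U=(\tilde u,B_2,\tilde v,B_4,\tilde y,B_6,\tilde z,B_8)^T$ with $$\begin{aligned}\rho_1B_2&=-A(\kappa_1u+\gamma_1\tilde u)-\kappa_1v_x-\gamma_1\tilde v_x+m(y-u),\\ \rho_2B_4&=-A_*(b_1v+\gamma_2A_*^{\alpha-1}\tilde v)+\kappa_1(u_x-v)+\gamma_1(\tilde u_x-\tilde v),\\ \rho_3B_6&=-A(\kappa_2y+\gamma_3\tilde y)-\kappa_2z_x-\gamma_3\tilde z_x-m(y-u),\\ \rho_4B_8&=-A_*(b_2z+\gamma_4A_*^{\beta-1}\tilde z)+\kappa_2(y_x-z)+\gamma_3(\tilde y_x-\tilde z),\end{aligned}$$ and domain $$\mathfrak{D}(\mathbb{B})=\{U\in\mathcal{H}:(\tilde u,\tilde v,\tilde y,\tilde z)\in[D(A^{1/2})\times D(A_*^{1/2})]^2,\ \kappa_1u+\gamma_1\tilde u,\ \kappa_2y+\gamma_3\tilde y\in D(A),\ b_1v+\gamma_2A_*^{\alpha-1}\tilde v,\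 b_2z+\gamma_4A_*^{\beta-1}\tilde z\in D(A_* )\}.$$ The equation $U_t=\mathbb{B}U$ (with $\tilde u=u_t$, etc.) is the abstract form of the system $$\begin{aligned}&\rho_1u_{tt}-\kappa_1(u_x-v)_x-m(y-u)-\gamma_1(u_x-v)_{xt}=0,\\&\rho_2v_{tt}-b_1v_{xx}-\kappa_1(u_x-v)-\gamma_1(u_x-v)_t+\gamma_2(-\partial_{xx})^\alpha v_t=0,\\&\rho_3y_{tt}-\kappa_2(y_x-z)_x+m(y-u)-\gamma_3(y_x-z)_{xt}=0,\\&\rho_4z_{tt}-b_2z_{xx}-\kappa_2(y_x-z)-\gamma_3(y_x-z)_t+\gamma_4(-\partial_{xx})^\beta z_t=0\end{aligned}$$ on $(0,l)\times(0,\infty)$ with $u=y=0$ and $v_x=z_x=0$ at $x=0,l$. The operator $\mathbb{B}$ generates a $C_0$-semigroup of contractions on $\mathcal{H}$, denoted $S(t)=e^{t\mathbb{B}}$. *)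

theory Defs
  imports "HOL-Analysis.Analysis"
begin

section \<open>Complex vector spaces\<close>

class complex_vector = real_vector +
  fixes scaleC :: "complex \<Rightarrow> 'a \<Rightarrow> 'a"  (infixr \<open>*\<^sub>C\<close> 75)
  assumes scaleC_add_right: "c *\<^sub>C (x + y) = c *\<^sub>C x + c *\<^sub>C y"
    and scaleC_add_left: "(c + d) *\<^sub>C x = c *\<^sub>C x + d *\<^sub>C x"
    and scaleC_scaleC: "c *\<^sub>C d *\<^sub>C x = (c * d) *\<^sub>C x"
    and scaleR_scaleC: "r *\<^sub>R x = complex_of_real r *\<^sub>C x"

instantiation prod :: (complex_vector, complex_vector) complex_vector
begin
definition "scaleC c p = (c *\<^sub>C fst p, c *\<^sub>C snd p)"
instance
  by standard
    (simp_all add: scaleC_prod_def prod_eq_iff scaleC_add_right scaleC_add_left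
      scaleC_scaleC scaleR_scaleC)
end


section \<open>Square integrable functions on the real line modulo null sets\<close>

definition sq_int :: "(real \<Rightarrow> complex) \<Rightarrow> bool" where
  "sq_int f \<longleftrightarrow> f \<in> borel_measurable borel \<and> integrable lborel (\<lambda>x. (cmod (f x))\<^sup>2)"

definition L2_rel :: "(real \<Rightarrow> complex) \<Rightarrow> (real \<Rightarrow> complex) \<Rightarrow> bool" where
  "L2_rel f g \<longleftrightarrow> sq_int f \<and> sq_int g \<and> (AE x in lborel. f x = g x)"

lemma sq_int_zero: "sq_int (\<lambda>x. 0)"
  by (simp add: sq_int_def)

lemma sq_int_scale: "sq_int f \<Longrightarrow> sq_int (\<lambda>x. c * f x)"
  by (auto simp: sq_int_def norm_mult power_mult_distrib)

lemma sq_int_mult: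
  assumes f: "sq_int f" and g: "sq_int g"
  shows "integrable lborel (\<lambda>x. f x * cnj (g x))"
proof (rule Bochner_Integration.integrable_bound)
  show "integrable lborel (\<lambda>x. (cmod (f x))\<^sup>2 + (cmod (g x))\<^sup>2)"
    using f g by (auto simp: sq_int_def)
  have [measurable]: "f \<in> borel_measurable borel" "g \<in> borel_measurable borel"
    using f g by (auto simp: sq_int_def)
  show "(\<lambda>x. f x * cnj (g x)) \<in> borel_measurable lborel"
    using borel_measurable_continuous_on[of cnj g borel] by simp
  have "a * b \<le> a\<^sup>2 + b\<^sup>2" if "0 \<le> a" "0 \<le> b" for a b :: real
    using sum_squares_bound[of a b] mult_nonneg_nonneg[OF that] by linarith
  then show "AE x in lborel. norm (f x * cnj (g x)) \<le> norm ((cmod (f x))\<^sup>2 + (cmod (g x))\<^sup>2)"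
    by (auto simp: norm_mult)
qed

lemma sq_int_add:
  assumes f: "sq_int f" and g: "sq_int g"
  shows "sq_int (\<lambda>x. f x + g x)"
  unfolding sq_int_def
proof
  have [measurable]: "f \<in> borel_measurable borel" "g \<in> borel_measurable borel"
    using f g by (auto simp: sq_int_def)
  show "(\<lambda>x. f x + g x) \<in> borel_measurable borel"
    by simp
  show "integrable lborel (\<lambda>x. (cmod (f x + g x))\<^sup>2)"
  proof (rule Bochner_Integration.integrable_bound)
    show "integrable lborel (\<lambda>x. 2 * (cmod (f x))\<^sup>2 + 2 * (cmod (g x))\<^sup>2)"
      using f g by (auto simp: sq_int_def)
    show "(\<lambda>x. (cmod (f x + g x))\<^sup>2) \<in> borel_measurable lborel"
      by simp
    have "(cmod (a + b))\<^sup>2 \<le> 2 * (cmod a)\<^sup>2 + 2 * (cmod b)\<^sup>2" for a b :: complex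
    proof -
      have "(cmod (a + b))\<^sup>2 \<le> (cmod a + cmod b)\<^sup>2"
        by (intro power_mono norm_triangle_ineq) auto
      then show ?thesis
        using sum_squares_bound[of "cmod a" "cmod b"] by (simp add: power2_sum)
    qed
    then show "AE x in lborel. norm ((cmod (f x + g x))\<^sup>2)
        \<le> norm (2 * (cmod (f x))\<^sup>2 + 2 * (cmod (g x))\<^sup>2)"
      by auto
  qed
qed

lemma sq_int_uminus: "sq_int f \<Longrightarrow> sq_int (\<lambda>x. - f x)"
  by (auto simp: sq_int_def)

lemma sq_int_diff: "sq_int f \<Longrightarrow> sq_int g \<Longrightarrow> sq_int (\<lambda>x. f x - g x)"
  using sq_int_add[OF _ sq_int_uminus] by auto

lemma L2_relI: "sq_int f \<Longrightarrow> (\<And>x. f x = g x) \<Longrightarrow> L2_rel f g"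
proof -
  assume "sq_int f" and "\<And>x. f x = g x"
  moreover from this(2) have "f = g" by (rule ext)
  ultimately show ?thesis by (simp add: L2_rel_def)
qed

lemma sq_int_L2_rel: "L2_rel f f \<Longrightarrow> sq_int f"
  by (simp add: L2_rel_def)

lemmas sq_int_intros = sq_int_L2_rel sq_int_zero sq_int_add sq_int_uminus sq_int_diff sq_int_scale

quotient_type L2 = "real \<Rightarrow> complex" / partial: L2_rel
proof (rule part_equivpI)
  show "\<exists>f. L2_rel f f"
    using sq_int_zero by (auto simp: L2_rel_def)
  show "symp L2_rel"
    by (auto intro!: sympI simp: L2_rel_def)
  show "transp L2_rel"
    by (rule transpI) (auto simp: L2_rel_def)
qed

instantiation L2 :: real_vector
begin

lift_definition zero_L2 :: L2 is "\<lambda>x. 0"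
  by (simp add: L2_rel_def sq_int_zero)

lift_definition plus_L2 :: "L2 \<Rightarrow> L2 \<Rightarrow> L2" is "\<lambda>f g x. f x + g x"
  by (auto simp: L2_rel_def sq_int_add)

lift_definition minus_L2 :: "L2 \<Rightarrow> L2 \<Rightarrow> L2" is "\<lambda>f g x. f x - g x"
  by (auto simp: L2_rel_def sq_int_diff)

lift_definition uminus_L2 :: "L2 \<Rightarrow> L2" is "\<lambda>f x. - f x"
  by (auto simp: L2_rel_def sq_int_uminus)

lift_definition scaleR_L2 :: "real \<Rightarrow> L2 \<Rightarrow> L2" is "\<lambda>r f x. complex_of_real r * f x"
  by (auto simp: L2_rel_def intro: sq_int_scale)

instance
  by standard
    (transfer, rule L2_relI, (intro sq_int_intros; assumption), simp add: algebra_simps)+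

end

instantiation L2 :: complex_vector
begin

lift_definition scaleC_L2 :: "complex \<Rightarrow> L2 \<Rightarrow> L2" is "\<lambda>c f x. c * f x"
  by (auto simp: L2_rel_def intro: sq_int_scale)

instance
  by standard
    (transfer, rule L2_relI, (intro sq_int_intros; assumption), simp add: algebra_simps)+

end

lift_definition cinner :: "L2 \<Rightarrow> L2 \<Rightarrow> complex" is "\<lambda>f g. LBINT x. f x * cnj (g x)"
proof -
  fix f f' g g' assume *: "L2_rel f f'" "L2_rel g g'"
  show "(LBINT x. f x * cnj (g x)) = (LBINT x. f' x * cnj (g' x))"
  proof (rule Bochner_Integration.integral_cong_AE)
    show "(\<lambda>x. f x * cnj (g x)) \<in> borel_measurable lborel"
      "(\<lambda>x. f' x * cnj (g' x)) \<in> borel_measurable lborel"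
      using * by (blast intro: borel_measurable_integrable sq_int_mult dest: L2_rel_def[THEN iffD1])+
    have "AE x in lborel. f x = f' x" "AE x in lborel. g x = g' x"
      using * by (auto simp: L2_rel_def)
    then show "AE x in lborel. f x * cnj (g x) = f' x * cnj (g' x)"
      by eventually_elim auto
  qed
qed

lemma cinner_add_left: "cinner (f + g) h = cinner f h + cinner g h"
  by transfer (simp add: L2_rel_def sq_int_mult algebra_simps)

lemma cinner_scaleR_left: "cinner (r *\<^sub>R f) h = complex_of_real r * cinner f h"
  by transfer (simp add: mult.assoc)

lemma cinner_commute: "cinner f g = cnj (cinner g f)"
  by transfer (simp add: mult.commute flip: Bochner_Integration.integral_cnj)

lemma Re_cinner_self: "Re (cinner f f) = (LBINT x. (cmod (rep_L2 f x))\<^sup>2)"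
proof -
  have "cinner f f = (LBINT x. complex_of_real ((cmod (rep_L2 f x))\<^sup>2))"
    by (simp only: cinner.rep_eq complex_norm_square)
  also have "\<dots> = complex_of_real (LBINT x. (cmod (rep_L2 f x))\<^sup>2)"
    by (rule integral_complex_of_real)
  finally show ?thesis
    by simp
qed

lemma rep_L2_sq_int: "sq_int (rep_L2 f)"
  using Quotient_rep_reflp[OF Quotient_L2, of f] by (auto simp: L2_rel_def)

text \<open>The library norm of this type is the norm of \<open>L\<^sup>2\<close>; the real inner product
  is the real part of the complex one, which is linear in its first argument.\<close>

instantiation L2 :: real_inner
begin

definition inner_L2 :: "L2 \<Rightarrow> L2 \<Rightarrow> real" where
  "inner_L2 f g = Re (cinner f g)"

definition norm_L2 :: "L2 \<Rightarrow> real" where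
  "norm_L2 f = sqrt (inner f f)"

definition dist_L2 :: "L2 \<Rightarrow> L2 \<Rightarrow> real" where
  "dist_L2 f g = norm (f - g)"

definition sgn_L2 :: "L2 \<Rightarrow> L2" where
  "sgn_L2 f = f /\<^sub>R norm f"

definition uniformity_L2 :: "(L2 \<times> L2) filter" where
  "uniformity_L2 = (INF e\<in>{0<..}. principal {(x, y). dist x y < e})"

definition open_L2 :: "L2 set \<Rightarrow> bool" where
  "open_L2 U \<longleftrightarrow> (\<forall>x\<in>U. eventually (\<lambda>(x', y). x' = x \<longrightarrow> y \<in> U) uniformity)"

instance
proof
  fix f g h :: L2 and r :: real
  show "inner f g = inner g f"
    by (simp add: inner_L2_def cinner_commute[of f g])
  show "inner (f + g) h = inner f h + inner g h"
    by (simp add: inner_L2_def cinner_add_left)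
  show "inner (r *\<^sub>R f) g = r * inner f g"
    by (simp add: inner_L2_def cinner_scaleR_left)
  show "0 \<le> inner f f"
    by (simp add: inner_L2_def Re_cinner_self)
  have "(LBINT x. (cmod (rep_L2 f x))\<^sup>2) = 0 \<longleftrightarrow> (AE x in lborel. rep_L2 f x = 0)"
    using rep_L2_sq_int[of f]
    by (subst integral_nonneg_eq_0_iff_AE) (auto simp: sq_int_def)
  also have "\<dots> \<longleftrightarrow> f = 0"
  proof -
    have "L2_rel (rep_L2 f) (\<lambda>x. 0) \<longleftrightarrow> (AE x in lborel. rep_L2 f x = 0)"
      using rep_L2_sq_int[of f] sq_int_zero by (simp add: L2_rel_def)
    moreover have "L2_rel (rep_L2 f) (\<lambda>x. 0) \<longleftrightarrow> abs_L2 (rep_L2 f) = abs_L2 (\<lambda>x. 0)"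
      using Quotient_rel[OF Quotient_L2, of "rep_L2 f" "\<lambda>x. 0"] rep_L2_sq_int[of f] sq_int_zero
      by (simp add: L2_rel_def)
    moreover have "abs_L2 (rep_L2 f) = f"
      by (rule Quotient_abs_rep[OF Quotient_L2])
    ultimately show ?thesis
      by (simp add: zero_L2_def)
  qed
  finally show "inner f f = 0 \<longleftrightarrow> f = 0"
    by (simp add: inner_L2_def Re_cinner_self)
qed (simp_all add: norm_L2_def dist_L2_def sgn_L2_def uniformity_L2_def open_L2_def)

end


section \<open>Function spaces on the interval \<open>(0,l)\<close>\<close>

text \<open>\<open>L\<^sup>2(0,l)\<close> is identified, through extension by zero, with the subspace of \<open>L\<^sup>2(\<real>)\<close>
  of the classes vanishing almost everywhere outside \<open>(0,l)\<close>.\<close>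

definition L2_on :: "real \<Rightarrow> L2 set" where
  "L2_on l = {f. AE x in lborel. x \<notin> {0<..<l} \<longrightarrow> rep_L2 f x = 0}"

definition L2_star :: "real \<Rightarrow> L2 set" where
  "L2_star l = {f \<in> L2_on l. (LBINT x:{0<..<l}. rep_L2 f x) = 0}"

text \<open>\<open>\<phi>\<close> is a test function, continuously differentiable with compact support in \<open>(0,l)\<close>,
  and \<open>\<phi>'\<close> is its derivative.\<close>

definition test_fun :: "real \<Rightarrow> (real \<Rightarrow> complex) \<Rightarrow> (real \<Rightarrow> complex) \<Rightarrow> bool" where
  "test_fun l \<phi> \<phi>' \<longleftrightarrow>
     (\<forall>x. (\<phi> has_vector_derivative \<phi>' x) (at x)) \<and> continuous_on UNIV \<phi>' \<and>
     (\<exists>a b. 0 < a \<and> a \<le> b \<and> b < l \<and> (\<forall>x. x \<notin> {a..b} \<longrightarrow> \<phi> x = 0))"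

definition has_weak_deriv :: "real \<Rightarrow> L2 \<Rightarrow> L2 \<Rightarrow> bool" where
  "has_weak_deriv l f g \<longleftrightarrow> f \<in> L2_on l \<and> g \<in> L2_on l \<and>
     (\<forall>\<phi> \<phi>'. test_fun l \<phi> \<phi>' \<longrightarrow>
        (LBINT x:{0<..<l}. rep_L2 f x * \<phi>' x) = - (LBINT x:{0<..<l}. rep_L2 g x * \<phi> x))"

definition weak_deriv :: "real \<Rightarrow> L2 \<Rightarrow> L2" where
  "weak_deriv l f = (THE g. has_weak_deriv l f g)"

definition H1 :: "real \<Rightarrow> L2 set" where
  "H1 l = {f. \<exists>g. has_weak_deriv l f g}"

definition H2 :: "real \<Rightarrow> L2 set" where
  "H2 l = {f \<in> H1 l. weak_deriv l f \<in> H1 l}"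

text \<open>The value at a point \<open>x \<in> [0,l]\<close> of an element of \<open>H\<^sup>1(0,l)\<close> is the value of its
  unique representative that is continuous on \<open>[0,l]\<close>.\<close>

definition value_at :: "real \<Rightarrow> L2 \<Rightarrow> real \<Rightarrow> complex" where
  "value_at l f x = (THE c. \<exists>F. continuous_on {0..l} F \<and>
     (AE t in lborel. t \<in> {0<..<l} \<longrightarrow> rep_L2 f t = F t) \<and> c = F x)"

definition H1_0 :: "real \<Rightarrow> L2 set" where
  "H1_0 l = {f \<in> H1 l. value_at l f 0 = 0 \<and> value_at l f l = 0}"

definition H1_star :: "real \<Rightarrow> L2 set" where
  "H1_star l = H1 l \<inter> L2_star l"


section \<open>The operators \<open>A\<close> and \<open>A\<^sub>*\<close> and fractional powers\<close>

definition opA :: "real \<Rightarrow> L2 \<Rightarrow> L2" where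
  "opA l f = - weak_deriv l (weak_deriv l f)"

definition domA :: "real \<Rightarrow> L2 set" where
  "domA l = H2 l \<inter> H1_0 l"

definition opA_star :: "real \<Rightarrow> L2 \<Rightarrow> L2" where
  "opA_star l f = - weak_deriv l (weak_deriv l f)"

definition domA_star :: "real \<Rightarrow> L2 set" where
  "domA_star l = {v \<in> H2 l \<inter> L2_star l.
     value_at l (weak_deriv l v) 0 = 0 \<and> value_at l (weak_deriv l v) l = 0}"

text \<open>\<open>e\<close> is an orthonormal basis of the subspace \<open>X\<close> consisting of eigenvectors of the
  positive operator \<open>T\<close> with domain \<open>D\<close>, with eigenvalues \<open>\<mu>\<close>.\<close>

definition eigenbasis ::
    "L2 set \<Rightarrow> L2 set \<Rightarrow> (L2 \<Rightarrow> L2) \<Rightarrow> (nat \<Rightarrow> L2) \<Rightarrow> (nat \<Rightarrow> real) \<Rightarrow> bool" where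
  "eigenbasis X D T e \<mu> \<longleftrightarrow>
     (\<forall>n. e n \<in> X \<inter> D \<and> \<mu> n > 0 \<and> T (e n) = \<mu> n *\<^sub>R e n) \<and>
     (\<forall>i j. cinner (e i) (e j) = (if i = j then 1 else 0)) \<and>
     (\<forall>f\<in>X. (\<forall>n. cinner f (e n) = 0) \<longrightarrow> f = 0)"

text \<open>\<open>T\<^sup>\<sigma> f = g\<close>, as given by the spectral decomposition of a positive self-adjoint operator
  with compact inverse. By the Riesz--Fischer theorem, for given \<open>f \<in> X\<close> such a \<open>g \<in> X\<close> exists iff
  \<open>\<Sum>n. (\<mu> n powr \<sigma>)\<^sup>2 * (cmod (cinner f (e n)))\<^sup>2\<close> converges; for \<open>\<sigma> \<le> 0\<close> this is no
  restriction. The choice of the eigenbasis is immaterial.\<close>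

definition has_frac_pow ::
    "L2 set \<Rightarrow> L2 set \<Rightarrow> (L2 \<Rightarrow> L2) \<Rightarrow> real \<Rightarrow> L2 \<Rightarrow> L2 \<Rightarrow> bool" where
  "has_frac_pow X D T \<sigma> f g \<longleftrightarrow> f \<in> X \<and> g \<in> X \<and>
     (\<exists>e \<mu>. eigenbasis X D T e \<mu> \<and>
        (\<forall>n. cinner g (e n) = complex_of_real (\<mu> n powr \<sigma>) * cinner f (e n)))"

definition A_star_pow :: "real \<Rightarrow> real \<Rightarrow> L2 \<Rightarrow> L2" where
  "A_star_pow l \<sigma> f = (THE g. has_frac_pow (L2_star l) (domA_star l) (opA_star l) \<sigma> f g)"


section \<open>Phase space and system operator\<close>

type_synonym state = "L2 \<times> L2 \<times> L2 \<times> L2 \<times> L2 \<times> L2 \<times> L2 \<times> L2"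

text \<open>Here \<open>D(A\<^sup>1\<^sup>/\<^sup>2) = H\<^sup>1\<^sub>0(0,l)\<close> and \<open>D(A\<^sub>*\<^sup>1\<^sup>/\<^sup>2) = H\<^sup>1(0,l) \<inter> L\<^sup>2\<^sub>*(0,l)\<close> are used.\<close>

definition phase_space :: "real \<Rightarrow> state set" where
  "phase_space l =
     H1_0 l \<times> L2_on l \<times> H1_star l \<times> L2_star l \<times> H1_0 l \<times> L2_on l \<times> H1_star l \<times> L2_star l"

definition phase_norm :: "real \<Rightarrow> real \<Rightarrow> real \<Rightarrow> real \<Rightarrow> real \<Rightarrow> real \<Rightarrow>
    real \<Rightarrow> real \<Rightarrow> real \<Rightarrow> real \<Rightarrow> state \<Rightarrow> real" where
  "phase_norm l m b\<^sub>1 b\<^sub>2 \<kappa>\<^sub>1 \<kappa>\<^sub>2 \<rho>\<^sub>1 \<rho>\<^sub>2 \<rho>\<^sub>3 \<rho>\<^sub>4 = (\<lambda>(u, u', v, v', y, y', z, z').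
     sqrt (\<rho>\<^sub>1 * (norm u')\<^sup>2 + \<rho>\<^sub>2 * (norm v')\<^sup>2 + \<rho>\<^sub>3 * (norm y')\<^sup>2 + \<rho>\<^sub>4 * (norm z')\<^sup>2 +
       \<kappa>\<^sub>1 * (norm (weak_deriv l u - v))\<^sup>2 + \<kappa>\<^sub>2 * (norm (weak_deriv l y - z))\<^sup>2 +
       m * (norm (y - u))\<^sup>2 +
       b\<^sub>1 * (norm (A_star_pow l (1/2) v))\<^sup>2 + b\<^sub>2 * (norm (A_star_pow l (1/2) z))\<^sup>2))"

definition sys_dom :: "real \<Rightarrow> real \<Rightarrow> real \<Rightarrow> real \<Rightarrow> real \<Rightarrow>
    real \<Rightarrow> real \<Rightarrow> real \<Rightarrow> real \<Rightarrow> real \<Rightarrow> real \<Rightarrow> state set" where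
  "sys_dom l b\<^sub>1 b\<^sub>2 \<kappa>\<^sub>1 \<kappa>\<^sub>2 \<gamma>\<^sub>1 \<gamma>\<^sub>2 \<gamma>\<^sub>3 \<gamma>\<^sub>4 \<alpha> \<beta> =
     {(u, u', v, v', y, y', z, z'). (u, u', v, v', y, y', z, z') \<in> phase_space l \<and>
        u' \<in> H1_0 l \<and> v' \<in> H1_star l \<and> y' \<in> H1_0 l \<and> z' \<in> H1_star l \<and>
        \<kappa>\<^sub>1 *\<^sub>R u + \<gamma>\<^sub>1 *\<^sub>R u' \<in> domA l \<and> \<kappa>\<^sub>2 *\<^sub>R y + \<gamma>\<^sub>3 *\<^sub>R y' \<in> domA l \<and>
        b\<^sub>1 *\<^sub>R v + \<gamma>\<^sub>2 *\<^sub>R A_star_pow l (\<alpha> - 1) v' \<in> domA_star l \<and>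
        b\<^sub>2 *\<^sub>R z + \<gamma>\<^sub>4 *\<^sub>R A_star_pow l (\<beta> - 1) z' \<in> domA_star l}"

definition sys_op :: "real \<Rightarrow> real \<Rightarrow> real \<Rightarrow> real \<Rightarrow> real \<Rightarrow> real \<Rightarrow> real \<Rightarrow> real \<Rightarrow> real \<Rightarrow> real \<Rightarrow>
    real \<Rightarrow> real \<Rightarrow> real \<Rightarrow> real \<Rightarrow> real \<Rightarrow> real \<Rightarrow> state \<Rightarrow> state" where
  "sys_op l m b\<^sub>1 b\<^sub>2 \<kappa>\<^sub>1 \<kappa>\<^sub>2 \<rho>\<^sub>1 \<rho>\<^sub>2 \<rho>\<^sub>3 \<rho>\<^sub>4 \<gamma>\<^sub>1 \<gamma>\<^sub>2 \<gamma>\<^sub>3 \<gamma>\<^sub>4 \<alpha> \<beta> = (\<lambda>(u, u', v, v', y, y', z, z').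
     (u',
      (- opA l (\<kappa>\<^sub>1 *\<^sub>R u + \<gamma>\<^sub>1 *\<^sub>R u') - \<kappa>\<^sub>1 *\<^sub>R weak_deriv l v - \<gamma>\<^sub>1 *\<^sub>R weak_deriv l v'
         + m *\<^sub>R (y - u)) /\<^sub>R \<rho>\<^sub>1,
      v',
      (- opA_star l (b\<^sub>1 *\<^sub>R v + \<gamma>\<^sub>2 *\<^sub>R A_star_pow l (\<alpha> - 1) v')
         + \<kappa>\<^sub>1 *\<^sub>R (weak_deriv l u - v) + \<gamma>\<^sub>1 *\<^sub>R (weak_deriv l u' - v')) /\<^sub>R \<rho>\<^sub>2,
      y',
      (- opA l (\<kappa>\<^sub>2 *\<^sub>R y + \<gamma>\<^sub>3 *\<^sub>R y') - \<kappa>\<^sub>2 *\<^sub>R weak_deriv l z - \<gamma>\<^sub>3 *\<^sub>R weak_deriv l z'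
         - m *\<^sub>R (y - u)) /\<^sub>R \<rho>\<^sub>3,
      z',
      (- opA_star l (b\<^sub>2 *\<^sub>R z + \<gamma>\<^sub>4 *\<^sub>R A_star_pow l (\<beta> - 1) z')
         + \<kappa>\<^sub>2 *\<^sub>R (weak_deriv l y - z) + \<gamma>\<^sub>3 *\<^sub>R (weak_deriv l y' - z')) /\<^sub>R \<rho>\<^sub>4))"


section \<open>Strongly continuous semigroups\<close>

text \<open>Semigroups of bounded complex linear operators on a subspace \<open>X\<close> normed by \<open>N\<close>, where
  \<open>N\<close> need not be the norm of the ambient type.\<close>

definition c0_semigroup ::
    "'a::complex_vector set \<Rightarrow> ('a \<Rightarrow> real) \<Rightarrow> (real \<Rightarrow> 'a \<Rightarrow> 'a) \<Rightarrow> bool" where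
  "c0_semigroup X N S \<longleftrightarrow>
     (\<forall>t\<ge>0. \<forall>U\<in>X. S t U \<in> X) \<and>
     (\<forall>t\<ge>0. \<forall>U\<in>X. \<forall>V\<in>X. S t (U + V) = S t U + S t V) \<and>
     (\<forall>t\<ge>0. \<forall>c. \<forall>U\<in>X. S t (c *\<^sub>C U) = c *\<^sub>C S t U) \<and>
     (\<forall>t\<ge>0. \<exists>C. \<forall>U\<in>X. N (S t U) \<le> C * N U) \<and>
     (\<forall>U\<in>X. S 0 U = U) \<and>
     (\<forall>s\<ge>0. \<forall>t\<ge>0. \<forall>U\<in>X. S (s + t) U = S s (S t U)) \<and>
     (\<forall>U\<in>X. ((\<lambda>t. N (S t U - U)) \<longlongrightarrow> 0) (at_right 0))"

definition generator_graph ::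
    "'a::complex_vector set \<Rightarrow> ('a \<Rightarrow> real) \<Rightarrow> (real \<Rightarrow> 'a \<Rightarrow> 'a) \<Rightarrow> ('a \<times> 'a) set" where
  "generator_graph X N S =
     {(U, V). U \<in> X \<and> V \<in> X \<and> ((\<lambda>t. N ((S t U - U) /\<^sub>R t - V)) \<longlongrightarrow> 0) (at_right 0)}"

definition generates_c0 ::
    "'a::complex_vector set \<Rightarrow> ('a \<Rightarrow> real) \<Rightarrow> 'a set \<Rightarrow> ('a \<Rightarrow> 'a) \<Rightarrow> (real \<Rightarrow> 'a \<Rightarrow> 'a) \<Rightarrow> bool" where
  "generates_c0 X N D B S \<longleftrightarrow>
     c0_semigroup X N S \<and> generator_graph X N S = {(U, B U) | U. U \<in> D}"

definition op_norm :: "'a set \<Rightarrow> ('a \<Rightarrow> real) \<Rightarrow> ('a \<Rightarrow> 'a) \<Rightarrow> real" where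
  "op_norm X N T = (SUP U\<in>{U \<in> X. N U \<le> 1}. N (T U))"

end

theory Submission
  imports Defs
begin

text \<open>Write \<open>D\<close> for \<open>\<partial>\<^sub>x\<close> and \<open>\<delta>\<close> for the dissipation, so that the energy satisfies
  \<open>d/dt (1/2) \<parallel>U\<parallel>\<^sup>2 = - \<delta>\<close>. Since both shear stresses and both rotations are damped, \<open>\<delta>\<close> controls the whole
  kinetic energy, by Poincare's inequality. The multiplier \<open>F U = Re (\<rho>\<^sub>1 \<langle>u', u\<rangle> + \<rho>\<^sub>2 \<langle>v', v\<rangle> + \<rho>\<^sub>3 \<langle>y', y\<rangle> + \<rho>\<^sub>4 \<langle>z', z\<rangle>)\<close>
  recovers the potential energy: \<open>d/dt F U \<le> - (1/2) \<parallel>U\<parallel>\<^sup>2 + C \<delta>\<close>, where \<open>\<alpha>, \<beta> \<le> 1\<close> bounds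
  \<open>\<parallel>D A\<^sub>*\<^sup>\<alpha>\<^sup>-\<^sup>1 v'\<parallel>\<^sup>2\<close> by a multiple of \<open>\<langle>D A\<^sub>*\<^sup>\<alpha>\<^sup>-\<^sup>1 v', D v'\<rangle>\<close>. Hence \<open>(1/2) \<parallel>U\<parallel>\<^sup>2 + \<epsilon> F U\<close> is a Lyapunov
  functional for small \<open>\<epsilon> > 0\<close>.

  The function spaces are handled by Fourier series: membership in \<open>H\<^sup>1\<close> or \<open>H\<^sup>1\<^sub>0\<close> and the value of the weak
  derivative are linear relations between the sine and cosine coefficients, and \<open>A\<^sub>*\<^sup>\<sigma>\<close> is diagonal in the
  cosines.\<close>

section \<open>The Hilbert space of square integrable functions\<close>

text \<open>The energy computation itself is short; the development is shaped by what it
  presupposes. The semigroup enters only through the graph of its generator, so orbits must first be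
  shown to be continuous and to be differentiable at positive times. Strong continuity at 0 is used
  for this together with a uniform bound for S(t) on bounded time intervals, hence with a uniform
  boundedness argument, hence with completeness of the phase space and of \<open>L2\<close>. The
  phase space is a subset of a product type whose own norm is not the energy norm; the map
  \<open>J\<close> therefore embeds it isometrically into a nine-fold product of \<open>L2\<close>,
  where the energy norm is the norm of the type. \<open>H1_0\<close> is defined through values of
  continuous representatives, and \<open>A_star_pow\<close> by a definite description over all
  eigenbases; both are first rewritten in coefficients. Derivatives are tested against the family
  for which boundary terms vanish: sines for any element of \<open>H1\<close>, cosines for elements
  of \<open>H1_0\<close>.\<close>

lemma rep_abs_L2: "sq_int f \<Longrightarrow> AE x in lborel. rep_L2 (abs_L2 f) x = f x"
  using Quotient_rep_abs[OF Quotient_L2, of f] by (auto simp: L2_rel_def)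

lemma abs_rep_L2 [simp]: "abs_L2 (rep_L2 f) = f"
  by (rule Quotient_abs_rep[OF Quotient_L2])

lemma abs_L2_eqI:
  assumes "sq_int f" "sq_int g" "AE x in lborel. f x = g x"
  shows "abs_L2 f = abs_L2 g"
  using Quotient_rel[OF Quotient_L2, of f g] assms by (auto simp: L2_rel_def)

lemma L2_eqI:
  assumes "AE x in lborel. rep_L2 f x = rep_L2 g x"
  shows "f = g"
  using abs_L2_eqI[OF rep_L2_sq_int rep_L2_sq_int assms] by simp

lemma rep_L2_measurable [measurable]: "rep_L2 f \<in> borel_measurable borel"
  using rep_L2_sq_int[of f] by (simp add: sq_int_def)

lemma rep_L2_zero: "AE x in lborel. rep_L2 0 x = 0"
  unfolding zero_L2_def by (rule rep_abs_L2[OF sq_int_zero])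

lemma rep_L2_add: "AE x in lborel. rep_L2 (f + g) x = rep_L2 f x + rep_L2 g x"
  unfolding plus_L2_def by (simp, rule rep_abs_L2, intro sq_int_add rep_L2_sq_int)

lemma rep_L2_diff: "AE x in lborel. rep_L2 (f - g) x = rep_L2 f x - rep_L2 g x"
  unfolding minus_L2_def by (simp, rule rep_abs_L2, intro sq_int_diff rep_L2_sq_int)

lemma rep_L2_scaleR: "AE x in lborel. rep_L2 (r *\<^sub>R f) x = complex_of_real r * rep_L2 f x"
  unfolding scaleR_L2_def by (simp, rule rep_abs_L2, intro sq_int_scale rep_L2_sq_int)

lemma rep_L2_scaleC: "AE x in lborel. rep_L2 (c *\<^sub>C f) x = c * rep_L2 f x"
  unfolding scaleC_L2_def by (simp, rule rep_abs_L2, intro sq_int_scale rep_L2_sq_int)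

lemma norm_L2_sq: "(norm f)\<^sup>2 = (LBINT x. (cmod (rep_L2 f x))\<^sup>2)" for f :: L2
proof -
  have "(norm f)\<^sup>2 = inner f f"
    by (rule power2_norm_eq_inner)
  then show ?thesis
    by (simp only: inner_L2_def Re_cinner_self)
qed


section \<open>The complex inner product\<close>

lemma cinner_scaleC_left [simp]: "cinner (c *\<^sub>C f) g = c * cinner f g"
  by transfer (simp add: mult.assoc)

lemma cinner_scaleC_right [simp]: "cinner f (c *\<^sub>C g) = cnj c * cinner f g"
  by (metis cinner_commute cinner_scaleC_left complex_cnj_mult)

lemma cinner_add_right: "cinner f (g + h) = cinner f g + cinner f h"
  by (metis cinner_commute cinner_add_left complex_cnj_add)

lemma cinner_scaleR_right: "cinner f (r *\<^sub>R g) = complex_of_real r * cinner f g"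
  by (metis cinner_commute cinner_scaleR_left complex_cnj_mult complex_cnj_complex_of_real)

lemma cinner_self: "cinner f f = complex_of_real ((norm f)\<^sup>2)"
proof -
  have "Im (cinner f f) = 0"
    using arg_cong[OF cinner_commute[of f f], of Im] by simp
  then show ?thesis
    by (simp add: complex_eq_iff power2_norm_eq_inner inner_L2_def)
qed

lemma norm_scaleC: "norm (c *\<^sub>C f) = cmod c * norm f" for f :: L2
proof -
  have "complex_of_real ((norm (c *\<^sub>C f))\<^sup>2) = (c * cnj c) * cinner f f"
    unfolding cinner_self[symmetric] by simp
  also have "\<dots> = complex_of_real ((cmod c * norm f)\<^sup>2)"
    by (simp only: cinner_self complex_norm_square[symmetric] power_mult_distrib of_real_mult)
  finally have "(norm (c *\<^sub>C f))\<^sup>2 = (cmod c * norm f)\<^sup>2"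
    using of_real_eq_iff by blast
  then show ?thesis
    by (simp add: power2_eq_iff_nonneg)
qed

lemma cinner_Cauchy_Schwarz: "cmod (cinner f g) \<le> norm f * norm g"
proof (cases "cinner f g = 0")
  case False
  \<comment> \<open>A unimodular factor that turns \<open>cinner f g\<close> into its modulus, so
    that the real Cauchy-Schwarz inequality applies.\<close>
  define c where "c = cnj (cinner f g) / complex_of_real (cmod (cinner f g))"
  have c: "cmod c = 1"
    using False by (simp add: c_def norm_divide)
  have "cinner (c *\<^sub>C f) g = complex_of_real (cmod (cinner f g))"
    using False by (simp add: c_def power2_eq_square field_simps flip: complex_norm_square)
  then have "cmod (cinner f g) = inner (c *\<^sub>C f) g"
    by (simp add: inner_L2_def)
  also have "\<dots> \<le> norm (c *\<^sub>C f) * norm g"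
    by (rule norm_cauchy_schwarz)
  finally show ?thesis
    by (simp add: norm_scaleC c)
qed simp

lemma bounded_linear_cinner_left: "bounded_linear (\<lambda>f. cinner f g)"
  by (rule bounded_linear_intro[where K = "norm g"])
    (auto simp: cinner_add_left cinner_scaleR_left scaleR_conv_of_real cinner_Cauchy_Schwarz)

lemma bounded_linear_cinner_right: "bounded_linear (\<lambda>g. cinner f g)"
  by (rule bounded_linear_intro[where K = "norm f"])
    (auto simp: cinner_add_right cinner_scaleR_right scaleR_conv_of_real mult.commute[of _ "norm f"]
      cinner_Cauchy_Schwarz)

lemmas cinner_left_simps =
  linear_0[OF bounded_linear.linear[OF bounded_linear_cinner_left]]
  linear_diff[OF bounded_linear.linear[OF bounded_linear_cinner_left]]
  linear_neg[OF bounded_linear.linear[OF bounded_linear_cinner_left]]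

lemmas cinner_right_simps =
  linear_0[OF bounded_linear.linear[OF bounded_linear_cinner_right]]
  linear_diff[OF bounded_linear.linear[OF bounded_linear_cinner_right]]
  linear_neg[OF bounded_linear.linear[OF bounded_linear_cinner_right]]

lemmas cinner_simps = cinner_left_simps cinner_right_simps cinner_add_left cinner_add_right
  cinner_scaleR_left cinner_scaleR_right

lemma cinner_sum_left: "cinner (sum f A) g = (\<Sum>i\<in>A. cinner (f i) g)"
  by (rule linear_sum[OF bounded_linear.linear[OF bounded_linear_cinner_left]])

lemmas tendsto_cinner_left = bounded_linear.tendsto[OF bounded_linear_cinner_left]


section \<open>Completeness of L^2\<close>

lemma nn_integral_L2_sq: "(\<integral>\<^sup>+x. ennreal ((cmod (rep_L2 f x))\<^sup>2) \<partial>lborel) = ennreal ((norm f)\<^sup>2)"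
  unfolding norm_L2_sq
  by (rule nn_integral_eq_integral) (use rep_L2_sq_int[of f] in \<open>auto simp: sq_int_def\<close>)

text \<open>Riesz--Fischer: along a subsequence with fast decreasing increments \<open>d\<^sub>k\<close>, the sum
  \<open>\<Sum>k. 2 ^ k * \<bar>d\<^sub>k\<bar>\<^sup>2\<close> has a finite integral, whence \<open>\<Sum>k. \<bar>d\<^sub>k\<bar>\<close> is finite almost everywhere.\<close>

lemma L2_fast_Cauchy_AE:
  fixes X :: "nat \<Rightarrow> L2"
  assumes "\<And>k. norm (X (Suc k) - X k) \<le> (1/2) ^ k"
  shows "AE x in lborel. convergent (\<lambda>k. rep_L2 (X k) x)"
proof -
  define d where "d k = rep_L2 (X (Suc k) - X k)" for k
  have [measurable]: "d k \<in> borel_measurable borel" for k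
    by (simp add: d_def)
  have "(\<integral>\<^sup>+x. (\<Sum>k. ennreal (2 ^ k) * ennreal ((cmod (d k x))\<^sup>2)) \<partial>lborel)
      = (\<Sum>k. \<integral>\<^sup>+x. ennreal (2 ^ k) * ennreal ((cmod (d k x))\<^sup>2) \<partial>lborel)"
    by (rule nn_integral_suminf) measurable
  also have "\<dots> = (\<Sum>k. ennreal (2 ^ k * (norm (X (Suc k) - X k))\<^sup>2))"
    by (subst nn_integral_cmult) (auto simp: d_def nn_integral_L2_sq ennreal_mult)
  also have "\<dots> \<le> (\<Sum>k. ennreal ((1/2) ^ k))"
  proof (rule suminf_le)
    fix k
    have "(norm (X (Suc k) - X k))\<^sup>2 \<le> ((1/2) ^ k)\<^sup>2"
      by (rule power_mono[OF assms]) simp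
    then have "2 ^ k * (norm (X (Suc k) - X k))\<^sup>2 \<le> 2 ^ k * ((1/2) ^ k)\<^sup>2"
      by simp
    also have "\<dots> = ((1/2)::real) ^ k"
      by (simp add: power2_eq_square field_simps flip: power_mult_distrib)
    finally show "ennreal (2 ^ k * (norm (X (Suc k) - X k))\<^sup>2) \<le> ennreal ((1/2) ^ k)"
      by (rule ennreal_leI)
  qed auto
  also have "\<dots> = ennreal (\<Sum>k. (1/2) ^ k)"
    by (rule suminf_ennreal2) (auto simp: summable_geometric)
  also have "\<dots> < \<infinity>"
    by simp
  finally have "AE x in lborel. (\<Sum>k. ennreal (2 ^ k) * ennreal ((cmod (d k x))\<^sup>2)) \<noteq> \<infinity>"
    by (intro nn_integral_PInf_AE) auto
  moreover have "AE x in lborel. \<forall>k. rep_L2 (X (Suc k) - X k) x = rep_L2 (X (Suc k)) x - rep_L2 (X k) x"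
    unfolding AE_all_countable using rep_L2_diff by blast
  ultimately show ?thesis
  proof eventually_elim
    case (elim x)
    have "(\<Sum>k. ennreal (2 ^ k * (cmod (d k x))\<^sup>2)) \<noteq> \<infinity>"
      using elim(1) by (simp add: ennreal_mult)
    then have "summable (\<lambda>k. 2 ^ k * (cmod (d k x))\<^sup>2)"
      by (intro summable_suminf_not_top) auto
    \<comment> \<open>The terms of a convergent series are bounded, so |d_k| is at most
      \<open>sqrt C\<close> times the k-th power of \<open>sqrt (1/2)\<close>; the weight 2^k serves
      to produce this geometric decay.\<close>
    then have "Bseq (\<lambda>k. 2 ^ k * (cmod (d k x))\<^sup>2)"
      using convergent_imp_Bseq convergent_def summable_LIMSEQ_zero by blast
    then obtain C where C: "C > 0" "\<And>k. 2 ^ k * (cmod (d k x))\<^sup>2 \<le> C"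
      by (auto simp: Bseq_def)
    have "cmod (d k x) \<le> sqrt C * (sqrt (1/2)) ^ k" for k
    proof -
      have "(cmod (d k x))\<^sup>2 \<le> C * (1/2) ^ k"
        using C(2)[of k] by (simp add: field_simps power_divide)
      then have "cmod (d k x) \<le> sqrt (C * (1/2) ^ k)"
        by (rule real_le_rsqrt)
      then show ?thesis
        by (simp only: real_sqrt_mult real_sqrt_power)
    qed
    moreover have "summable (\<lambda>k. sqrt C * (sqrt (1/2)) ^ k)"
      by (intro summable_mult summable_geometric) (auto simp: real_sqrt_divide)
    ultimately have "summable (\<lambda>k. d k x)"
      by (meson summable_comparison_test)
    then have "convergent (\<lambda>n. \<Sum>k<n. rep_L2 (X (Suc k)) x - rep_L2 (X k) x)"
      using elim(2) by (simp add: summable_iff_convergent d_def)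
    then have "convergent (\<lambda>n. rep_L2 (X n) x - rep_L2 (X 0) x)"
      using sum_lessThan_telescope[of "\<lambda>k. rep_L2 (X k) x"] by simp
    then show ?case
      using convergent_diff_const_right_iff by blast
  qed
qed

text \<open>The pointwise limit \<open>F\<close> is a limit in L^2 by Fatou's lemma: the distance
  from \<open>F\<close> to X_k is at most any bound for the distances from X_n to X_k with n >= k.
  The Cauchy property makes such a bound finite for one index, which puts \<open>F\<close> into L^2,
  and small for large indices, which gives convergence.\<close>

lemma L2_fast_Cauchy_convergent:
  fixes X :: "nat \<Rightarrow> L2"
  assumes fast: "\<And>k. norm (X (Suc k) - X k) \<le> (1/2) ^ k" and "Cauchy X"
  shows "convergent X"
proof -
  define F where "F x = lim (\<lambda>k. rep_L2 (X k) x)" for x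
  have [measurable]: "F \<in> borel_measurable borel"
    unfolding F_def by (rule borel_measurable_lim_metric) simp
  have lim: "AE x in lborel. (\<lambda>k. rep_L2 (X k) x) \<longlonglongrightarrow> F x"
    using L2_fast_Cauchy_AE[OF fast] by eventually_elim (simp add: F_def convergent_LIMSEQ_iff)
  have est: "(\<integral>\<^sup>+x. ennreal ((cmod (F x - rep_L2 (X k) x))\<^sup>2) \<partial>lborel) \<le> ennreal (e\<^sup>2)"
    if e: "\<And>n. n \<ge> k \<Longrightarrow> norm (X n - X k) \<le> e" for k e
  proof -
    have 1: "AE x in lborel. ennreal ((cmod (F x - rep_L2 (X k) x))\<^sup>2)
        = liminf (\<lambda>n. ennreal ((cmod (rep_L2 (X n) x - rep_L2 (X k) x))\<^sup>2))"
      using lim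
    proof eventually_elim
      case (elim x)
      then have "(\<lambda>n. ennreal ((cmod (rep_L2 (X n) x - rep_L2 (X k) x))\<^sup>2))
          \<longlonglongrightarrow> ennreal ((cmod (F x - rep_L2 (X k) x))\<^sup>2)"
        by (intro tendsto_intros)
      then show ?case
        by (intro lim_imp_Liminf[symmetric]) auto
    qed
    have 2: "(\<integral>\<^sup>+x. ennreal ((cmod (rep_L2 (X n) x - rep_L2 (X k) x))\<^sup>2) \<partial>lborel)
        = ennreal ((norm (X n - X k))\<^sup>2)" for n
      unfolding nn_integral_L2_sq[symmetric]
      by (rule nn_integral_cong_AE) (use rep_L2_diff[of "X n" "X k"] in \<open>eventually_elim, simp\<close>)
    have "(\<integral>\<^sup>+x. ennreal ((cmod (F x - rep_L2 (X k) x))\<^sup>2) \<partial>lborel)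
        = (\<integral>\<^sup>+x. liminf (\<lambda>n. ennreal ((cmod (rep_L2 (X n) x - rep_L2 (X k) x))\<^sup>2)) \<partial>lborel)"
      by (rule nn_integral_cong_AE[OF 1])
    also have "\<dots> \<le> liminf (\<lambda>n. ennreal ((norm (X n - X k))\<^sup>2))"
      unfolding 2[symmetric] by (rule nn_integral_liminf) measurable
    also have "\<dots> \<le> liminf (\<lambda>n. ennreal (e\<^sup>2))"
      by (rule Liminf_mono) (auto simp: eventually_sequentially intro!: exI[of _ k] ennreal_leI power_mono e)
    finally show ?thesis
      by (simp only: Liminf_const[OF trivial_limit_sequentially])
  qed
  have sq: "sq_int (\<lambda>x. F x - rep_L2 (X k) x)" for k
  proof -
    obtain N where N: "\<And>m n. m \<ge> N \<Longrightarrow> n \<ge> N \<Longrightarrow> dist (X m) (X n) < 1"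
      using \<open>Cauchy X\<close> unfolding Cauchy_def by (meson zero_less_one)
    have "(\<integral>\<^sup>+x. ennreal ((cmod (F x - rep_L2 (X N) x))\<^sup>2) \<partial>lborel) \<le> ennreal (1\<^sup>2)"
      by (rule est) (use N in \<open>auto simp: dist_norm less_imp_le\<close>)
    then have "sq_int (\<lambda>x. F x - rep_L2 (X N) x)"
      by (auto simp: sq_int_def integrable_iff_bounded intro: le_less_trans)
    then have "sq_int (\<lambda>x. (F x - rep_L2 (X N) x) + rep_L2 (X N) x - rep_L2 (X k) x)"
      by (rule sq_int_diff[OF sq_int_add[OF _ rep_L2_sq_int] rep_L2_sq_int])
    then show ?thesis
      by simp
  qed
  have "sq_int (\<lambda>x. F x - rep_L2 (X 0) x + rep_L2 (X 0) x)"
    by (rule sq_int_add[OF sq rep_L2_sq_int])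
  then have F: "sq_int F"
    by simp
  have bound: "norm (abs_L2 F - X k) \<le> e" if e: "\<And>n. n \<ge> k \<Longrightarrow> norm (X n - X k) \<le> e" for k e
  proof -
    have "0 \<le> e"
      using e[of k] by simp
    have "ennreal ((norm (abs_L2 F - X k))\<^sup>2) = (\<integral>\<^sup>+x. ennreal ((cmod (F x - rep_L2 (X k) x))\<^sup>2) \<partial>lborel)"
      unfolding nn_integral_L2_sq[symmetric]
      by (rule nn_integral_cong_AE)
        (use rep_L2_diff[of "abs_L2 F" "X k"] rep_abs_L2[OF F] in \<open>eventually_elim, simp\<close>)
    also note est[OF e]
    finally show ?thesis
      using \<open>0 \<le> e\<close> by (simp add: ennreal_le_iff abs_le_square_iff[symmetric])
  qed
  have "X \<longlonglongrightarrow> abs_L2 F"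
  proof (rule LIMSEQ_I)
    fix r :: real assume "0 < r"
    then obtain N where N: "\<And>m n. m \<ge> N \<Longrightarrow> n \<ge> N \<Longrightarrow> dist (X m) (X n) < r / 2"
      using \<open>Cauchy X\<close> unfolding Cauchy_def by (meson half_gt_zero)
    have "norm (X k - abs_L2 F) < r" if "k \<ge> N" for k
    proof -
      have "norm (abs_L2 F - X k) \<le> r / 2"
        by (rule bound) (use N that in \<open>auto simp: dist_norm intro!: less_imp_le\<close>)
      then show ?thesis
        using \<open>0 < r\<close> by (simp add: norm_minus_commute)
    qed
    then show "\<exists>no. \<forall>n\<ge>no. norm (X n - abs_L2 F) < r"
      by blast
  qed
  then show ?thesis
    by (auto simp: convergent_def)
qed

instance L2 :: complete_space
proof
  fix X :: "nat \<Rightarrow> L2" assume X: "Cauchy X"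
  have "\<exists>N. \<forall>m\<ge>N. \<forall>n\<ge>N. dist (X m) (X n) < (1/2) ^ k" for k :: nat
    using X unfolding Cauchy_def by simp
  then obtain N where N: "\<And>k m n. m \<ge> N k \<Longrightarrow> n \<ge> N k \<Longrightarrow> dist (X m) (X n) < (1/2) ^ k"
    by metis
  \<comment> \<open>The sum dominates \<open>N k\<close>, and the summand \<open>k\<close> makes
    \<open>r\<close> strictly increasing.\<close>
  define r where "r k = k + (\<Sum>i\<le>k. N i)" for k
  have r: "strict_mono r"
    by (auto simp: strict_mono_Suc_iff r_def)
  have rN: "N k \<le> r k" for k
    by (simp add: r_def trans_le_add2 member_le_sum)
  have "norm ((X \<circ> r) (Suc k) - (X \<circ> r) k) \<le> (1/2) ^ k" for k
    using N[of k "r (Suc k)" "r k"] rN[of k] strict_monoD[OF r, of k "Suc k"]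
    by (simp add: dist_norm)
  moreover have "Cauchy (X \<circ> r)"
    by (rule Cauchy_subseq_Cauchy[OF X r])
  ultimately have "convergent (X \<circ> r)"
    by (rule L2_fast_Cauchy_convergent)
  then obtain L where L: "(X \<circ> r) \<longlonglongrightarrow> L"
    by (auto simp: convergent_def)
  have "X \<longlonglongrightarrow> L"
  proof (rule metric_LIMSEQ_I)
    fix e :: real assume e: "e > 0"
    obtain M where M: "\<And>m n. m \<ge> M \<Longrightarrow> n \<ge> M \<Longrightarrow> dist (X m) (X n) < e / 2"
      using X e unfolding Cauchy_def by (meson half_gt_zero)
    obtain K where K: "\<And>k. k \<ge> K \<Longrightarrow> dist (X (r k)) L < e / 2"
      using metric_LIMSEQ_D[OF L, of "e / 2"] e by auto
    have "dist (X n) L < e" if "n \<ge> M" for n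
    proof -
      define k where "k = max K M"
      have "r k \<ge> M"
        using seq_suble[OF r, of k] by (simp add: k_def)
      then show ?thesis
        using M[OF that, of "r k"] K[of k] dist_triangle_half_r[of "X (r k)" "X n" e L]
        by (simp add: k_def dist_commute)
    qed
    then show "\<exists>no. \<forall>n\<ge>no. dist (X n) L < e"
      by blast
  qed
  then show "convergent X"
    by (auto simp: convergent_def)
qed

instance L2 :: banach ..

section \<open>Orthonormal bases\<close>

text \<open>Closedness of the subspace is what keeps infinite sums of basis vectors in
  \<open>Y\<close>. The index runs over all of \<open>nat\<close>, so families starting at frequency
  1 appear with \<open>Suc n\<close>.\<close>

definition L2_onb :: "L2 set \<Rightarrow> (nat \<Rightarrow> L2) \<Rightarrow> bool" where
  "L2_onb Y e \<longleftrightarrow> closed Y \<and> 0 \<in> Y \<and> (\<forall>f\<in>Y. \<forall>g\<in>Y. f + g \<in> Y) \<and> (\<forall>c. \<forall>f\<in>Y. c *\<^sub>C f \<in> Y) \<and>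
     (\<forall>n. e n \<in> Y) \<and> (\<forall>i j. cinner (e i) (e j) = (if i = j then 1 else 0)) \<and>
     (\<forall>f\<in>Y. (\<forall>n. cinner f (e n) = 0) \<longrightarrow> f = 0)"

lemma L2_onbD:
  assumes "L2_onb Y e"
  shows "closed Y" "0 \<in> Y" "f \<in> Y \<Longrightarrow> g \<in> Y \<Longrightarrow> f + g \<in> Y" "f \<in> Y \<Longrightarrow> c *\<^sub>C f \<in> Y"
    "e n \<in> Y" "cinner (e i) (e j) = (if i = j then 1 else 0)"
    "f \<in> Y \<Longrightarrow> (\<And>n. cinner f (e n) = 0) \<Longrightarrow> f = 0"
  using assms unfolding L2_onb_def by auto

lemma L2_onb_diff: "L2_onb Y e \<Longrightarrow> f \<in> Y \<Longrightarrow> g \<in> Y \<Longrightarrow> f - g \<in> Y"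
  using L2_onbD(3)[of Y e f "(-1) *\<^sub>R g"] L2_onbD(4)[of Y e g "complex_of_real (-1)"]
    scaleR_scaleC[of "-1" g] by simp

lemma L2_onb_eqI:
  assumes "L2_onb Y e" "f \<in> Y" "g \<in> Y" "\<And>n. cinner f (e n) = cinner g (e n)"
  shows "f = g"
  using L2_onbD(7)[OF assms(1) L2_onb_diff[OF assms(1-3)]] assms(4) by (simp add: cinner_simps)

lemma L2_onb_sum_mem:
  assumes "L2_onb Y e" shows "(\<Sum>i\<in>A. a i *\<^sub>C e i) \<in> Y"
  by (induction A rule: infinite_finite_induct) (auto intro: L2_onbD[OF assms])

lemma cinner_onb_sum:
  assumes "L2_onb Y e" "finite A"
  shows "cinner (\<Sum>i\<in>A. a i *\<^sub>C e i) (e n) = (if n \<in> A then a n else 0)"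
  using assms(2) by (simp add: cinner_sum_left L2_onbD(6)[OF assms(1)] if_distrib cong: if_cong)

lemma norm_onb_sum:
  assumes "L2_onb Y e" "finite A"
  shows "(norm (\<Sum>i\<in>A. a i *\<^sub>C e i))\<^sup>2 = (\<Sum>i\<in>A. (cmod (a i))\<^sup>2)"
proof -
  let ?s = "\<Sum>i\<in>A. a i *\<^sub>C e i"
  have "cinner ?s ?s = (\<Sum>i\<in>A. a i * cnj (cinner ?s (e i)))"
    by (subst cinner_sum_left) (metis (no_types) cinner_commute cinner_scaleC_left)
  also have "\<dots> = (\<Sum>i\<in>A. complex_of_real ((cmod (a i))\<^sup>2))"
    by (intro sum.cong refl) (simp only: cinner_onb_sum[OF assms] if_True complex_norm_square)
  finally show ?thesis
    using of_real_eq_iff[where 'a = complex] by (simp only: cinner_self flip: of_real_sum)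
qed

text \<open>The partial sum \<open>s\<close> satisfies <s, f> = |s|^2, so that |f - s|^2 = |f|^2 -
  |s|^2.\<close>

lemma bessel_sum:
  assumes e: "L2_onb Y e" and "finite A"
  shows "(\<Sum>i\<in>A. (cmod (cinner f (e i)))\<^sup>2) \<le> (norm f)\<^sup>2"
proof -
  define s where "s = (\<Sum>i\<in>A. cinner f (e i) *\<^sub>C e i)"
  have "cinner s f = (\<Sum>i\<in>A. cinner f (e i) * cnj (cinner f (e i)))"
    unfolding s_def cinner_sum_left by (metis (no_types) cinner_commute cinner_scaleC_left)
  also have "\<dots> = complex_of_real ((norm s)\<^sup>2)"
    unfolding s_def norm_onb_sum[OF assms] by (simp only: complex_norm_square of_real_sum)
  finally have "inner s f = (norm s)\<^sup>2"
    by (simp add: inner_L2_def)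
  then have "(norm (f - s))\<^sup>2 = (norm f)\<^sup>2 - (norm s)\<^sup>2"
    by (simp add: power2_norm_eq_inner inner_diff_left inner_diff_right inner_commute)
  then show ?thesis
    using norm_onb_sum[OF assms, of "\<lambda>i. cinner f (e i)"] zero_le_power2[of "norm (f - s)"]
    unfolding s_def by linarith
qed

lemma bessel_summable:
  assumes "L2_onb Y e"
  shows "summable (\<lambda>n. (cmod (cinner f (e n)))\<^sup>2)"
  by (rule bounded_imp_summable[where B = "(norm f)\<^sup>2"]) (auto intro: bessel_sum[OF assms])

text \<open>By orthonormality the squared norm of a block of the series is the corresponding block
  of the sum of |a_n|^2; completeness of \<open>L2\<close> then gives the limit.\<close>

lemma riesz_fischer:
  assumes e: "L2_onb Y e" and a: "summable (\<lambda>n. (cmod (a n))\<^sup>2)"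
  obtains g where "g \<in> Y" "(\<lambda>n. a n *\<^sub>C e n) sums g" "\<And>n. cinner g (e n) = a n"
proof -
  have "summable (\<lambda>n. a n *\<^sub>C e n)"
    unfolding summable_Cauchy
  proof (intro allI impI)
    fix r :: real assume r: "r > 0"
    then obtain N where N: "\<And>m n. m \<ge> N \<Longrightarrow> norm (\<Sum>i=m..<n. (cmod (a i))\<^sup>2) < r\<^sup>2"
      using a[unfolded summable_Cauchy, rule_format, of "r\<^sup>2"] by auto
    have "norm (\<Sum>i=m..<n. a i *\<^sub>C e i) < r" if "m \<ge> N" for m n
    proof -
      have "(norm (\<Sum>i=m..<n. a i *\<^sub>C e i))\<^sup>2 < r\<^sup>2"
        using N[OF that, of n] by (simp add: norm_onb_sum[OF e] sum_nonneg)
      then show ?thesis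
        using r power_less_imp_less_base by fastforce
    qed
    then show "\<exists>N. \<forall>m\<ge>N. \<forall>n. norm (\<Sum>i=m..<n. a i *\<^sub>C e i) < r"
      by blast
  qed
  then obtain g where g: "(\<lambda>n. a n *\<^sub>C e n) sums g"
    by (auto simp: summable_def)
  have "g \<in> Y"
    by (rule closed_sequentially[OF L2_onbD(1)[OF e] _ g[unfolded sums_def]])
      (rule L2_onb_sum_mem[OF e])
  moreover have "cinner g (e n) = a n" for n
  proof (rule LIMSEQ_unique)
    show "(\<lambda>N. cinner (\<Sum>i<N. a i *\<^sub>C e i) (e n)) \<longlonglongrightarrow> cinner g (e n)"
      using g unfolding sums_def by (rule tendsto_cinner_left)
    show "(\<lambda>N. cinner (\<Sum>i<N. a i *\<^sub>C e i) (e n)) \<longlonglongrightarrow> a n"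
      by (rule tendsto_eventually, rule eventually_sequentiallyI[of "Suc n"])
        (simp add: cinner_onb_sum[OF e])
  qed
  ultimately show ?thesis
    using g that by blast
qed

text \<open>Riesz-Fischer applied to the coefficients of \<open>f\<close> yields a sum with the same
  coefficients, and totality of the basis in \<open>Y\<close> identifies it with
  \<open>f\<close>.\<close>

lemma onb_expansion:
  assumes e: "L2_onb Y e" and f: "f \<in> Y"
  shows "(\<lambda>n. cinner f (e n) *\<^sub>C e n) sums f"
proof -
  obtain g where g: "g \<in> Y" "(\<lambda>n. cinner f (e n) *\<^sub>C e n) sums g"
      "\<And>n. cinner g (e n) = cinner f (e n)"
    using riesz_fischer[OF e bessel_summable[OF e]] by blast
  then have "g = f"
    by (intro L2_onb_eqI[OF e _ f])
  with g show ?thesis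
    by simp
qed

lemma parseval:
  assumes e: "L2_onb Y e" and f: "f \<in> Y"
  shows "(\<lambda>n. cinner f (e n) * cnj (cinner g (e n))) sums cinner f g"
proof -
  have "(\<lambda>n. cinner (cinner f (e n) *\<^sub>C e n) g) sums cinner f g"
    by (rule bounded_linear.sums[OF bounded_linear_cinner_left onb_expansion[OF e f]])
  moreover have "cinner (cinner f (e n) *\<^sub>C e n) g = cinner f (e n) * cnj (cinner g (e n))" for n
    by (simp add: cinner_commute[of "e n" g])
  ultimately show ?thesis
    by (simp only:)
qed

lemma parseval_inner:
  assumes "L2_onb Y e" "f \<in> Y"
  shows "(\<lambda>n. Re (cinner f (e n) * cnj (cinner g (e n)))) sums inner f g"
  using sums_Re[OF parseval[OF assms]] by (simp only: inner_L2_def)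

lemma parseval_norm:
  assumes "L2_onb Y e" "f \<in> Y"
  shows "(\<lambda>n. (cmod (cinner f (e n)))\<^sup>2) sums (norm f)\<^sup>2"
  using parseval_inner[OF assms, of f]
  by (simp only: power2_norm_eq_inner flip: complex_norm_square) simp

section \<open>Completeness of the cosines and of the sines\<close>

text \<open>The Borel sets over which \<open>F\<close> integrates to 0 contain the compact intervals
  and are closed under complements and countable disjoint unions. For complements the integral over
  the whole line must be 0, which is a limit over [-i,i].\<close>

lemma integral_intervals_zero_AE:
  fixes F :: "real \<Rightarrow> complex"
  assumes F: "integrable lborel F" and zero: "\<And>a b. a \<le> b \<Longrightarrow> (LBINT x:{a..b}. F x) = 0"
  shows "AE x in lborel. F x = 0"
proof (rule sigma_finite_measure.density_zero[OF sigma_finite_lborel F])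
  have si: "set_integrable lborel A F" if "A \<in> sets borel" for A
    using F that by (simp add: set_integrable_def integrable_mult_indicator)
  have total: "(LBINT x. F x) = 0"
  proof (rule LIMSEQ_unique)
    have *: "(\<Union>i::nat. {- real i..real i}) = UNIV"
    proof (rule set_eqI)
      fix x :: real
      obtain n where "\<bar>x\<bar> \<le> real n"
        using real_arch_simple by blast
      then show "(x \<in> (\<Union>i::nat. {- real i..real i})) = (x \<in> UNIV)"
        by (auto intro!: exI[of _ n])
    qed
    have "(\<lambda>i. LBINT x:{- real i..real i}. F x) \<longlonglongrightarrow> (LBINT x:(\<Union>i::nat. {- real i..real i}). F x)"
      by (rule set_integral_cont_up) (auto simp: incseq_def intro!: si)
    then show "(\<lambda>i. LBINT x:{- real i..real i}. F x) \<longlonglongrightarrow> (LBINT x. F x)"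
      by (simp add: * set_lebesgue_integral_def)
    show "(\<lambda>i. LBINT x:{- real i..real i}. F x) \<longlonglongrightarrow> 0"
      by (simp add: zero)
  qed
  fix A :: "real set" assume "A \<in> sets lborel"
  then have "A \<in> sets borel"
    by simp
  then show "(LBINT x:A. F x) = 0"
  proof (induction rule: borel_set_induct)
    case (compl A)
    have "(LBINT x. F x) = (LBINT x:A \<union> - A. F x)"
      by (simp add: set_lebesgue_integral_def)
    also have "\<dots> = (LBINT x:A. F x) + (LBINT x:- A. F x)"
      by (rule set_integral_Un) (use compl in \<open>auto intro!: si\<close>)
    finally show ?case
      using compl total by simp
  next
    case (union f)
    have "(LBINT x:(\<Union>i. f i). F x) = (\<Sum>i. LBINT x:f i. F x)"
      by (rule lebesgue_integral_countable_add)
        (use union in \<open>auto simp: disjoint_family_on_def intro!: si\<close>)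
    then show ?case
      using union by simp
  next
    case empty
    then show ?case
      by (simp add: set_lebesgue_integral_def)
  qed (rule zero)
qed

text \<open>For n >= 1 the square of \<open>freq l n\<close> is the n-th eigenvalue both of
  \<open>opA\<close> and of \<open>opA_star\<close>.\<close>

definition freq :: "real \<Rightarrow> nat \<Rightarrow> real" where
  "freq l n = real n * pi / l"

lemma freq_0 [simp]: "freq l 0 = 0"
  by (simp add: freq_def)

lemma freq_Suc: "freq l (Suc n) = freq l n + freq l 1"
  by (simp add: freq_def algebra_simps add_divide_distrib)

lemma freq_pos: "l > 0 \<Longrightarrow> n > 0 \<Longrightarrow> freq l n > 0"
  by (simp add: freq_def)

lemma freq_mono: "l > 0 \<Longrightarrow> m \<le> n \<Longrightarrow> freq l m \<le> freq l n"
  by (simp add: freq_def divide_right_mono)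

lemma freq_eq_iff: "l > 0 \<Longrightarrow> freq l m = freq l n \<longleftrightarrow> m = n"
  by (simp add: freq_def)

lemma sin_freq_l [simp]: "l > 0 \<Longrightarrow> sin (freq l n * l) = 0"
  by (simp add: freq_def)

lemma cos_freq_l [simp]: "l > 0 \<Longrightarrow> cos (freq l n * l) = (- 1) ^ n"
  by (simp add: freq_def)

lemma sin_freq_1_pos:
  assumes "x \<in> {0<..<l}"
  shows "sin (freq l 1 * x) > 0"
proof (rule sin_gt_zero)
  have "0 < l" using assms by simp
  then show "0 < freq l 1 * x"
    using assms by (simp add: freq_def)
  show "freq l 1 * x < pi"
    using assms \<open>0 < l\<close> by (simp add: freq_def field_simps)
qed

text \<open>Products with powers of \<open>cos (\<pi> x / l)\<close> stay in the span of the cosines, and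
  \<open>x \<mapsto> cos (\<pi> x / l)\<close> is a homeomorphism from \<open>[0,l]\<close> onto \<open>[-1,1]\<close>; so the
  Weierstrass theorem on \<open>[-1,1]\<close> applies.\<close>

lemma cos_total_continuous:
  fixes F :: "real \<Rightarrow> complex" and \<eta> :: "real \<Rightarrow> real"
  assumes l: "l > 0" and F: "integrable lborel F" and out: "\<And>x. x \<notin> {0<..<l} \<Longrightarrow> F x = 0"
    and orth: "\<And>n. (LBINT x. F x * complex_of_real (cos (freq l n * x))) = 0"
    and \<eta>: "continuous_on UNIV \<eta>"
  shows "(LBINT x. F x * complex_of_real (\<eta> x)) = 0"
proof -
  have [measurable]: "F \<in> borel_measurable borel"
    using F by auto
  have int: "integrable lborel (\<lambda>x. F x * complex_of_real (g x))"
    if "g \<in> borel_measurable borel" "\<And>x. x \<in> {0<..<l} \<Longrightarrow> \<bar>g x\<bar> \<le> B" for g B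
  proof (rule Bochner_Integration.integrable_bound)
    show "integrable lborel (\<lambda>x. B * norm (F x))"
      using F by auto
    show "(\<lambda>x. F x * complex_of_real (g x)) \<in> borel_measurable lborel"
      using that(1) by measurable
    have "cmod (F x * complex_of_real (g x)) \<le> norm (B * norm (F x))" for x
    proof (cases "x \<in> {0<..<l}")
      case True
      then have "\<bar>g x\<bar> * cmod (F x) \<le> B * cmod (F x)"
        by (intro mult_right_mono that(2)) auto
      then show ?thesis
        using abs_ge_self[of "B * cmod (F x)"] by (simp add: norm_mult mult.commute)
    qed (simp add: out)
    then show "AE x in lborel. norm (F x * complex_of_real (g x)) \<le> norm (B * norm (F x))"
      by simp
  qed
  define c where "c x = cos (freq l 1 * x)" for x
  have c_meas [measurable]: "c \<in> borel_measurable borel"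
    unfolding c_def by measurable
  have c_le: "\<bar>c x\<bar> \<le> 1" for x
    by (simp add: c_def)
  have ck_le: "\<bar>c x ^ k\<bar> \<le> 1" for x k
    by (simp add: power_abs power_le_one c_le)
  have ccos: "\<bar>c x ^ k * cos (freq l n * x)\<bar> \<le> 1" for x k n
    using mult_mono[OF ck_le[of x k] abs_cos_le_one[of "freq l n * x"]] by (simp add: abs_mult)
  have int_ccos: "integrable lborel (\<lambda>x. F x * complex_of_real (c x ^ k * cos (freq l n * x)))" for k n
    by (rule int[OF _ ccos]) measurable
  have pow: "(LBINT x. F x * complex_of_real (c x ^ k * cos (freq l n * x))) = 0" for k n
  proof (induction k arbitrary: n)
    case 0
    then show ?case
      using orth[of n] by simp
  next
    case (Suc k)
    show ?case
    \<comment> \<open>The product formula lowers the frequency by one, which is impossible for n =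
      0; there cos 0 = 1, and one power of \<open>c\<close> serves as the cosine of frequency
      1.\<close>
    proof (cases n)
      case 0
      then show ?thesis
        using Suc[of 1] by (simp add: c_def mult.commute)
    next
      case (Suc m)
      have *: "c x ^ Suc k * cos (freq l n * x)
          = (c x ^ k * cos (freq l m * x) + c x ^ k * cos (freq l (Suc n) * x)) / 2" for x
      proof -
        have "c x * cos (freq l n * x)
            = (cos (freq l n * x - freq l 1 * x) + cos (freq l n * x + freq l 1 * x)) / 2"
          unfolding c_def by (subst mult.commute, rule cos_times_cos)
        also have "freq l n * x - freq l 1 * x = freq l m * x"
          unfolding Suc freq_Suc[of l m] by (simp add: algebra_simps)
        also have "freq l n * x + freq l 1 * x = freq l (Suc n) * x"
          unfolding freq_Suc[of l n] by (simp add: algebra_simps)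
        finally have h: "c x * cos (freq l n * x) = (cos (freq l m * x) + cos (freq l (Suc n) * x)) / 2" .
        have "c x ^ Suc k * cos (freq l n * x) = c x ^ k * (c x * cos (freq l n * x))"
          by simp
        then show ?thesis
          unfolding h by (simp only: distrib_left times_divide_eq_right)
      qed
      have "(LBINT x. F x * complex_of_real (c x ^ Suc k * cos (freq l n * x)))
          = (LBINT x. (F x * complex_of_real (c x ^ k * cos (freq l m * x))
              + F x * complex_of_real (c x ^ k * cos (freq l (Suc n) * x))) / 2)"
        unfolding * by (intro Bochner_Integration.integral_cong refl) (simp add: algebra_simps)
      also have "\<dots> = 0"
        unfolding integral_divide_zero
        by (simp only: Bochner_Integration.integral_add[OF int_ccos int_ccos] Suc.IH) simp
      finally show ?thesis .
    qed
  qed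
  have pow': "(LBINT x. F x * complex_of_real (c x ^ k)) = 0" for k
    using pow[of k 0] by simp
  have poly: "(LBINT x. F x * complex_of_real (\<Sum>i\<le>N. a i * c x ^ i)) = 0"
    for a :: "nat \<Rightarrow> real" and N
  proof -
    have "(LBINT x. F x * complex_of_real (\<Sum>i\<le>N. a i * c x ^ i))
        = (LBINT x. (\<Sum>i\<le>N. complex_of_real (a i) * (F x * complex_of_real (c x ^ i))))"
      by (intro Bochner_Integration.integral_cong refl) (simp add: sum_distrib_left algebra_simps)
    also have "\<dots> = (\<Sum>i\<le>N. LBINT x. complex_of_real (a i) * (F x * complex_of_real (c x ^ i)))"
      by (intro Bochner_Integration.integral_sum integrable_mult_right int[where B = 1] ck_le) measurable
    also have "\<dots> = 0"
      using pow' by (simp del: of_real_power)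
    finally show ?thesis .
  qed
  have [measurable]: "\<eta> \<in> borel_measurable borel"
    using \<eta> by (rule borel_measurable_continuous_onI)
  define I where "I = (LBINT x. norm (F x))"
  have "I \<ge> 0"
    by (simp add: I_def)
  have bound: "cmod (LBINT x. F x * complex_of_real (\<eta> x)) \<le> \<epsilon> * I" if "\<epsilon> > 0" for \<epsilon>
  proof -
    \<comment> \<open>With y = cos (pi x / l) the point x is l / pi * arccos y, so
      \<open>\<eta>\<close> becomes a continuous function of y on [-1,1], to be approximated by
      polynomials in y.\<close>
    have "continuous_on {-1..1} (\<lambda>y. \<eta> (l / pi * arccos y))"
      by (rule continuous_on_compose2[OF \<eta>]) (auto intro!: continuous_intros)
    then obtain p where p: "real_polynomial_function p"
        "\<And>y. y \<in> {-1..1} \<Longrightarrow> \<bar>\<eta> (l / pi * arccos y) - p y\<bar> < \<epsilon>"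
      using Stone_Weierstrass_real_polynomial_function[OF compact_Icc _ \<open>\<epsilon> > 0\<close>] by metis
    then obtain a N where pa: "p = (\<lambda>y. \<Sum>i\<le>N. a i * y ^ i)"
      by (auto simp: real_polynomial_function_iff_sum)
    have approx: "\<bar>\<eta> x - p (c x)\<bar> \<le> \<epsilon>" if "x \<in> {0<..<l}" for x
    proof -
      have "arccos (c x) = freq l 1 * x"
        unfolding c_def
      proof (rule arccos_cos)
        show "0 \<le> freq l 1 * x" "freq l 1 * x \<le> pi"
          using that l by (auto simp: freq_def field_simps)
      qed
      then have "l / pi * arccos (c x) = x"
        using l by (simp add: freq_def)
      moreover have "c x \<in> {-1..1}"
        by (auto simp: c_def)
      ultimately show ?thesis
        using p(2)[of "c x"] by (simp add: less_imp_le)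
    qed
    have p_meas [measurable]: "(\<lambda>x. p (c x)) \<in> borel_measurable borel"
      unfolding pa by measurable
    have p_bound: "\<bar>p (c x)\<bar> \<le> (\<Sum>i\<le>N. \<bar>a i\<bar>)" for x
    proof -
      have "\<bar>p (c x)\<bar> \<le> (\<Sum>i\<le>N. \<bar>a i * c x ^ i\<bar>)"
        unfolding pa by (rule sum_abs)
      also have "\<dots> \<le> (\<Sum>i\<le>N. \<bar>a i\<bar>)"
        by (intro sum_mono) (use ck_le in \<open>auto simp: abs_mult intro: mult_left_le\<close>)
      finally show ?thesis .
    qed
    have i1: "integrable lborel (\<lambda>x. F x * complex_of_real (p (c x)))"
      by (rule int[OF p_meas p_bound])
    have i2: "integrable lborel (\<lambda>x. F x * complex_of_real (\<eta> x - p (c x)))"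
      by (rule int[OF _ approx]) measurable
    have "(LBINT x. F x * complex_of_real (\<eta> x))
        = (LBINT x. F x * complex_of_real (\<eta> x - p (c x)) + F x * complex_of_real (p (c x)))"
      by (intro Bochner_Integration.integral_cong refl) (simp add: algebra_simps)
    also have "\<dots> = (LBINT x. F x * complex_of_real (\<eta> x - p (c x)))"
      unfolding Bochner_Integration.integral_add[OF i2 i1]
      using poly[of a N] unfolding pa by (simp only: add_0_right)
    finally have "cmod (LBINT x. F x * complex_of_real (\<eta> x))
        \<le> (LBINT x. norm (F x * complex_of_real (\<eta> x - p (c x))))"
      by (simp only: integral_norm_bound)
    also have "\<dots> \<le> (LBINT x. \<epsilon> * norm (F x))"
    proof (rule integral_mono)
      show "integrable lborel (\<lambda>x. norm (F x * complex_of_real (\<eta> x - p (c x))))"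
        by (rule integrable_norm[OF i2])
      fix x
      show "norm (F x * complex_of_real (\<eta> x - p (c x))) \<le> \<epsilon> * norm (F x)"
      proof (cases "x \<in> {0<..<l}")
        case True
        then show ?thesis
          using mult_right_mono[OF approx[OF True], of "norm (F x)"]
          by (simp add: norm_mult mult.commute flip: of_real_diff)
      qed (simp add: out)
    qed (use F in auto)
    finally show ?thesis
      by (simp add: I_def)
  qed
  have "cmod (LBINT x. F x * complex_of_real (\<eta> x)) \<le> 0 + e" if "e > 0" for e
  proof -
    \<comment> \<open>Division by \<open>I + 1\<close> instead of \<open>I\<close> also covers
      \<open>I = 0\<close>.\<close>
    have "cmod (LBINT x. F x * complex_of_real (\<eta> x)) \<le> e / (I + 1) * I"
      using that \<open>I \<ge> 0\<close> by (intro bound) auto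
    also have "\<dots> \<le> e"
      using that \<open>I \<ge> 0\<close> by (simp add: field_simps)
    finally show ?thesis
      by simp
  qed
  then have "cmod (LBINT x. F x * complex_of_real (\<eta> x)) \<le> 0"
    by (rule field_le_epsilon)
  then show ?thesis
    by simp
qed

text \<open>Continuous trapezoids decrease to the indicator of [a,b], so the continuous case gives
  vanishing integrals over intervals by dominated convergence.\<close>

lemma cos_total_AE:
  fixes F :: "real \<Rightarrow> complex"
  assumes l: "l > 0" and F: "integrable lborel F" and out: "\<And>x. x \<notin> {0<..<l} \<Longrightarrow> F x = 0"
    and orth: "\<And>n. (LBINT x. F x * complex_of_real (cos (freq l n * x))) = 0"
  shows "AE x in lborel. F x = 0"
proof (rule integral_intervals_zero_AE[OF F])
  fix a b :: real assume "a \<le> b"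
  have [measurable]: "F \<in> borel_measurable borel"
    using F by auto
  define \<eta> where "\<eta> k x = max 0 (1 - real k * infdist x {a..b})" for k x
  have cont: "continuous_on UNIV (\<eta> k)" for k
    unfolding \<eta>_def by (intro continuous_intros)
  have [measurable]: "\<eta> k \<in> borel_measurable borel" for k
    using cont by (rule borel_measurable_continuous_onI)
  have lim: "(\<lambda>k. \<eta> k x) \<longlonglongrightarrow> indicator {a..b} x" for x
  proof (cases "x \<in> {a..b}")
    case True
    then show ?thesis
      by (simp add: \<eta>_def)
  next
    case False
    then have pos: "infdist x {a..b} > 0"
      using in_closed_iff_infdist_zero[of "{a..b}" x] \<open>a \<le> b\<close> infdist_nonneg[of x "{a..b}"]
      by (auto simp: less_le)
    obtain N where N: "1 / infdist x {a..b} \<le> real N"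
      using real_arch_simple by blast
    have "\<eta> k x = 0" if "k \<ge> N" for k
    proof -
      have "1 / infdist x {a..b} \<le> real k"
        using N that by linarith
      then show ?thesis
        using pos by (simp add: \<eta>_def field_simps)
    qed
    then show ?thesis
      using False by (intro tendsto_eventually eventually_sequentiallyI[of N]) simp
  qed
  have \<eta>_le: "\<bar>\<eta> k x\<bar> \<le> 1" for k x
    using infdist_nonneg[of x "{a..b}"] by (simp add: \<eta>_def)
  have "(\<lambda>k. LBINT x. F x * complex_of_real (\<eta> k x))
      \<longlonglongrightarrow> (LBINT x. F x * complex_of_real (indicator {a..b} x))"
  proof (rule integral_dominated_convergence[where w = "\<lambda>x. norm (F x)"])
    show "AE x in lborel. (\<lambda>k. F x * complex_of_real (\<eta> k x)) \<longlonglongrightarrow> F x * complex_of_real (indicator {a..b} x)"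
      by (intro AE_I2 tendsto_intros lim)
    show "AE x in lborel. norm (F x * complex_of_real (\<eta> k x)) \<le> norm (F x)" for k
      using \<eta>_le by (auto simp: norm_mult intro!: AE_I2 mult_left_le)
  qed (use F in auto)
  moreover have "(LBINT x. F x * complex_of_real (\<eta> k x)) = 0" for k
    by (rule cos_total_continuous[OF assms cont])
  ultimately have "(LBINT x. F x * complex_of_real (indicator {a..b} x)) = 0"
    by (simp add: LIMSEQ_const_iff)
  then show "(LBINT x:{a..b}. F x) = 0"
    by (simp add: set_lebesgue_integral_def scaleR_conv_of_real mult.commute)
qed

text \<open>The factor sin (pi x / l) is positive on (0,l), and its product with a cosine is a
  combination of sines. Hence F * sin (pi x / l) is orthogonal to all cosines, and the cosine case
  applies.\<close>

lemma sin_total_AE: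
  fixes F :: "real \<Rightarrow> complex"
  assumes l: "l > 0" and F: "integrable lborel F" and out: "\<And>x. x \<notin> {0<..<l} \<Longrightarrow> F x = 0"
    and orth: "\<And>n. (LBINT x. F x * complex_of_real (sin (freq l n * x))) = 0"
  shows "AE x in lborel. F x = 0"
proof -
  have [measurable]: "F \<in> borel_measurable borel"
    using F by auto
  have int: "integrable lborel (\<lambda>x. F x * complex_of_real (sin (c * x)))" for c
    by (rule Bochner_Integration.integrable_bound[OF F]) (auto simp: norm_mult intro!: AE_I2 mult_left_le)
  have "AE x in lborel. F x * complex_of_real (sin (freq l 1 * x)) = 0"
  proof (rule cos_total_AE[OF l int])
    fix n
    \<comment> \<open>The truncated \<open>n - 1\<close> is wrong at \<open>n = 0\<close>: there the
      lower frequency is that of index -1, and the oddness of the sine turns the minus sign into a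
      plus sign.\<close>
    have *: "F x * complex_of_real (sin (freq l 1 * x)) * complex_of_real (cos (freq l n * x))
        = (F x * complex_of_real (sin (freq l (Suc n) * x))
            + (if n = 0 then F x * complex_of_real (sin (freq l 1 * x))
               else - (F x * complex_of_real (sin (freq l (n - 1) * x))))) / 2" for x
    proof (cases n)
      case (Suc m)
      have 1: "freq l n * x + freq l 1 * x = freq l (Suc n) * x"
        unfolding freq_Suc[of l n] by (simp add: algebra_simps)
      have 2: "freq l n * x - freq l 1 * x = freq l m * x"
        unfolding Suc freq_Suc[of l m] by (simp add: algebra_simps)
      have h: "cos (freq l n * x) * sin (freq l 1 * x)
          = (sin (freq l (Suc n) * x) - sin (freq l m * x)) / 2"
        unfolding cos_times_sin 1 2 ..
      have "F x * complex_of_real (sin (freq l 1 * x)) * complex_of_real (cos (freq l n * x))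
          = F x * complex_of_real (cos (freq l n * x) * sin (freq l 1 * x))"
        by (simp only: of_real_mult ac_simps)
      also have "\<dots> = (F x * complex_of_real (sin (freq l (Suc n) * x))
          - F x * complex_of_real (sin (freq l m * x))) / 2"
        unfolding h by (simp add: algebra_simps)
      finally show ?thesis
        using Suc by simp
    qed simp
    show "(LBINT x. F x * complex_of_real (sin (freq l 1 * x)) * complex_of_real (cos (freq l n * x))) = 0"
      unfolding * integral_divide_zero
      using orth[of "Suc n"] orth[of "n - 1"] orth[of 1]
      by (cases "n = 0") (simp_all add: int)
  qed (simp add: out)
  then show ?thesis
  proof eventually_elim
    case (elim x)
    then show ?case
      using sin_freq_1_pos[of x l] out[of x] by (cases "x \<in> {0<..<l}") auto
  qed
qed

section \<open>Trigonometric bases\<close>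

lemma sq_int_continuous:
  fixes \<psi> :: "real \<Rightarrow> complex"
  assumes "continuous_on UNIV \<psi>"
  shows "sq_int (\<lambda>x. indicator {0<..<l} x *\<^sub>R \<psi> x)"
proof -
  have [measurable]: "\<psi> \<in> borel_measurable borel"
    using assms by (rule borel_measurable_continuous_onI)
  have "continuous_on {0..l} (\<lambda>x. (cmod (\<psi> x))\<^sup>2)"
    by (intro continuous_intros continuous_on_subset[OF assms]) auto
  then have "set_integrable lborel {0..l} (\<lambda>x. (cmod (\<psi> x))\<^sup>2)"
    by (rule borel_integrable_atLeastAtMost')
  then have "set_integrable lborel {0<..<l} (\<lambda>x. (cmod (\<psi> x))\<^sup>2)"
    by (rule set_integrable_subset) auto
  then have "integrable lborel (\<lambda>x. (cmod (indicator {0<..<l} x *\<^sub>R \<psi> x))\<^sup>2)"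
    unfolding set_integrable_def
    by (rule Bochner_Integration.integrable_cong[THEN iffD1, rotated 2])
      (auto simp: indicator_def)
  then show ?thesis
    by (auto simp: sq_int_def)
qed

text \<open>Bilinear, without conjugation, like the integrals in \<open>has_weak_deriv\<close>;
  \<open>\<psi>\<close> lives on the whole line and is cut off by the domain of integration.\<close>

definition L2_pair :: "real \<Rightarrow> L2 \<Rightarrow> (real \<Rightarrow> complex) \<Rightarrow> complex" where
  "L2_pair l f \<psi> = (LBINT x:{0<..<l}. rep_L2 f x * \<psi> x)"

lemma rep_L2_mult_integrable:
  assumes "continuous_on UNIV \<psi>"
  shows "set_integrable lborel {0<..<l} (\<lambda>x. rep_L2 f x * \<psi> x)"
proof -
  have "integrable lborel (\<lambda>x. rep_L2 f x * cnj (indicator {0<..<l} x *\<^sub>R cnj (\<psi> x)))"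
    by (intro sq_int_mult rep_L2_sq_int sq_int_continuous continuous_intros assms)
  then show ?thesis
    by (simp add: set_integrable_def scaleR_conv_of_real mult.assoc mult.left_commute)
qed

lemma rep_L2_integrable: "set_integrable lborel {0<..<l} (rep_L2 f)"
  using rep_L2_mult_integrable[of "\<lambda>_. 1" l f] by simp


lemma L2_pair_cmult_right: "L2_pair l f (\<lambda>x. c * \<psi> x) = c * L2_pair l f \<psi>"
  by (simp add: L2_pair_def mult.left_commute)

lemma L2_pair_AE_cong:
  assumes "AE x in lborel. x \<in> {0<..<l} \<longrightarrow> rep_L2 f x = g x" "g \<in> borel_measurable borel"
    and \<psi>: "continuous_on UNIV \<psi>"
  shows "L2_pair l f \<psi> = (LBINT x:{0<..<l}. g x * \<psi> x)"
  unfolding L2_pair_def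
proof (rule set_lebesgue_integral_cong_AE)
  have [measurable]: "\<psi> \<in> borel_measurable borel" "g \<in> borel_measurable borel"
    using \<psi> assms by (auto intro: borel_measurable_continuous_onI)
  show "(\<lambda>x. rep_L2 f x * \<psi> x) \<in> borel_measurable lborel" "(\<lambda>x. g x * \<psi> x) \<in> borel_measurable lborel"
    by measurable
  show "AE x\<in>{0<..<l} in lborel. rep_L2 f x * \<psi> x = g x * \<psi> x"
    using assms(1) by eventually_elim auto
qed auto

definition L2_fun :: "real \<Rightarrow> (real \<Rightarrow> real) \<Rightarrow> L2" where
  "L2_fun l \<psi> = abs_L2 (\<lambda>x. indicator {0<..<l} x *\<^sub>R complex_of_real (\<psi> x))"

lemma rep_L2_fun:
  assumes "continuous_on UNIV \<psi>"
  shows "AE x in lborel. rep_L2 (L2_fun l \<psi>) x = indicator {0<..<l} x *\<^sub>R complex_of_real (\<psi> x)"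
  unfolding L2_fun_def by (intro rep_abs_L2 sq_int_continuous continuous_intros assms)

lemma L2_fun_mem: "continuous_on UNIV \<psi> \<Longrightarrow> L2_fun l \<psi> \<in> L2_on l"
  unfolding L2_on_def using rep_L2_fun[of \<psi> l] by (auto elim: eventually_mono)

lemma L2_fun_cmult:
  assumes "continuous_on UNIV \<psi>"
  shows "L2_fun l (\<lambda>x. c * \<psi> x) = c *\<^sub>R L2_fun l \<psi>"
proof (rule L2_eqI)
  have "continuous_on UNIV (\<lambda>x. c * \<psi> x)"
    by (intro continuous_intros assms)
  then have "AE x in lborel. rep_L2 (L2_fun l (\<lambda>x. c * \<psi> x)) x
      = indicator {0<..<l} x *\<^sub>R complex_of_real (c * \<psi> x)"
    by (rule rep_L2_fun)
  then show "AE x in lborel. rep_L2 (L2_fun l (\<lambda>x. c * \<psi> x)) x = rep_L2 (c *\<^sub>R L2_fun l \<psi>) x"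
    using rep_L2_fun[OF assms, of l] rep_L2_scaleR[of c "L2_fun l \<psi>"]
    by eventually_elim (simp add: scaleR_conv_of_real)
qed

lemma cinner_L2_fun:
  assumes "continuous_on UNIV \<psi>"
  shows "cinner f (L2_fun l \<psi>) = L2_pair l f (\<lambda>x. complex_of_real (\<psi> x))"
  unfolding cinner.rep_eq L2_pair_def set_lebesgue_integral_def
proof (rule Bochner_Integration.integral_cong_AE)
  have [measurable]: "\<psi> \<in> borel_measurable borel"
    using assms by (rule borel_measurable_continuous_onI)
  show "(\<lambda>x. rep_L2 f x * cnj (rep_L2 (L2_fun l \<psi>) x)) \<in> borel_measurable lborel"
    using borel_measurable_integrable[OF sq_int_mult[OF rep_L2_sq_int rep_L2_sq_int]] by simp
  show "(\<lambda>x. indicator {0<..<l} x *\<^sub>R (rep_L2 f x * complex_of_real (\<psi> x))) \<in> borel_measurable lborel"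
    by measurable
  show "AE x in lborel. rep_L2 f x * cnj (rep_L2 (L2_fun l \<psi>) x)
      = indicator {0<..<l} x *\<^sub>R (rep_L2 f x * complex_of_real (\<psi> x))"
    using rep_L2_fun[OF assms, of l] by eventually_elim simp
qed

lemma cinner_L2_fun_L2_fun:
  assumes "continuous_on UNIV \<phi>" "continuous_on UNIV \<psi>"
  shows "cinner (L2_fun l \<phi>) (L2_fun l \<psi>) = complex_of_real (LBINT x:{0<..<l}. \<phi> x * \<psi> x)"
proof -
  have [measurable]: "\<phi> \<in> borel_measurable borel"
    using assms(1) by (rule borel_measurable_continuous_onI)
  have "L2_pair l (L2_fun l \<phi>) (\<lambda>x. complex_of_real (\<psi> x))
      = (LBINT x:{0<..<l}. complex_of_real (\<phi> x) * complex_of_real (\<psi> x))"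
  proof (rule L2_pair_AE_cong)
    show "AE x in lborel. x \<in> {0<..<l} \<longrightarrow> rep_L2 (L2_fun l \<phi>) x = complex_of_real (\<phi> x)"
      using rep_L2_fun[OF assms(1), of l] by eventually_elim simp
  qed (auto intro!: continuous_intros assms)
  also have "\<dots> = complex_of_real (LBINT x:{0<..<l}. \<phi> x * \<psi> x)"
    by (simp only: set_integral_complex_of_real flip: of_real_mult)
  finally show ?thesis
    by (simp only: cinner_L2_fun[OF assms(2)])
qed

lemma L2_on_vanish: "f \<in> L2_on l \<Longrightarrow> AE x in lborel. rep_L2 f x = indicator {0<..<l} x *\<^sub>R rep_L2 f x"
  unfolding L2_on_def by (auto simp: indicator_def elim: eventually_mono)

text \<open>The mass of the limit outside (0,l) is at most its squared distance to each
  \<open>X n\<close>, since \<open>X n\<close> has no mass there.\<close>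

lemma closed_L2_on: "closed (L2_on l)"
  unfolding closed_sequential_limits
proof (intro allI impI, elim conjE)
  fix X :: "nat \<Rightarrow> L2" and f
  assume X: "\<forall>n. X n \<in> L2_on l" "X \<longlonglongrightarrow> f"
  have int: "integrable lborel (\<lambda>x. (cmod (rep_L2 g x))\<^sup>2)" for g
    using rep_L2_sq_int[of g] by (simp add: sq_int_def)
  have int': "integrable lborel (\<lambda>x. indicator (- {0<..<l}) x *\<^sub>R (cmod (rep_L2 g x))\<^sup>2)" for g
    by (intro integrable_mult_indicator int) simp
  define I where "I = (LBINT x. indicator (- {0<..<l}) x *\<^sub>R (cmod (rep_L2 f x))\<^sup>2)"
  have le: "I \<le> (norm (f - X n))\<^sup>2" for n
    unfolding norm_L2_sq I_def
  proof (rule integral_mono_AE[OF int' int])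
    have "AE x in lborel. x \<notin> {0<..<l} \<longrightarrow> rep_L2 (X n) x = 0"
      using X(1) by (simp add: L2_on_def)
    then show "AE x in lborel. indicator (- {0<..<l}) x *\<^sub>R (cmod (rep_L2 f x))\<^sup>2 \<le> (cmod (rep_L2 (f - X n) x))\<^sup>2"
      using rep_L2_diff[of f "X n"] by eventually_elim (auto simp: indicator_def)
  qed
  have "(\<lambda>n. (norm (f - X n))\<^sup>2) \<longlonglongrightarrow> (norm (f - f))\<^sup>2"
    by (intro tendsto_intros X)
  then have "I \<le> 0"
    using le by (intro LIMSEQ_le_const[where X = "\<lambda>n. (norm (f - X n))\<^sup>2"]) auto
  moreover have "I \<ge> 0"
    unfolding I_def by (rule Bochner_Integration.integral_nonneg) simp
  ultimately have "AE x in lborel. indicator (- {0<..<l}) x *\<^sub>R (cmod (rep_L2 f x))\<^sup>2 = 0"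
    using integral_nonneg_eq_0_iff_AE[OF int'[of f]] unfolding I_def by (simp add: order.antisym)
  then show "f \<in> L2_on l"
    unfolding L2_on_def by (auto simp: indicator_def elim: eventually_mono)
qed

lemma L2_on_0: "0 \<in> L2_on l"
  unfolding L2_on_def using rep_L2_zero by (auto elim: eventually_mono)

lemma L2_on_add:
  assumes "f \<in> L2_on l" "g \<in> L2_on l" shows "f + g \<in> L2_on l"
proof -
  have "AE x in lborel. x \<notin> {0<..<l} \<longrightarrow> rep_L2 f x = 0" "AE x in lborel. x \<notin> {0<..<l} \<longrightarrow> rep_L2 g x = 0"
    using assms by (auto simp: L2_on_def)
  then have "AE x in lborel. x \<notin> {0<..<l} \<longrightarrow> rep_L2 (f + g) x = 0"
    using rep_L2_add[of f g] by eventually_elim auto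
  then show ?thesis
    by (simp add: L2_on_def)
qed

lemma L2_on_scaleC:
  assumes "f \<in> L2_on l" shows "c *\<^sub>C f \<in> L2_on l"
proof -
  have "AE x in lborel. x \<notin> {0<..<l} \<longrightarrow> rep_L2 f x = 0"
    using assms by (auto simp: L2_on_def)
  then have "AE x in lborel. x \<notin> {0<..<l} \<longrightarrow> rep_L2 (c *\<^sub>C f) x = 0"
    using rep_L2_scaleC[of c f] by eventually_elim auto
  then show ?thesis
    by (simp add: L2_on_def)
qed

text \<open>The constant 1 has squared norm l on (0,l), a cosine of positive frequency l / 2; this
  explains the two normalizing factors.\<close>

definition cs :: "real \<Rightarrow> nat \<Rightarrow> L2" where
  "cs l n = sqrt ((if n = 0 then 1 else 2) / l) *\<^sub>R L2_fun l (\<lambda>x. cos (freq l n * x))"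

text \<open>Indexed by frequency to match \<open>cs\<close>, so \<open>sn l 0\<close> is 0 and the
  sine basis starts at index 1.\<close>

definition sn :: "real \<Rightarrow> nat \<Rightarrow> L2" where
  "sn l n = sqrt (2 / l) *\<^sub>R L2_fun l (\<lambda>x. sin (freq l n * x))"

lemma cs_0: "cs l 0 = sqrt (1 / l) *\<^sub>R L2_fun l (\<lambda>x. 1)"
  by (simp add: cs_def)


lemma L2_on_scaleR: "f \<in> L2_on l \<Longrightarrow> r *\<^sub>R f \<in> L2_on l"
  unfolding scaleR_scaleC by (rule L2_on_scaleC)

lemma cs_mem: "cs l n \<in> L2_on l"
  unfolding cs_def by (intro L2_on_scaleR L2_fun_mem continuous_intros)

lemma sn_mem: "sn l n \<in> L2_on l"
  unfolding sn_def by (intro L2_on_scaleR L2_fun_mem continuous_intros)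

lemma cinner_cs:
  "cinner f (cs l n) = complex_of_real (sqrt ((if n = 0 then 1 else 2) / l))
     * L2_pair l f (\<lambda>x. complex_of_real (cos (freq l n * x)))"
  unfolding cs_def cinner_scaleR_right by (subst cinner_L2_fun) (intro continuous_intros refl)+

lemma cinner_sn:
  "cinner f (sn l n) = complex_of_real (sqrt (2 / l))
     * L2_pair l f (\<lambda>x. complex_of_real (sin (freq l n * x)))"
  unfolding sn_def cinner_scaleR_right by (subst cinner_L2_fun) (intro continuous_intros refl)+

lemma L2_pair_rep:
  "L2_pair l f \<psi> = (LBINT x. (indicator {0<..<l} x *\<^sub>R rep_L2 f x) * \<psi> x)"
  by (simp add: L2_pair_def set_lebesgue_integral_def)

lemma cs_total:
  assumes l: "l > 0" and f: "f \<in> L2_on l" and orth: "\<And>n. cinner f (cs l n) = 0"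
  shows "f = 0"
proof (rule L2_eqI)
  have "AE x in lborel. indicator {0<..<l} x *\<^sub>R rep_L2 f x = 0"
  proof (rule cos_total_AE[OF l])
    show "integrable lborel (\<lambda>x. indicator {0<..<l} x *\<^sub>R rep_L2 f x)"
      using rep_L2_integrable by (simp add: set_integrable_def)
    show "(LBINT x. indicator {0<..<l} x *\<^sub>R rep_L2 f x * complex_of_real (cos (freq l n * x))) = 0" for n
      using orth[of n] l unfolding L2_pair_rep[symmetric] by (auto simp: cinner_cs split: if_splits)
  qed auto
  then show "AE x in lborel. rep_L2 f x = rep_L2 0 x"
    using L2_on_vanish[OF f] rep_L2_zero by eventually_elim simp
qed

lemma sn_total:
  assumes l: "l > 0" and f: "f \<in> L2_on l" and orth: "\<And>n. n > 0 \<Longrightarrow> cinner f (sn l n) = 0"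
  shows "f = 0"
proof (rule L2_eqI)
  have "AE x in lborel. indicator {0<..<l} x *\<^sub>R rep_L2 f x = 0"
  proof (rule sin_total_AE[OF l])
    show "integrable lborel (\<lambda>x. indicator {0<..<l} x *\<^sub>R rep_L2 f x)"
      using rep_L2_integrable by (simp add: set_integrable_def)
    show "(LBINT x. indicator {0<..<l} x *\<^sub>R rep_L2 f x * complex_of_real (sin (freq l n * x))) = 0" for n
      using orth[of n] l unfolding L2_pair_rep[symmetric]
      by (cases "n = 0") (auto simp: cinner_sn L2_pair_def)
  qed auto
  then show "AE x in lborel. rep_L2 f x = rep_L2 0 x"
    using L2_on_vanish[OF f] rep_L2_zero by eventually_elim simp
qed

section \<open>Orthonormality of the trigonometric systems\<close>

lemma integral_cos_freq:
  fixes c l :: real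
  assumes "l > 0"
  shows "(LBINT x:{0<..<l}. cos (c * x)) = (if c = 0 then l else sin (c * l) / c)"
proof (cases "c = 0")
  case True
  have "(LBINT x:{0<..<l}. cos (c * x)) = (LBINT x. indicator {0<..<l} x)"
    unfolding set_lebesgue_integral_def
    by (rule Bochner_Integration.integral_cong) (auto simp: True)
  then show ?thesis
    using assms True by simp
next
  case False
  then show ?thesis
    using integral_cos[of c 0 l] assms
    by (simp add: interval_lebesgue_integral_def zero_ereal_def)
qed

lemma cos_integrable: "set_integrable lborel {0<..<l} (\<lambda>x. cos (c * x))" for c :: real
  by (rule set_integrable_subset[of _ "{0..l}"])
    (auto intro!: borel_integrable_atLeastAtMost' continuous_intros)

lemma sin_freq_diff: "l > 0 \<Longrightarrow> sin ((freq l i - freq l j) * l) = 0"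
  by (simp add: left_diff_distrib sin_diff)

lemma sin_freq_sum: "l > 0 \<Longrightarrow> sin ((freq l i + freq l j) * l) = 0"
  by (simp add: distrib_right sin_add)

lemma freq_add_eq_0: "l > 0 \<Longrightarrow> freq l i + freq l j = 0 \<longleftrightarrow> i = 0 \<and> j = 0"
  by (auto simp: freq_def add_divide_distrib[symmetric] distrib_right[symmetric] add_nonneg_eq_0_iff)

lemma integral_cos_diff:
  "l > 0 \<Longrightarrow> (LBINT x:{0<..<l}. cos ((freq l i - freq l j) * x)) = (if i = j then l else 0)"
  using freq_eq_iff[of l i j] sin_freq_diff[of l i j] by (simp add: integral_cos_freq)

lemma integral_cos_add:
  "l > 0 \<Longrightarrow> (LBINT x:{0<..<l}. cos ((freq l i + freq l j) * x)) = (if i = 0 \<and> j = 0 then l else 0)"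
  using freq_add_eq_0[of l i j] sin_freq_sum[of l i j] by (simp only: integral_cos_freq) simp

lemma integral_cos_cos:
  assumes "l > 0"
  shows "(LBINT x:{0<..<l}. cos (freq l i * x) * cos (freq l j * x))
     = ((if i = j then l else 0) + (if i = 0 \<and> j = 0 then l else 0)) / 2"
proof -
  have "cos (freq l i * x) * cos (freq l j * x)
      = (cos ((freq l i - freq l j) * x) + cos ((freq l i + freq l j) * x)) / 2" for x
    by (simp add: cos_times_cos algebra_simps)
  then show ?thesis
    by (simp only: set_integral_divide_zero set_integral_add(2)[OF cos_integrable cos_integrable]
        integral_cos_diff[OF assms] integral_cos_add[OF assms])
qed

lemma integral_sin_sin:
  assumes "l > 0"
  shows "(LBINT x:{0<..<l}. sin (freq l i * x) * sin (freq l j * x))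
     = ((if i = j then l else 0) - (if i = 0 \<and> j = 0 then l else 0)) / 2"
proof -
  have "sin (freq l i * x) * sin (freq l j * x)
      = (cos ((freq l i - freq l j) * x) - cos ((freq l i + freq l j) * x)) / 2" for x
    by (simp add: sin_times_sin algebra_simps)
  then show ?thesis
    by (simp only: set_integral_divide_zero set_integral_diff(2)[OF cos_integrable cos_integrable]
        integral_cos_diff[OF assms] integral_cos_add[OF assms])
qed

lemma cinner_cs_cs:
  assumes l: "l > 0"
  shows "cinner (cs l i) (cs l j) = (if i = j then 1 else 0)"
proof -
  have "cinner (L2_fun l (\<lambda>x. cos (freq l i * x))) (L2_fun l (\<lambda>x. cos (freq l j * x)))
      = complex_of_real (((if i = j then l else 0) + (if i = 0 \<and> j = 0 then l else 0)) / 2)"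
    by (subst cinner_L2_fun_L2_fun) (auto intro!: continuous_intros simp: integral_cos_cos[OF l])
  then have "cinner (cs l i) (cs l j)
      = complex_of_real (sqrt ((if i = 0 then 1 else 2) / l) * sqrt ((if j = 0 then 1 else 2) / l)
          * (((if i = j then l else 0) + (if i = 0 \<and> j = 0 then l else 0)) / 2))"
    by (simp only: cs_def cinner_simps of_real_mult ac_simps)
  then show ?thesis
    using l by (cases "i = j"; cases "i = 0") auto
qed

lemma cinner_sn_sn:
  assumes l: "l > 0" and ij: "i > 0"
  shows "cinner (sn l i) (sn l j) = (if i = j then 1 else 0)"
proof -
  have "cinner (L2_fun l (\<lambda>x. sin (freq l i * x))) (L2_fun l (\<lambda>x. sin (freq l j * x)))
      = complex_of_real (((if i = j then l else 0) - (if i = 0 \<and> j = 0 then l else 0)) / 2)"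
    by (subst cinner_L2_fun_L2_fun) (auto intro!: continuous_intros simp: integral_sin_sin[OF l])
  then have "cinner (sn l i) (sn l j) = complex_of_real (sqrt (2 / l) * sqrt (2 / l)
          * (((if i = j then l else 0) - (if i = 0 \<and> j = 0 then l else 0)) / 2))"
    by (simp only: sn_def cinner_simps of_real_mult ac_simps)
  then show ?thesis
    using l ij by (cases "i = j") auto
qed

text \<open>The integral of \<open>f\<close> is a nonzero multiple of its zeroth cosine
  coefficient.\<close>

lemma L2_star_iff: "l > 0 \<Longrightarrow> f \<in> L2_star l \<longleftrightarrow> f \<in> L2_on l \<and> cinner f (cs l 0) = 0"
  by (auto simp: L2_star_def cinner_cs L2_pair_def)

lemma onb_cs: "l > 0 \<Longrightarrow> L2_onb (L2_on l) (cs l)"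
  unfolding L2_onb_def
  using closed_L2_on L2_on_0 L2_on_add L2_on_scaleC cs_mem cinner_cs_cs cs_total by blast

lemma onb_sn: "l > 0 \<Longrightarrow> L2_onb (L2_on l) (\<lambda>n. sn l (Suc n))"
  unfolding L2_onb_def
  using closed_L2_on L2_on_0 L2_on_add L2_on_scaleC sn_mem
  by (auto simp: cinner_sn_sn) (metis sn_total Suc_pred)

lemma closed_L2_star: "l > 0 \<Longrightarrow> closed (L2_star l)"
proof -
  assume l: "l > 0"
  have "L2_star l = L2_on l \<inter> (\<lambda>f. cinner f (cs l 0)) -` {0}"
    using L2_star_iff[OF l] by auto
  then show ?thesis
    by (simp add: closed_Int closed_L2_on closed_vimage
        linear_continuous_on[OF bounded_linear_cinner_left])
qed

lemma onb_cs_star: "l > 0 \<Longrightarrow> L2_onb (L2_star l) (\<lambda>n. cs l (Suc n))"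
  unfolding L2_onb_def
proof (intro conjI ballI allI impI)
  assume l: "l > 0"
  note S = L2_star_iff[OF l] L2_on_0 L2_on_add L2_on_scaleC cs_mem cinner_simps cinner_cs_cs[OF l]
  show "closed (L2_star l)"
    by (rule closed_L2_star[OF l])
  show "0 \<in> L2_star l" "\<And>n. cs l (Suc n) \<in> L2_star l"
    by (auto simp: S)
  show "f + g \<in> L2_star l" if "f \<in> L2_star l" "g \<in> L2_star l" for f g
    using that by (auto simp: S)
  show "c *\<^sub>C f \<in> L2_star l" if "f \<in> L2_star l" for f c
    using that by (auto simp: S)
  show "cinner (cs l (Suc i)) (cs l (Suc j)) = (if i = j then 1 else 0)" for i j
    by (simp add: S)
  show "f = 0" if "f \<in> L2_star l" "\<forall>n. cinner f (cs l (Suc n)) = 0" for f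
  proof (rule cs_total[OF l])
    show "cinner f (cs l n) = 0" for n
      using that by (cases n) (auto simp: S)
  qed (use that in \<open>auto simp: S\<close>)
qed

section \<open>Weak derivatives and Fourier coefficients\<close>

text \<open>A \<open>C\<^sup>1\<close> approximation \<open>cutoff \<delta>\<close> of the identity which vanishes on \<open>[-\<delta>,\<delta>]\<close>;
  composing with it turns \<open>sin (n \<pi> x / l)\<close> into a test function.\<close>

definition cutoff :: "real \<Rightarrow> real \<Rightarrow> real" where
  "cutoff \<delta> y = y * (max (y\<^sup>2 - \<delta>\<^sup>2) 0)\<^sup>2 / (y ^ 4 + \<delta> ^ 4)"

text \<open>The derivative of \<open>cutoff\<close> by the quotient rule. Squaring the positive part
  makes it continuous; numerator and denominator are homogeneous of the same degree in y and
  \<delta>, which makes a bound independent of \<delta> possible.\<close>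

definition cutoff' :: "real \<Rightarrow> real \<Rightarrow> real" where
  "cutoff' \<delta> y = (((max (y\<^sup>2 - \<delta>\<^sup>2) 0)\<^sup>2 + 4 * y\<^sup>2 * max (y\<^sup>2 - \<delta>\<^sup>2) 0) * (y ^ 4 + \<delta> ^ 4)
      - 4 * y ^ 4 * (max (y\<^sup>2 - \<delta>\<^sup>2) 0)\<^sup>2) / (y ^ 4 + \<delta> ^ 4)\<^sup>2"

lemma has_real_derivative_max_0_squared:
  "((\<lambda>t::real. (max t 0)\<^sup>2) has_real_derivative 2 * max t 0) (at t)"
proof -
  consider "t > 0" | "t < 0" | "t = 0" by linarith
  then show ?thesis
  proof cases
    case 1
    have "((\<lambda>t::real. t\<^sup>2) has_real_derivative 2 * max t 0) (at t)"
      using 1 by (auto intro!: derivative_eq_intros)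
    then show ?thesis
      by (rule has_field_derivative_transform_within_open[where S = "{0<..}"]) (use 1 in auto)
  next
    case 2
    have "((\<lambda>t::real. 0) has_real_derivative 2 * max t 0) (at t)"
      using 2 by (auto intro!: derivative_eq_intros)
    then show ?thesis
      by (rule has_field_derivative_transform_within_open[where S = "{..<0}"]) (use 2 in auto)
  next
    case 3
    have "((\<lambda>h::real. (max h 0)\<^sup>2 / h) \<longlongrightarrow> 0) (at 0)"
    proof (rule tendsto_rabs_zero_cancel, rule tendsto_sandwich)
      show "\<forall>\<^sub>F h::real in at 0. 0 \<le> \<bar>(max h 0)\<^sup>2 / h\<bar>"
        by simp
      show "\<forall>\<^sub>F h::real in at 0. \<bar>(max h 0)\<^sup>2 / h\<bar> \<le> \<bar>h\<bar>"
        by (rule always_eventually) (auto simp: max_def power2_eq_square)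
      show "((\<lambda>h::real. \<bar>h\<bar>) \<longlongrightarrow> 0) (at 0)"
        by (rule tendsto_eq_intros refl | simp)+
    qed simp
    then show ?thesis
      using 3 by (simp add: has_field_derivative_iff)
  qed
qed

lemma cutoff_deriv:
  assumes "\<delta> > 0"
  shows "(cutoff \<delta> has_real_derivative cutoff' \<delta> y) (at y)"
proof -
  have pos: "y ^ 4 + \<delta> ^ 4 > 0"
    using assms by (simp add: add_nonneg_pos)
  have 1: "((\<lambda>y. (max (y\<^sup>2 - \<delta>\<^sup>2) 0)\<^sup>2) has_real_derivative 2 * max (y\<^sup>2 - \<delta>\<^sup>2) 0 * (2 * y)) (at y)"
    by (rule DERIV_chain'[of "\<lambda>y. y\<^sup>2 - \<delta>\<^sup>2", OF _ has_real_derivative_max_0_squared])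
      (auto intro!: derivative_eq_intros)
  have 2: "((\<lambda>y. y * (max (y\<^sup>2 - \<delta>\<^sup>2) 0)\<^sup>2) has_real_derivative
      y * (2 * max (y\<^sup>2 - \<delta>\<^sup>2) 0 * (2 * y)) + 1 * (max (y\<^sup>2 - \<delta>\<^sup>2) 0)\<^sup>2) (at y)"
    by (rule DERIV_mult'[OF DERIV_ident 1])
  have 3: "((\<lambda>y. y ^ 4 + \<delta> ^ 4) has_real_derivative 4 * y ^ 3) (at y)"
    by (auto intro!: derivative_eq_intros)
  have "(cutoff \<delta> has_real_derivative
      ((y * (2 * max (y\<^sup>2 - \<delta>\<^sup>2) 0 * (2 * y)) + 1 * (max (y\<^sup>2 - \<delta>\<^sup>2) 0)\<^sup>2) * (y ^ 4 + \<delta> ^ 4)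
        - y * (max (y\<^sup>2 - \<delta>\<^sup>2) 0)\<^sup>2 * (4 * y ^ 3)) / ((y ^ 4 + \<delta> ^ 4) * (y ^ 4 + \<delta> ^ 4))) (at y)"
    unfolding cutoff_def[abs_def] by (rule DERIV_divide[OF 2 3]) (use pos in simp)
  moreover have "((y * (2 * m * (2 * y)) + 1 * m\<^sup>2) * D - y * m\<^sup>2 * (4 * y ^ 3)) / (D * D)
      = ((m\<^sup>2 + 4 * y\<^sup>2 * m) * D - 4 * y ^ 4 * m\<^sup>2) / D\<^sup>2" for m D :: real
    by (simp add: power2_eq_square power4_eq_xxxx power3_eq_cube ac_simps)
  ultimately show ?thesis
    by (simp only: cutoff'_def)
qed

lemma continuous_cutoff': "\<delta> > 0 \<Longrightarrow> continuous_on UNIV (cutoff' \<delta>)"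
  unfolding cutoff'_def[abs_def]
proof (intro continuous_intros ballI)
  fix y :: real assume "\<delta> > 0"
  then have "y ^ 4 + \<delta> ^ 4 > 0"
    by (simp add: add_nonneg_pos)
  then show "(y ^ 4 + \<delta> ^ 4)\<^sup>2 \<noteq> 0"
    by simp
qed

lemma cutoff_zero: "\<bar>y\<bar> \<le> \<delta> \<Longrightarrow> cutoff \<delta> y = 0" and cutoff'_zero: "\<bar>y\<bar> \<le> \<delta> \<Longrightarrow> cutoff' \<delta> y = 0"
proof -
  assume "\<bar>y\<bar> \<le> \<delta>"
  then have "y\<^sup>2 \<le> \<delta>\<^sup>2"
    using abs_le_square_iff[of y \<delta>] by simp
  then show "cutoff \<delta> y = 0" "cutoff' \<delta> y = 0"
    by (simp_all add: cutoff_def cutoff'_def)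
qed

lemma max_square_le: "(max (y\<^sup>2 - \<delta>\<^sup>2) 0)\<^sup>2 \<le> y ^ 4" for y \<delta> :: real
proof -
  have "(max (y\<^sup>2 - \<delta>\<^sup>2) 0)\<^sup>2 \<le> (y\<^sup>2)\<^sup>2"
    by (rule power_mono) auto
  then show ?thesis
    by simp
qed

lemma cutoff_bound:
  assumes "\<delta> > 0" shows "\<bar>cutoff \<delta> y\<bar> \<le> \<bar>y\<bar>"
proof -
  have pos: "y ^ 4 + \<delta> ^ 4 > 0"
    using assms by (simp add: add_nonneg_pos)
  have "(max (y\<^sup>2 - \<delta>\<^sup>2) 0)\<^sup>2 \<le> y ^ 4 + \<delta> ^ 4"
    using max_square_le[of y \<delta>] zero_le_power[of \<delta> 4] assms by linarith
  then have "\<bar>y\<bar> * (max (y\<^sup>2 - \<delta>\<^sup>2) 0)\<^sup>2 \<le> \<bar>y\<bar> * (y ^ 4 + \<delta> ^ 4)"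
    by (rule mult_left_mono) simp
  then show ?thesis
    using pos by (simp add: cutoff_def abs_mult pos_divide_le_eq)
qed

text \<open>With m the positive part and D = y^4 + \<delta>^4, each of m^2, y^2 m and y^4 is at most
  D, so the numerator is at most (5 + 4) D^2. Independence of \<delta> allows dominated convergence
  as \<delta> tends to 0.\<close>

lemma cutoff'_bound:
  assumes "\<delta> > 0" shows "\<bar>cutoff' \<delta> y\<bar> \<le> 9"
proof -
  define D where "D = y ^ 4 + \<delta> ^ 4"
  define m where "m = max (y\<^sup>2 - \<delta>\<^sup>2) 0"
  have pos: "D > 0"
    using assms by (simp add: D_def add_nonneg_pos)
  have y4: "y ^ 4 \<le> D" "0 \<le> y ^ 4"
    using assms by (simp_all add: D_def)
  have m2: "0 \<le> m\<^sup>2" "m\<^sup>2 \<le> D"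
    using max_square_le[of y \<delta>] y4 by (auto simp: m_def)
  have "m \<le> y\<^sup>2" "0 \<le> m"
    by (auto simp: m_def)
  then have "y\<^sup>2 * m \<le> y\<^sup>2 * y\<^sup>2" "0 \<le> y\<^sup>2 * m"
    using mult_left_mono[of m "y\<^sup>2" "y\<^sup>2"] by simp_all
  then have ym: "0 \<le> y\<^sup>2 * m" "y\<^sup>2 * m \<le> D"
    using y4 power_add[of y 2 2] by auto
  have a: "(m\<^sup>2 + 4 * y\<^sup>2 * m) * D \<le> 5 * D * D"
    using m2 ym pos by (intro mult_right_mono) auto
  have b: "4 * y ^ 4 * m\<^sup>2 \<le> 4 * D * D"
    using mult_mono[OF y4(1) m2(2)] pos m2 by simp
  have a0: "0 \<le> (m\<^sup>2 + 4 * y\<^sup>2 * m) * D"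
  proof (rule mult_nonneg_nonneg)
    show "0 \<le> m\<^sup>2 + 4 * y\<^sup>2 * m"
      using m2 ym by (simp add: mult.assoc)
  qed (use pos in simp)
  have b0: "0 \<le> 4 * y ^ 4 * m\<^sup>2"
    using y4 m2 by (intro mult_nonneg_nonneg) auto
  have "0 \<le> D * D"
    by simp
  then have "\<bar>(m\<^sup>2 + 4 * y\<^sup>2 * m) * D - 4 * y ^ 4 * m\<^sup>2\<bar> \<le> 9 * D\<^sup>2"
    using a b a0 b0 unfolding power2_eq_square by linarith
  then show ?thesis
    using pos by (simp add: cutoff'_def m_def[symmetric] D_def[symmetric] pos_divide_le_eq)
qed

lemma cutoff_tendsto:
  assumes "\<delta> \<longlonglongrightarrow> 0" "y \<noteq> 0"
  shows "(\<lambda>k. cutoff (\<delta> k) y) \<longlonglongrightarrow> y" "(\<lambda>k. cutoff' (\<delta> k) y) \<longlonglongrightarrow> 1"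
proof -
  have "(\<lambda>k. cutoff (\<delta> k) y) \<longlonglongrightarrow> y * (max (y\<^sup>2 - 0\<^sup>2) 0)\<^sup>2 / (y ^ 4 + 0 ^ 4)"
    unfolding cutoff_def by (intro tendsto_intros assms) (use assms in auto)
  then show "(\<lambda>k. cutoff (\<delta> k) y) \<longlonglongrightarrow> y"
    using assms by (simp add: max_def)
  have "(\<lambda>k. cutoff' (\<delta> k) y) \<longlonglongrightarrow>
      (((max (y\<^sup>2 - 0\<^sup>2) 0)\<^sup>2 + 4 * y\<^sup>2 * max (y\<^sup>2 - 0\<^sup>2) 0) * (y ^ 4 + 0 ^ 4)
        - 4 * y ^ 4 * (max (y\<^sup>2 - 0\<^sup>2) 0)\<^sup>2) / (y ^ 4 + 0 ^ 4)\<^sup>2"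
    unfolding cutoff'_def by (intro tendsto_intros assms) (use assms in auto)
  also have "(((max (y\<^sup>2 - 0\<^sup>2) 0)\<^sup>2 + 4 * y\<^sup>2 * max (y\<^sup>2 - 0\<^sup>2) 0) * (y ^ 4 + 0 ^ 4)
        - 4 * y ^ 4 * (max (y\<^sup>2 - 0\<^sup>2) 0)\<^sup>2) / (y ^ 4 + 0 ^ 4)\<^sup>2 = 1"
  proof -
    have "max (y\<^sup>2 - 0\<^sup>2) 0 = y\<^sup>2"
      by simp
    moreover have "y\<^sup>2 * y\<^sup>2 = y ^ 4"
      by (simp add: power2_eq_square power4_eq_xxxx)
    moreover have "y ^ 4 \<noteq> 0"
      using assms by simp
    ultimately show ?thesis
      by (simp add: power2_eq_square[of "y ^ 4"] power2_eq_square[of "y\<^sup>2"] mult.assoc)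
  qed
  finally show "(\<lambda>k. cutoff' (\<delta> k) y) \<longlonglongrightarrow> 1" .
qed

text \<open>As \<open>\<theta>\<close> vanishes at 0 and l, it is smaller than
  \<open>\<delta>\<close> near the ends, where \<open>cutoff\<close> kills it; hence the compact
  support in (0,l).\<close>

lemma test_fun_cutoff:
  assumes l: "l > 0" and \<delta>: "\<delta> > 0"
    and \<theta>: "\<And>x. (\<theta> has_real_derivative \<theta>' x) (at x)" "continuous_on UNIV \<theta>'" "\<theta> 0 = 0" "\<theta> l = 0"
  shows "test_fun l (\<lambda>x. if x \<in> {0<..<l} then complex_of_real (cutoff \<delta> (\<theta> x)) else 0)
     (\<lambda>x. if x \<in> {0<..<l} then complex_of_real (cutoff' \<delta> (\<theta> x) * \<theta>' x) else 0)"
proof -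
  let ?\<phi> = "\<lambda>x. if x \<in> {0<..<l} then complex_of_real (cutoff \<delta> (\<theta> x)) else 0"
  let ?\<phi>' = "\<lambda>x. if x \<in> {0<..<l} then complex_of_real (cutoff' \<delta> (\<theta> x) * \<theta>' x) else 0"
  have cont: "isCont \<theta> x" for x
    using \<theta>(1) DERIV_isCont by blast
  have "\<exists>e>0. \<forall>x. \<bar>x - c\<bar> < e \<longrightarrow> \<bar>\<theta> x\<bar> < \<delta>" if "\<theta> c = 0" for c
    using cont[of c] \<delta> that unfolding isCont_def LIM_eq
    by (metis diff_zero real_norm_def abs_0 diff_self)
  from this[OF \<theta>(3)] this[OF \<theta>(4)] obtain e1 e2
    where e1: "e1 > 0" "\<And>x. \<bar>x - 0\<bar> < e1 \<Longrightarrow> \<bar>\<theta> x\<bar> < \<delta>"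
      and e2: "e2 > 0" "\<And>x. \<bar>x - l\<bar> < e2 \<Longrightarrow> \<bar>\<theta> x\<bar> < \<delta>"
    by blast
  \<comment> \<open>The bound l / 4 ensures \<open>a \<le> l - a\<close>; halving
    \<open>min e1 e2\<close> makes \<open>a\<close> strictly smaller than both.\<close>
  define a where "a = min (l / 4) (min e1 e2 / 2)"
  have a: "0 < a" "a \<le> l - a" "l - a < l" "a < e1" "a < e2"
    using l e1 e2 by (auto simp: a_def min_def)
  have small: "\<bar>\<theta> x\<bar> \<le> \<delta>" if "x \<in> {0<..<l}" "x \<notin> {a..l - a}" for x
  proof (cases "x < a")
    case True
    then show ?thesis
      using that a e1(2)[of x] by auto
  next
    case False
    then show ?thesis
      using that a e2(2)[of x] by auto
  qed
  have out: "?\<phi> x = 0" "?\<phi>' x = 0" if "x \<notin> {a..l - a}" for x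
    using small[OF _ that] cutoff_zero cutoff'_zero by auto
  have deriv: "(?\<phi> has_vector_derivative ?\<phi>' x) (at x)" for x
  proof (cases "x \<in> {0<..<l}")
    case True
    have "((\<lambda>x. cutoff \<delta> (\<theta> x)) has_real_derivative cutoff' \<delta> (\<theta> x) * \<theta>' x) (at x)"
      by (rule DERIV_chain2[OF cutoff_deriv[OF \<delta>] \<theta>(1)])
    then have "((\<lambda>x. complex_of_real (cutoff \<delta> (\<theta> x))) has_vector_derivative
        complex_of_real (cutoff' \<delta> (\<theta> x) * \<theta>' x)) (at x)"
      by (intro has_vector_derivative_of_real) (simp add: has_real_derivative_iff_has_vector_derivative)
    then have "(?\<phi> has_vector_derivative complex_of_real (cutoff' \<delta> (\<theta> x) * \<theta>' x)) (at x)"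
      by (rule has_vector_derivative_transform_within_open[where S = "{0<..<l}"]) (use True in auto)
    then show ?thesis
      using True by (simp only: if_True)
  next
    case False
    then have x: "x \<in> - {a..l - a}"
      using a by auto
    have "((\<lambda>x. 0) has_vector_derivative (0::complex)) (at x)"
      by simp
    then have "(?\<phi> has_vector_derivative 0) (at x)"
      by (rule has_vector_derivative_transform_within_open[where S = "- {a..l - a}"])
        (use x in \<open>auto simp: out(1)[symmetric]\<close>)
    then show ?thesis
      using False by (simp only: if_False)
  qed
  have contU: "continuous_on A (\<lambda>x. complex_of_real (cutoff' \<delta> (\<theta> x) * \<theta>' x))" for A
    using continuous_on_compose2[OF continuous_cutoff'[OF \<delta>], of A \<theta>] cont \<theta>(2)
    by (intro continuous_intros) (auto intro: continuous_at_imp_continuous_on continuous_on_subset)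
  \<comment> \<open>The open interval and the complement of [a, l - a] cover the line, and on each
    of these open sets the derivative has one continuous formula.\<close>
  have "continuous_on ({0<..<l} \<union> - {a..l - a}) ?\<phi>'"
  proof (rule continuous_on_open_Un)
    show "continuous_on {0<..<l} ?\<phi>'"
      using contU by (rule continuous_on_cong[THEN iffD1, rotated 2]) auto
    show "continuous_on (- {a..l - a}) ?\<phi>'"
      using continuous_on_const by (rule continuous_on_cong[THEN iffD1, rotated 2]) (use out in auto)
  qed auto
  moreover have "{0<..<l} \<union> - {a..l - a} = UNIV"
    using a by auto
  ultimately have "continuous_on UNIV ?\<phi>'"
    by simp
  moreover have "\<exists>a b. 0 < a \<and> a \<le> b \<and> b < l \<and> (\<forall>x. x \<notin> {a..b} \<longrightarrow> ?\<phi> x = 0)"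
    using a out(1) by blast
  ultimately show ?thesis
    unfolding test_fun_def using deriv by blast
qed

section \<open>Sine coefficients of a weak derivative\<close>

lemma has_weak_derivD:
  assumes "has_weak_deriv l f g"
  shows "f \<in> L2_on l" "g \<in> L2_on l"
    "test_fun l \<phi> \<phi>' \<Longrightarrow> L2_pair l f \<phi>' = - L2_pair l g \<phi>"
  using assms by (auto simp: has_weak_deriv_def L2_pair_def)

lemma L2_pair_dominated:
  assumes [measurable]: "\<And>k. \<psi> k \<in> borel_measurable borel" "\<phi> \<in> borel_measurable borel"
    and lim: "AE x in lborel. x \<in> {0<..<l} \<longrightarrow> (\<lambda>k. \<psi> k x) \<longlonglongrightarrow> \<phi> x"
    and bound: "\<And>k x. cmod (\<psi> k x) \<le> B"
  shows "(\<lambda>k. L2_pair l f (\<psi> k)) \<longlonglongrightarrow> L2_pair l f \<phi>"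
  unfolding L2_pair_def set_lebesgue_integral_def
proof (rule integral_dominated_convergence[where w = "\<lambda>x. B * cmod (indicator {0<..<l} x *\<^sub>R rep_L2 f x)"])
  show "integrable lborel (\<lambda>x. B * cmod (indicator {0<..<l} x *\<^sub>R rep_L2 f x))"
    using rep_L2_integrable[of l f] unfolding set_integrable_def
    by (intro integrable_mult_right integrable_norm)
  show "AE x in lborel. (\<lambda>k. indicator {0<..<l} x *\<^sub>R (rep_L2 f x * \<psi> k x))
      \<longlonglongrightarrow> indicator {0<..<l} x *\<^sub>R (rep_L2 f x * \<phi> x)"
    using lim by eventually_elim (auto simp: indicator_def intro!: tendsto_intros)
  show "AE x in lborel. cmod (indicator {0<..<l} x *\<^sub>R (rep_L2 f x * \<psi> k x))
      \<le> B * cmod (indicator {0<..<l} x *\<^sub>R rep_L2 f x)" for k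
    using bound[of k] by (auto simp: norm_mult indicator_def mult.commute[of B] intro!: mult_left_mono AE_I2)
qed measurable

lemma sin_zero_null:
  fixes c :: real
  assumes "c \<noteq> 0"
  shows "AE x in lborel. sin (c * x) \<noteq> 0"
proof -
  have "{x. sin (c * x) = 0} \<subseteq> range (\<lambda>i::int. of_int i * pi / c)"
    using assms by (auto simp: sin_zero_iff_int2 field_simps)
  then have "countable {x. sin (c * x) = 0}"
    by (rule countable_subset) auto
  then have "{x. sin (c * x) = 0} \<in> null_sets lborel"
    by (rule countable_imp_null_set_lborel)
  then show ?thesis
    by (rule AE_I') auto
qed

text \<open>The sine vanishes at both ends, so it is a limit of test functions and no boundary value
  of \<open>f\<close> enters. The derivatives of the cut-off sines converge off the zeros of the
  sine, a null set, and are dominated by 9 times the frequency.\<close>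

lemma weak_deriv_L2_pair_sin:
  assumes l: "l > 0" and w: "has_weak_deriv l f g" and n: "n > 0"
  shows "L2_pair l g (\<lambda>x. complex_of_real (sin (freq l n * x)))
     = - complex_of_real (freq l n) * L2_pair l f (\<lambda>x. complex_of_real (cos (freq l n * x)))"
proof -
  define \<theta> where "\<theta> x = sin (freq l n * x)" for x
  define \<theta>' where "\<theta>' x = freq l n * cos (freq l n * x)" for x
  have \<theta>: "(\<theta> has_real_derivative \<theta>' x) (at x)" "continuous_on UNIV \<theta>'" "\<theta> 0 = 0" "\<theta> l = 0" for x
    using l by (auto simp: \<theta>_def[abs_def] \<theta>'_def[abs_def] intro!: derivative_eq_intros continuous_intros)
  define \<delta> where "\<delta> k = 1 / real (Suc k)" for k
  have \<delta>: "\<delta> k > 0" "\<delta> \<longlonglongrightarrow> 0" for k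
    using LIMSEQ_inverse_real_of_nat by (auto simp: \<delta>_def[abs_def] inverse_eq_divide)
  define \<phi> where "\<phi> k x = (if x \<in> {0<..<l} then complex_of_real (cutoff (\<delta> k) (\<theta> x)) else 0)" for k x
  define \<phi>' where "\<phi>' k x = (if x \<in> {0<..<l} then complex_of_real (cutoff' (\<delta> k) (\<theta> x) * \<theta>' x) else 0)" for k x
  have test: "test_fun l (\<phi> k) (\<phi>' k)" for k
    unfolding \<phi>_def \<phi>'_def by (rule test_fun_cutoff[OF l \<delta>(1) \<theta>])
  have nz: "AE x in lborel. \<theta> x \<noteq> 0"
    unfolding \<theta>_def by (rule sin_zero_null) (use freq_pos[OF l n] in simp)
  have [measurable]: "\<phi> k \<in> borel_measurable borel" "\<phi>' k \<in> borel_measurable borel" for k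
  proof -
    have "continuous_on UNIV (\<phi> k)" "continuous_on UNIV (\<phi>' k)"
      using test[of k] unfolding test_fun_def
      by (auto intro: continuous_at_imp_continuous_on has_vector_derivative_continuous)
    then show "\<phi> k \<in> borel_measurable borel" "\<phi>' k \<in> borel_measurable borel"
      by (auto intro: borel_measurable_continuous_onI)
  qed
  have lim: "(\<lambda>k. L2_pair l g (\<phi> k)) \<longlonglongrightarrow> L2_pair l g (\<lambda>x. complex_of_real (\<theta> x))"
  proof (rule L2_pair_dominated)
    show "AE x in lborel. x \<in> {0<..<l} \<longrightarrow> (\<lambda>k. \<phi> k x) \<longlonglongrightarrow> complex_of_real (\<theta> x)"
      using nz by eventually_elim (auto simp: \<phi>_def intro!: tendsto_of_real cutoff_tendsto \<delta>)
    show "cmod (\<phi> k x) \<le> 1" for k x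
      using cutoff_bound[OF \<delta>(1)[of k], of "\<theta> x"] abs_sin_le_one[of "freq l n * x"]
      by (auto simp: \<phi>_def \<theta>_def intro: order_trans)
  qed (auto simp: \<theta>_def)
  have lim': "(\<lambda>k. L2_pair l f (\<phi>' k)) \<longlonglongrightarrow> L2_pair l f (\<lambda>x. complex_of_real (\<theta>' x))"
  proof (rule L2_pair_dominated)
    show "AE x in lborel. x \<in> {0<..<l} \<longrightarrow> (\<lambda>k. \<phi>' k x) \<longlonglongrightarrow> complex_of_real (\<theta>' x)"
      using nz
    proof eventually_elim
      case (elim x)
      have "(\<lambda>k. cutoff' (\<delta> k) (\<theta> x) * \<theta>' x) \<longlonglongrightarrow> 1 * \<theta>' x"
        by (intro tendsto_intros cutoff_tendsto \<delta> elim)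
      then show ?case
        by (auto simp: \<phi>'_def simp del: of_real_mult intro!: tendsto_of_real)
    qed
    show "cmod (\<phi>' k x) \<le> 9 * \<bar>freq l n\<bar>" for k x
      using mult_mono[OF cutoff'_bound[OF \<delta>(1)[of k], of "\<theta> x"], of "\<bar>\<theta>' x\<bar>" "\<bar>freq l n\<bar>"]
      by (auto simp: \<phi>'_def norm_mult \<theta>'_def abs_mult mult_left_le)
  qed (auto simp: \<theta>'_def)
  have "L2_pair l f (\<phi>' k) = - L2_pair l g (\<phi> k)" for k
    by (rule has_weak_derivD(3)[OF w test])
  then have "(\<lambda>k. - L2_pair l g (\<phi> k)) \<longlonglongrightarrow> L2_pair l f (\<lambda>x. complex_of_real (\<theta>' x))"
    using lim' by simp
  then have "L2_pair l f (\<lambda>x. complex_of_real (\<theta>' x)) = - L2_pair l g (\<lambda>x. complex_of_real (\<theta> x))"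
    using tendsto_minus[OF lim] LIMSEQ_unique by blast
  then show ?thesis
    by (simp add: \<theta>_def \<theta>'_def L2_pair_cmult_right)
qed

lemma weak_deriv_sn:
  assumes l: "l > 0" and w: "has_weak_deriv l f g"
  shows "cinner g (sn l n) = - complex_of_real (freq l n) * cinner f (cs l n)"
proof (cases "n = 0")
  case True
  then show ?thesis
    by (simp add: cinner_sn L2_pair_def)
next
  case False
  then show ?thesis
    using weak_deriv_L2_pair_sin[OF l w, of n] by (simp add: cinner_sn cinner_cs)
qed

text \<open>The sine coefficients of a weak derivative are determined by \<open>f\<close>, and the
  sines are total. This justifies the definite description in \<open>weak_deriv\<close>.\<close>

lemma weak_deriv_unique:
  assumes l: "l > 0" and "has_weak_deriv l f g" "has_weak_deriv l f h"
  shows "g = h"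
proof -
  have "g - h = 0"
  proof (rule sn_total[OF l])
    show "g - h \<in> L2_on l"
      by (rule L2_onb_diff[OF onb_cs[OF l]]) (use assms has_weak_derivD in auto)
    show "cinner (g - h) (sn l n) = 0" for n
      using weak_deriv_sn[OF l assms(2), of n] weak_deriv_sn[OF l assms(3), of n]
      by (simp add: cinner_simps)
  qed
  then show ?thesis
    by simp
qed

lemma weak_deriv_eqI: "l > 0 \<Longrightarrow> has_weak_deriv l f g \<Longrightarrow> weak_deriv l f = g"
  unfolding weak_deriv_def using weak_deriv_unique by blast

lemma H1_weak_deriv: "l > 0 \<Longrightarrow> f \<in> H1 l \<Longrightarrow> has_weak_deriv l f (weak_deriv l f)"
  unfolding H1_def using weak_deriv_eqI by auto

section \<open>Primitives, continuous representatives and boundary values\<close>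

definition primitive :: "real \<Rightarrow> L2 \<Rightarrow> real \<Rightarrow> complex" where
  "primitive l g x = (LBINT t. indicator {..<x} t *\<^sub>R (indicator {0<..<l} t *\<^sub>R rep_L2 g t))"

lemma rep_L2_cut_integrable: "integrable lborel (\<lambda>t. indicator {0<..<l} t *\<^sub>R rep_L2 g t)"
  using rep_L2_integrable[of l g] by (simp add: set_integrable_def)

lemma primitive_0: "primitive l g 0 = 0"
proof -
  have "primitive l g 0 = (LBINT t::real. 0)"
    unfolding primitive_def by (intro Bochner_Integration.integral_cong) (auto simp: indicator_def)
  then show ?thesis
    by simp
qed

lemma primitive_l: "primitive l g l = L2_pair l g (\<lambda>x. 1)"
  unfolding primitive_def L2_pair_rep
  by (intro Bochner_Integration.integral_cong) (auto simp: indicator_def)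

lemma continuous_primitive: "continuous_on UNIV (primitive l g)"
proof -
  have "primitive l g \<midarrow>x\<rightarrow> primitive l g x" for x
    unfolding tendsto_at_iff_sequentially
  proof (intro allI impI)
    fix X :: "nat \<Rightarrow> real"
    assume X: "X \<longlonglongrightarrow> x"
    show "(primitive l g \<circ> X) \<longlonglongrightarrow> primitive l g x"
      unfolding primitive_def comp_def
    proof (rule integral_dominated_convergence[where w = "\<lambda>t. norm (indicator {0<..<l} t *\<^sub>R rep_L2 g t)"])
      show "integrable lborel (\<lambda>t. norm (indicator {0<..<l} t *\<^sub>R rep_L2 g t))"
        by (intro integrable_norm rep_L2_cut_integrable)
      \<comment> \<open>At t = x the indicators need not converge.\<close>
      have "AE t in lborel. t \<noteq> x"
        by (rule AE_lborel_singleton)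
      then show "AE t in lborel. (\<lambda>n. indicator {..<X n} t *\<^sub>R (indicator {0<..<l} t *\<^sub>R rep_L2 g t))
          \<longlonglongrightarrow> indicator {..<x} t *\<^sub>R (indicator {0<..<l} t *\<^sub>R rep_L2 g t)"
      proof eventually_elim
        case (elim t)
        have "(\<lambda>n. indicator {..<X n} t :: real) \<longlonglongrightarrow> indicator {..<x} t"
        proof (cases "t < x")
          case True
          then have "eventually (\<lambda>n. t < X n) sequentially"
            using X order_tendstoD(1) by blast
          then show ?thesis
            using True by (intro tendsto_eventually) (auto elim: eventually_mono)
        next
          case False
          then have "eventually (\<lambda>n. X n < t) sequentially"
            using X elim order_tendstoD(2) by (metis linorder_neqE_linordered_idom)
          then show ?thesis
            using False by (intro tendsto_eventually) (auto elim!: eventually_mono)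
        qed
        then show ?case
          by (intro tendsto_intros)
      qed
    qed (auto simp: indicator_def)
  qed
  then show ?thesis
    by (simp add: continuous_on_def)
qed

text \<open>Fubini's theorem for \<open>g t * \<psi>' x\<close> on \<open>t < x\<close>.\<close>

lemma primitive_parts:
  fixes \<psi> \<psi>' :: "real \<Rightarrow> complex"
  assumes l: "l > 0" and deriv: "\<And>x. (\<psi> has_vector_derivative \<psi>' x) (at x)"
    and cont: "continuous_on UNIV \<psi>'"
  shows "(LBINT x:{0<..<l}. primitive l g x * \<psi>' x) = primitive l g l * \<psi> l - L2_pair l g \<psi>"
proof -
  define F where "F t = indicator {0<..<l} t *\<^sub>R rep_L2 g t" for t
  define P where "P x = indicator {0<..<l} x *\<^sub>R \<psi>' x" for x
  define H where "H t x = indicator {t<..} x *\<^sub>R (F t * P x)" for t x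
  have F: "integrable lborel F"
    unfolding F_def by (rule rep_L2_cut_integrable)
  have [measurable]: "\<psi>' \<in> borel_measurable borel"
    using cont by (rule borel_measurable_continuous_onI)
  have \<psi>: "continuous_on A \<psi>" for A
    using deriv by (intro continuous_at_imp_continuous_on) (auto intro: has_vector_derivative_continuous)
  have [measurable]: "F \<in> borel_measurable borel" "P \<in> borel_measurable borel"
    by (auto simp: F_def[abs_def] P_def[abs_def])
  have "set_integrable lborel {0..l} \<psi>'"
    by (rule borel_integrable_atLeastAtMost') (rule continuous_on_subset[OF cont], simp)
  then have "set_integrable lborel {0<..<l} \<psi>'"
    by (rule set_integrable_subset) auto
  then have P: "integrable lborel P"
    by (simp add: set_integrable_def P_def[abs_def])
  have intH: "integrable lborel (H t)" for t
    unfolding H_def[abs_def] by (intro integrable_mult_indicator integrable_mult_right P) simp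
  have Hmeas [measurable]: "(\<lambda>p. H (fst p) (snd p)) \<in> borel_measurable (lborel \<Otimes>\<^sub>M lborel)"
  proof -
    have "(\<lambda>p. H (fst p) (snd p))
        = (\<lambda>p. if fst p < snd p then F (fst p) * P (snd p) else 0 :: complex)"
      by (auto simp: H_def indicator_def fun_eq_iff)
    then show ?thesis
      by simp
  qed
  have "integrable (lborel \<Otimes>\<^sub>M lborel) (\<lambda>p. H (fst p) (snd p))"
  proof (rule lborel_pair.Fubini_integrable[OF Hmeas])
    show "AE t in lborel. integrable lborel (\<lambda>x. H (fst (t, x)) (snd (t, x)))"
      by (simp add: intH)
    show "integrable lborel (\<lambda>t. LBINT x. norm (H (fst (t, x)) (snd (t, x))))"
    proof (rule Bochner_Integration.integrable_bound)
      show "integrable lborel (\<lambda>t. norm (F t) * (LBINT x. norm (P x)))"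
        by (intro integrable_mult_left integrable_norm F)
      show "(\<lambda>t. LBINT x. norm (H (fst (t, x)) (snd (t, x)))) \<in> borel_measurable lborel"
        using Hmeas by measurable
      show "AE t in lborel. norm (LBINT x. norm (H (fst (t, x)) (snd (t, x))))
          \<le> norm (norm (F t) * (LBINT x. norm (P x)))"
      proof (rule AE_I2)
        fix t
        have "(LBINT x. norm (H t x)) \<le> (LBINT x. norm (F t) * norm (P x))"
          by (intro integral_mono integrable_norm intH integrable_mult_right P)
            (auto simp: H_def indicator_def norm_mult)
        then show "norm (LBINT x. norm (H (fst (t, x)) (snd (t, x))))
            \<le> norm (norm (F t) * (LBINT x. norm (P x)))"
          by simp
      qed
    qed
  qed
  then have swap: "(LBINT x. LBINT t. H t x) = (LBINT t. LBINT x. H t x)"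
    by (intro lborel_pair.Fubini_integral) (simp add: case_prod_beta')
  have "(LBINT t. H t x) = indicator {0<..<l} x *\<^sub>R (primitive l g x * \<psi>' x)" for x
  proof -
    have "(LBINT t. H t x) = (LBINT t. (indicator {..<x} t *\<^sub>R F t) * P x)"
      by (intro Bochner_Integration.integral_cong) (auto simp: H_def indicator_def)
    also have "\<dots> = primitive l g x * P x"
      unfolding primitive_def F_def by (rule integral_mult_left_zero)
    finally show ?thesis
      by (simp add: P_def scaleR_conv_of_real)
  qed
  moreover have "(LBINT x. H t x) = F t * \<psi> l - F t * \<psi> t" for t
  proof (cases "t \<in> {0<..<l}")
    case True
    have "(LBINT x. H t x) = (LBINT x. F t * (indicator {t<..<l} x *\<^sub>R \<psi>' x))"
      using True by (intro Bochner_Integration.integral_cong) (auto simp: H_def P_def indicator_def)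
    also have "\<dots> = F t * (LBINT x. indicator {t<..<l} x *\<^sub>R \<psi>' x)"
      by (rule integral_mult_right_zero)
    also have "(LBINT x. indicator {t<..<l} x *\<^sub>R \<psi>' x) = (LBINT x. indicator {t..l} x *\<^sub>R \<psi>' x)"
    proof (rule Bochner_Integration.integral_cong_AE)
      show "AE x in lborel. indicator {t<..<l} x *\<^sub>R \<psi>' x = indicator {t..l} x *\<^sub>R \<psi>' x"
        using AE_lborel_singleton[of t] AE_lborel_singleton[of l]
        by eventually_elim (auto simp: indicator_def)
    qed auto
    also have "\<dots> = \<psi> l - \<psi> t"
      by (rule integral_FTC_Icc)
        (use True deriv continuous_on_subset[OF cont] in \<open>auto intro: has_vector_derivative_at_within\<close>)
    finally show ?thesis
      by (simp add: algebra_simps)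
  next
    case False
    then show ?thesis
      by (simp add: H_def[abs_def] F_def)
  qed
  ultimately have "(LBINT x:{0<..<l}. primitive l g x * \<psi>' x) = (LBINT t. F t * \<psi> l - F t * \<psi> t)"
    using swap by (simp add: set_lebesgue_integral_def)
  also have "\<dots> = (LBINT t. F t * \<psi> l) - (LBINT t. F t * \<psi> t)"
  proof (rule Bochner_Integration.integral_diff)
    show "integrable lborel (\<lambda>t. F t * \<psi> l)"
      by (intro integrable_mult_left F)
    show "integrable lborel (\<lambda>t. F t * \<psi> t)"
      using rep_L2_mult_integrable[OF \<psi>, of l g]
      by (simp add: set_integrable_def F_def[abs_def])
  qed
  also have "(LBINT t. F t * \<psi> t) = L2_pair l g \<psi>"
    by (simp add: F_def L2_pair_rep)
  also have "(LBINT t. F t * \<psi> l) = (LBINT t. F t) * \<psi> l"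
    by (rule integral_mult_left_zero)
  also have "(LBINT t. F t) = primitive l g l"
    by (simp add: primitive_l L2_pair_rep F_def)
  finally show ?thesis .
qed

text \<open>Integration by parts is required against every C^1 function, not only those with compact
  support in (0,l). The resulting boundary terms are what makes the boundary values of
  \<open>f\<close> accessible.\<close>

definition H1_rep :: "real \<Rightarrow> L2 \<Rightarrow> L2 \<Rightarrow> (real \<Rightarrow> complex) \<Rightarrow> bool" where
  "H1_rep l f g W \<longleftrightarrow> f \<in> L2_on l \<and> g \<in> L2_on l \<and> continuous_on UNIV W \<and>
     (AE x in lborel. x \<in> {0<..<l} \<longrightarrow> rep_L2 f x = W x) \<and>
     (\<forall>\<psi> \<psi>'. (\<forall>x. (\<psi> has_vector_derivative \<psi>' x) (at x)) \<longrightarrow> continuous_on UNIV \<psi>' \<longrightarrow>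
        L2_pair l f \<psi>' + L2_pair l g \<psi> = W l * \<psi> l - W 0 * \<psi> 0)"

lemma H1_repD:
  assumes "H1_rep l f g W"
  shows "f \<in> L2_on l" "g \<in> L2_on l" "continuous_on UNIV W"
    "AE x in lborel. x \<in> {0<..<l} \<longrightarrow> rep_L2 f x = W x"
    "(\<And>x. (\<psi> has_vector_derivative \<psi>' x) (at x)) \<Longrightarrow> continuous_on UNIV \<psi>' \<Longrightarrow>
        L2_pair l f \<psi>' + L2_pair l g \<psi> = W l * \<psi> l - W 0 * \<psi> 0"
  using assms by (simp_all add: H1_rep_def)

lemma H1_rep_has_weak_deriv:
  assumes "H1_rep l f g W"
  shows "has_weak_deriv l f g"
  unfolding has_weak_deriv_def L2_pair_def[symmetric]
proof (intro conjI allI impI)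
  fix \<phi> \<phi>' assume t: "test_fun l \<phi> \<phi>'"
  then have "\<phi> 0 = 0" "\<phi> l = 0"
    unfolding test_fun_def by fastforce+
  then show "L2_pair l f \<phi>' = - L2_pair l g \<phi>"
    using H1_repD(5)[OF assms, of \<phi> \<phi>'] t by (simp add: test_fun_def eq_neg_iff_add_eq_0)
qed (use H1_repD[OF assms] in auto)

lemma H1_rep_primitive:
  assumes l: "l > 0" and g: "g \<in> L2_on l"
  obtains \<gamma> where "H1_rep l \<gamma> g (primitive l g)"
proof -
  define \<gamma> where "\<gamma> = abs_L2 (\<lambda>x. indicator {0<..<l} x *\<^sub>R primitive l g x)"
  have rep: "AE x in lborel. rep_L2 \<gamma> x = indicator {0<..<l} x *\<^sub>R primitive l g x"
    unfolding \<gamma>_def by (intro rep_abs_L2 sq_int_continuous continuous_primitive)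
  have "\<gamma> \<in> L2_on l"
    using rep unfolding L2_on_def by (auto elim: eventually_mono)
  have ae: "AE x in lborel. x \<in> {0<..<l} \<longrightarrow> rep_L2 \<gamma> x = primitive l g x"
    using rep by eventually_elim auto
  have "H1_rep l \<gamma> g (primitive l g)"
    unfolding H1_rep_def
  proof (intro conjI allI impI)
    fix \<psi> \<psi>' :: "real \<Rightarrow> complex"
    assume a: "\<forall>x. (\<psi> has_vector_derivative \<psi>' x) (at x)" "continuous_on UNIV \<psi>'"
    have "L2_pair l \<gamma> \<psi>' = (LBINT x:{0<..<l}. primitive l g x * \<psi>' x)"
      by (rule L2_pair_AE_cong[OF ae _ a(2)])
        (rule borel_measurable_continuous_onI[OF continuous_primitive])
    then show "L2_pair l \<gamma> \<psi>' + L2_pair l g \<psi> = primitive l g l * \<psi> l - primitive l g 0 * \<psi> 0"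
      using primitive_parts[OF l _ a(2), of \<psi> g] a(1) by (simp add: primitive_0)
  qed (rule \<open>\<gamma> \<in> L2_on l\<close> g continuous_primitive ae)+
  moreover have "continuous_on UNIV (primitive l g)"
    by (rule continuous_primitive)
  ultimately show ?thesis
    using that by blast
qed

text \<open>The additional boundary terms are a constant times the integral of \<psi>', so the
  derivative stays the same. The factor sqrt (1 / l) is the value of the normalized constant
  \<open>cs l 0\<close>.\<close>

lemma H1_rep_add_const:
  assumes l: "l > 0" and W: "H1_rep l f g W"
  shows "H1_rep l (f + c *\<^sub>C cs l 0) g (\<lambda>x. W x + c * complex_of_real (sqrt (1 / l)))"
  unfolding H1_rep_def
proof (intro conjI allI impI)
  let ?c = "c * complex_of_real (sqrt (1 / l))"
  show "f + c *\<^sub>C cs l 0 \<in> L2_on l"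
    by (intro L2_on_add L2_on_scaleC cs_mem H1_repD[OF W])
  show "g \<in> L2_on l"
    by (rule H1_repD[OF W])
  show contW: "continuous_on UNIV (\<lambda>x. W x + ?c)"
    by (intro continuous_intros H1_repD[OF W])
  have "AE x in lborel. rep_L2 (cs l 0) x = complex_of_real (sqrt (1 / l)) * rep_L2 (L2_fun l (\<lambda>x. 1)) x"
    unfolding cs_0 by (rule rep_L2_scaleR)
  moreover have "AE x in lborel. rep_L2 (L2_fun l (\<lambda>x. 1)) x = indicator {0<..<l} x *\<^sub>R complex_of_real 1"
    by (rule rep_L2_fun) simp
  ultimately show ae: "AE x in lborel. x \<in> {0<..<l} \<longrightarrow> rep_L2 (f + c *\<^sub>C cs l 0) x = W x + ?c"
    using rep_L2_add[of f "c *\<^sub>C cs l 0"] rep_L2_scaleC[of c "cs l 0"] H1_repD(4)[OF W]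
    by eventually_elim simp
  fix \<psi> \<psi>' :: "real \<Rightarrow> complex"
  assume a: "\<forall>x. (\<psi> has_vector_derivative \<psi>' x) (at x)" "continuous_on UNIV \<psi>'"
  have W_meas: "W \<in> borel_measurable borel" "(\<lambda>x. W x + ?c) \<in> borel_measurable borel"
    by (rule borel_measurable_continuous_onI, rule H1_repD[OF W], rule borel_measurable_continuous_onI, rule contW)
  have si: "set_integrable lborel {0<..<l} h" if "continuous_on UNIV h" for h :: "real \<Rightarrow> complex"
    by (rule set_integrable_subset[of _ "{0..l}"])
      (auto intro!: borel_integrable_atLeastAtMost' continuous_on_subset[OF that])
  have "(LBINT x:{0<..<l}. \<psi>' x) = (LBINT x:{0..l}. \<psi>' x)"
    unfolding set_lebesgue_integral_def
  proof (rule Bochner_Integration.integral_cong_AE)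
    show "AE x in lborel. indicator {0<..<l} x *\<^sub>R \<psi>' x = indicator {0..l} x *\<^sub>R \<psi>' x"
      using AE_lborel_singleton[of 0] AE_lborel_singleton[of l]
      by eventually_elim (auto simp: indicator_def)
  qed (use borel_measurable_continuous_onI[OF a(2)] in auto)
  also have "\<dots> = \<psi> l - \<psi> 0"
    unfolding set_lebesgue_integral_def
    by (rule integral_FTC_Icc)
      (use l a continuous_on_subset[OF a(2)] in \<open>auto intro: has_vector_derivative_at_within\<close>)
  finally have I: "(LBINT x:{0<..<l}. \<psi>' x) = \<psi> l - \<psi> 0" .
  have "L2_pair l (f + c *\<^sub>C cs l 0) \<psi>' = (LBINT x:{0<..<l}. (W x + ?c) * \<psi>' x)"
    by (rule L2_pair_AE_cong[OF ae W_meas(2) a(2)])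
  also have "\<dots> = (LBINT x:{0<..<l}. W x * \<psi>' x + ?c * \<psi>' x)"
    by (simp add: distrib_right)
  also have "\<dots> = (LBINT x:{0<..<l}. W x * \<psi>' x) + ?c * (LBINT x:{0<..<l}. \<psi>' x)"
    by (subst set_integral_add(2)) (auto intro!: si continuous_intros H1_repD[OF W] a(2))
  also have "(LBINT x:{0<..<l}. W x * \<psi>' x) = L2_pair l f \<psi>'"
    by (rule L2_pair_AE_cong[OF H1_repD(4)[OF W] W_meas(1) a(2), symmetric])
  finally show "L2_pair l (f + c *\<^sub>C cs l 0) \<psi>' + L2_pair l g \<psi>
      = (W l + ?c) * \<psi> l - (W 0 + ?c) * \<psi> 0"
    using H1_repD(5)[OF W, of \<psi> \<psi>'] a by (simp add: I algebra_simps)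
qed


lemma cos_deriv: "((\<lambda>x. complex_of_real (cos (c * x))) has_vector_derivative
    - complex_of_real c * complex_of_real (sin (c * x))) (at x)" for c :: real
proof -
  have "((\<lambda>x. cos (c * x)) has_real_derivative - c * sin (c * x)) (at x)"
    by (auto intro!: derivative_eq_intros)
  then show ?thesis
    unfolding of_real_mult[symmetric] of_real_minus[symmetric]
    by (intro has_vector_derivative_of_real) (simp add: has_real_derivative_iff_has_vector_derivative)
qed

lemma H1_rep_sn:
  assumes l: "l > 0" and W: "H1_rep l f g W"
  shows "cinner g (sn l n) = - complex_of_real (freq l n) * cinner f (cs l n)"
  by (rule weak_deriv_sn[OF l H1_rep_has_weak_deriv[OF W]])

text \<open>A cosine does not vanish at the ends, so both boundary values of \<open>W\<close>
  survive; once they are 0, cosine coefficients of \<open>g\<close> and sine coefficients of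
  \<open>f\<close> determine each other at positive frequencies.\<close>

lemma H1_rep_cos:
  assumes l: "l > 0" and W: "H1_rep l f g W"
  shows "L2_pair l g (\<lambda>x. complex_of_real (cos (freq l n * x)))
     = W l * (- 1) ^ n - W 0 + complex_of_real (freq l n) * L2_pair l f (\<lambda>x. complex_of_real (sin (freq l n * x)))"
proof -
  have eq: "L2_pair l f (\<lambda>x. - complex_of_real (freq l n) * complex_of_real (sin (freq l n * x)))
      + L2_pair l g (\<lambda>x. complex_of_real (cos (freq l n * x)))
      = W l * complex_of_real (cos (freq l n * l)) - W 0 * complex_of_real (cos (freq l n * 0))"
    by (rule H1_repD(5)[OF W]) (rule cos_deriv, intro continuous_intros)
  have "complex_of_real (cos (freq l n * l)) = (- 1) ^ n"
    using l by simp
  from eq[unfolded L2_pair_cmult_right this] show ?thesis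
    by (simp add: algebra_simps)
qed

lemma H1_rep_cs:
  assumes l: "l > 0" and W: "H1_rep l f g W" and "W 0 = 0" "W l = 0"
  shows "cinner g (cs l n) = complex_of_real (freq l n) * cinner f (sn l n)"
  using H1_rep_cos[OF l W, of n] assms by (simp add: cinner_cs cinner_sn)

text \<open>At positive frequencies the relation can be divided by the frequency, so
  \<open>f\<close> and the primitive of \<open>g\<close> have the same cosine coefficients there.
  They differ by a constant, which the zeroth coefficient supplies.\<close>

lemma sn_coeffs_imp_H1_rep:
  assumes l: "l > 0" and f: "f \<in> L2_on l" and g: "g \<in> L2_on l"
    and coeff: "\<And>n. cinner g (sn l n) = - complex_of_real (freq l n) * cinner f (cs l n)"
  obtains W where "H1_rep l f g W"
proof -
  obtain \<gamma> where \<gamma>: "H1_rep l \<gamma> g (primitive l g)"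
    using H1_rep_primitive[OF l g] by blast
  have "f = \<gamma> + cinner (f - \<gamma>) (cs l 0) *\<^sub>C cs l 0"
  proof (rule L2_onb_eqI[OF onb_cs[OF l] f])
    show "\<gamma> + cinner (f - \<gamma>) (cs l 0) *\<^sub>C cs l 0 \<in> L2_on l"
      by (intro L2_on_add L2_on_scaleC cs_mem H1_repD[OF \<gamma>])
    fix n
    show "cinner f (cs l n) = cinner (\<gamma> + cinner (f - \<gamma>) (cs l 0) *\<^sub>C cs l 0) (cs l n)"
    proof (cases "n = 0")
      case False
      then show ?thesis
        using coeff[of n] H1_rep_sn[OF l \<gamma>, of n] freq_pos[OF l, of n]
        by (simp add: cinner_simps cinner_cs_cs[OF l])
    qed (simp add: cinner_simps cinner_cs_cs[OF l])
  qed
  then show ?thesis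
    using H1_rep_add_const[OF l \<gamma>, of "cinner (f - \<gamma>) (cs l 0)"] that by metis
qed

text \<open>Sufficiency holds because \<open>f\<close> can be recovered as a primitive of
  \<open>g\<close> plus a constant. Linearity and closedness of weak differentiation can now be read
  off coefficients.\<close>

lemma has_weak_deriv_iff:
  assumes l: "l > 0"
  shows "has_weak_deriv l f g \<longleftrightarrow> f \<in> L2_on l \<and> g \<in> L2_on l \<and>
     (\<forall>n. cinner g (sn l n) = - complex_of_real (freq l n) * cinner f (cs l n))"
  using weak_deriv_sn[OF l] sn_coeffs_imp_H1_rep[OF l] H1_rep_has_weak_deriv has_weak_derivD
  by metis

lemma H1_rep_ex: "l > 0 \<Longrightarrow> has_weak_deriv l f g \<Longrightarrow> \<exists>W. H1_rep l f g W"
  using weak_deriv_sn sn_coeffs_imp_H1_rep has_weak_derivD by metis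

text \<open>The set of agreement is closed and of full measure in (0,l), hence it contains the
  closure of (0,l).\<close>

lemma AE_eq_imp_eq_Icc:
  fixes F G :: "real \<Rightarrow> complex"
  assumes l: "l > 0" and F: "continuous_on {0..l} F" and G: "continuous_on {0..l} G"
    and ae: "AE x in lborel. x \<in> {0<..<l} \<longrightarrow> F x = G x" and x: "x \<in> {0..l}"
  shows "F x = G x"
proof -
  define C where "C = {x \<in> {0..l}. F x - G x = 0}"
  have C: "closed C"
    unfolding C_def by (intro continuous_closed_preimage_constant continuous_intros F G)
  have "AE x\<in>{0<..<l} in lebesgue. x \<in> C"
  proof (rule AE_completion)
    show "AE x\<in>{0<..<l} in lborel. x \<in> C"
      using ae by eventually_elim (auto simp: C_def)
  qed
  then have "{0<..<l} \<subseteq> C"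
    using mem_closed_if_AE_lebesgue_open[OF open_greaterThanLessThan C] by blast
  then have "closure {0<..<l} \<subseteq> C"
    using C by (rule closure_minimal)
  then show ?thesis
    using x l by (auto simp: C_def closure_greaterThanLessThan)
qed

lemma value_at_H1_rep:
  assumes l: "l > 0" and W: "H1_rep l f g W" and x: "x \<in> {0..l}"
  shows "value_at l f x = W x"
  unfolding value_at_def
proof (rule the_equality)
  show "\<exists>F. continuous_on {0..l} F \<and> (AE t in lborel. t \<in> {0<..<l} \<longrightarrow> rep_L2 f t = F t) \<and> W x = F x"
    using H1_repD(3,4)[OF W] continuous_on_subset by blast
next
  fix c assume "\<exists>F. continuous_on {0..l} F \<and> (AE t in lborel. t \<in> {0<..<l} \<longrightarrow> rep_L2 f t = F t) \<and> c = F x"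
  then obtain F where F: "continuous_on {0..l} F" "AE t in lborel. t \<in> {0<..<l} \<longrightarrow> rep_L2 f t = F t" "c = F x"
    by blast
  have "AE t in lborel. t \<in> {0<..<l} \<longrightarrow> F t = W t"
    using F(2) H1_repD(4)[OF W] by eventually_elim simp
  then show "c = W x"
    using AE_eq_imp_eq_Icc[OF l F(1) _ _ x] H1_repD(3)[OF W] F(3) continuous_on_subset by blast
qed

text \<open>With zero boundary values the cosine relation has no boundary terms. Conversely, the
  relation at n = 0 says that \<open>g\<close> has integral zero, so its primitive vanishes at both
  ends, and the sine coefficients identify this primitive with \<open>f\<close>.\<close>

lemma H1_0_iff:
  assumes l: "l > 0"
  shows "f \<in> H1_0 l \<and> weak_deriv l f = g \<longleftrightarrow> f \<in> L2_on l \<and> g \<in> L2_on l \<and>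
     (\<forall>n. cinner g (cs l n) = complex_of_real (freq l n) * cinner f (sn l n))"
proof
  assume a: "f \<in> H1_0 l \<and> weak_deriv l f = g"
  then have w: "has_weak_deriv l f g"
    using H1_weak_deriv[OF l, of f] by (auto simp: H1_0_def)
  then obtain W where W: "H1_rep l f g W"
    using H1_rep_ex[OF l] by blast
  have "W 0 = 0" "W l = 0"
    using a value_at_H1_rep[OF l W] l by (auto simp: H1_0_def)
  then show "f \<in> L2_on l \<and> g \<in> L2_on l \<and>
     (\<forall>n. cinner g (cs l n) = complex_of_real (freq l n) * cinner f (sn l n))"
    using H1_rep_cs[OF l W] has_weak_derivD[OF w] by blast
next
  assume a: "f \<in> L2_on l \<and> g \<in> L2_on l \<and>
     (\<forall>n. cinner g (cs l n) = complex_of_real (freq l n) * cinner f (sn l n))"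
  then obtain \<gamma> where \<gamma>: "H1_rep l \<gamma> g (primitive l g)"
    using H1_rep_primitive[OF l] by blast
  have "cinner g (cs l 0) = 0"
    using a by simp
  then have "primitive l g l = 0"
    using l by (simp add: primitive_l cinner_cs)
  note b = primitive_0[of l g] this
  have "f = \<gamma>"
  proof (rule L2_onb_eqI[OF onb_sn[OF l]])
    show "cinner f (sn l (Suc n)) = cinner \<gamma> (sn l (Suc n))" for n
      using a H1_rep_cs[OF l \<gamma> b, of "Suc n"] freq_pos[OF l, of "Suc n"] by auto
  qed (use a H1_repD[OF \<gamma>] in auto)
  with \<gamma> have W: "H1_rep l f g (primitive l g)"
    by simp
  then show "f \<in> H1_0 l \<and> weak_deriv l f = g"
    using value_at_H1_rep[OF l W, of 0] value_at_H1_rep[OF l W, of l] b l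
      weak_deriv_eqI[OF l H1_rep_has_weak_deriv[OF W]] H1_rep_has_weak_deriv[OF W]
    by (auto simp: H1_0_def H1_def)
qed

section \<open>Sobolev spaces, operators and fractional powers\<close>

lemma has_weak_deriv_0: "l > 0 \<Longrightarrow> has_weak_deriv l 0 0"
  by (simp add: has_weak_deriv_iff L2_on_0 cinner_simps)

lemma has_weak_deriv_add:
  "l > 0 \<Longrightarrow> has_weak_deriv l f f' \<Longrightarrow> has_weak_deriv l g g' \<Longrightarrow> has_weak_deriv l (f + g) (f' + g')"
  by (simp add: has_weak_deriv_iff L2_on_add cinner_simps algebra_simps)

lemma has_weak_deriv_scaleC:
  "l > 0 \<Longrightarrow> has_weak_deriv l f f' \<Longrightarrow> has_weak_deriv l (c *\<^sub>C f) (c *\<^sub>C f')"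
  by (simp add: has_weak_deriv_iff L2_on_scaleC)

lemma H1_0I: "l > 0 \<Longrightarrow> f \<in> L2_on l \<Longrightarrow> g \<in> L2_on l \<Longrightarrow>
    (\<And>n. cinner g (cs l n) = complex_of_real (freq l n) * cinner f (sn l n)) \<Longrightarrow>
    f \<in> H1_0 l \<and> weak_deriv l f = g"
  by (simp add: H1_0_iff)

lemma H1_0D:
  assumes "l > 0" "f \<in> H1_0 l"
  shows "f \<in> H1 l" "f \<in> L2_on l" "weak_deriv l f \<in> L2_on l"
    "cinner (weak_deriv l f) (cs l n) = complex_of_real (freq l n) * cinner f (sn l n)"
  using H1_0_iff[OF assms(1), of f "weak_deriv l f"] assms(2) by (auto simp: H1_0_def)

lemma H1D:
  assumes "l > 0" "f \<in> H1 l"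
  shows "f \<in> L2_on l" "weak_deriv l f \<in> L2_on l"
    "cinner (weak_deriv l f) (sn l n) = - complex_of_real (freq l n) * cinner f (cs l n)"
  using has_weak_deriv_iff[OF assms(1)] H1_weak_deriv[OF assms] by auto

lemma H1_I: "l > 0 \<Longrightarrow> f \<in> L2_on l \<Longrightarrow> g \<in> L2_on l \<Longrightarrow>
    (\<And>n. cinner g (sn l n) = - complex_of_real (freq l n) * cinner f (cs l n)) \<Longrightarrow>
    f \<in> H1 l \<and> weak_deriv l f = g"
  using has_weak_deriv_iff[of l f g] weak_deriv_eqI[of l f g] by (auto simp: H1_def)

lemma H1_0:
  assumes l: "l > 0"
  shows "0 \<in> H1 l" "weak_deriv l 0 = 0"
  using has_weak_deriv_0[OF l] weak_deriv_eqI[OF l] by (auto simp: H1_def)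

lemma H1_add:
  assumes l: "l > 0" and "f \<in> H1 l" "g \<in> H1 l"
  shows "f + g \<in> H1 l" "weak_deriv l (f + g) = weak_deriv l f + weak_deriv l g"
  using has_weak_deriv_add[OF l H1_weak_deriv[OF l assms(2)] H1_weak_deriv[OF l assms(3)]]
    weak_deriv_eqI[OF l] by (auto simp: H1_def)

lemma H1_scaleC:
  assumes l: "l > 0" and "f \<in> H1 l"
  shows "c *\<^sub>C f \<in> H1 l" "weak_deriv l (c *\<^sub>C f) = c *\<^sub>C weak_deriv l f"
  using has_weak_deriv_scaleC[OF l H1_weak_deriv[OF l assms(2)]]
    weak_deriv_eqI[OF l] by (auto simp: H1_def)

lemma H1_scaleR:
  assumes "l > 0" and "f \<in> H1 l"
  shows "r *\<^sub>R f \<in> H1 l" "weak_deriv l (r *\<^sub>R f) = r *\<^sub>R weak_deriv l f"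
  unfolding scaleR_scaleC using H1_scaleC[OF assms] by auto


lemma H1_0_zero: "l > 0 \<Longrightarrow> 0 \<in> H1_0 l"
  using H1_0I[of l 0 0] by (simp add: L2_on_0 cinner_simps)

lemma H1_0_add: "l > 0 \<Longrightarrow> f \<in> H1_0 l \<Longrightarrow> g \<in> H1_0 l \<Longrightarrow> f + g \<in> H1_0 l"
  using H1_0I[of l "f + g" "weak_deriv l f + weak_deriv l g"] H1_0D[of l f] H1_0D[of l g]
  by (simp add: L2_on_add cinner_simps algebra_simps)

lemma H1_0_scaleC: "l > 0 \<Longrightarrow> f \<in> H1_0 l \<Longrightarrow> c *\<^sub>C f \<in> H1_0 l"
  using H1_0I[of l "c *\<^sub>C f" "c *\<^sub>C weak_deriv l f"] H1_0D[of l f]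
  by (simp add: L2_on_scaleC)

lemma L2_star_props:
  assumes "l > 0"
  shows "0 \<in> L2_star l" "f \<in> L2_star l \<Longrightarrow> g \<in> L2_star l \<Longrightarrow> f + g \<in> L2_star l"
    "f \<in> L2_star l \<Longrightarrow> c *\<^sub>C f \<in> L2_star l" "f \<in> L2_star l \<Longrightarrow> f \<in> L2_on l"
  using L2_onbD(2-4)[OF onb_cs_star[OF assms]] by (auto simp: L2_star_def)

lemma H1_star_D:
  assumes "l > 0" "f \<in> H1_star l"
  shows "f \<in> H1 l" "f \<in> L2_star l" "f \<in> L2_on l"
  using assms by (auto simp: H1_star_def L2_star_def)

lemma H1_star_zero: "l > 0 \<Longrightarrow> 0 \<in> H1_star l"
  by (simp add: H1_star_def H1_0 L2_star_props)

lemma H1_star_add: "l > 0 \<Longrightarrow> f \<in> H1_star l \<Longrightarrow> g \<in> H1_star l \<Longrightarrow> f + g \<in> H1_star l"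
  by (auto simp: H1_star_def H1_add L2_star_props)

lemma H1_star_scaleC: "l > 0 \<Longrightarrow> f \<in> H1_star l \<Longrightarrow> c *\<^sub>C f \<in> H1_star l"
  by (auto simp: H1_star_def H1_scaleC L2_star_props)

lemma H1_0_scaleR: "l > 0 \<Longrightarrow> f \<in> H1_0 l \<Longrightarrow> r *\<^sub>R f \<in> H1_0 l"
  and H1_star_scaleR: "l > 0 \<Longrightarrow> g \<in> H1_star l \<Longrightarrow> r *\<^sub>R g \<in> H1_star l"
  unfolding scaleR_scaleC by (simp_all add: H1_0_scaleC H1_star_scaleC)

text \<open>Parseval in the sine basis on the left and in the cosine basis on the right gives the
  same series up to sign; the zero boundary values of \<open>p\<close> provide the cosine
  coefficients of its derivative.\<close>

lemma inner_weak_deriv: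
  assumes l: "l > 0" and w: "w \<in> H1 l" and p: "p \<in> H1_0 l"
  shows "inner (weak_deriv l w) p = - inner w (weak_deriv l p)"
proof -
  define h where "h n = Re (cinner w (cs l n) * cnj (cinner (weak_deriv l p) (cs l n)))" for n
  have h: "h n = freq l n * Re (cinner w (cs l n) * cnj (cinner p (sn l n)))" for n
    by (simp add: h_def H1_0D[OF l p] algebra_simps)
  have "(\<lambda>n. Re (cinner (weak_deriv l w) (sn l (Suc n)) * cnj (cinner p (sn l (Suc n)))))
      sums inner (weak_deriv l w) p"
    by (rule parseval_inner[OF onb_sn[OF l]]) (rule H1D[OF l w])
  moreover have "Re (cinner (weak_deriv l w) (sn l (Suc n)) * cnj (cinner p (sn l (Suc n)))) = - h (Suc n)" for n
    unfolding h H1D(3)[OF l w] by (simp add: algebra_simps)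
  ultimately have "(\<lambda>n. - h (Suc n)) sums inner (weak_deriv l w) p"
    by simp
  then have "(\<lambda>n. h (Suc n)) sums (- inner (weak_deriv l w) p)"
    using sums_minus by fastforce
  \<comment> \<open>The sine series starts at frequency 1 and the cosine series at 0; the additional
    term vanishes because \<open>freq l 0\<close> is 0.\<close>
  then have "h sums (- inner (weak_deriv l w) p)"
    by (rule sums_Suc_imp[rotated]) (simp add: h)
  moreover have "h sums inner w (weak_deriv l p)"
    unfolding h_def by (rule parseval_inner[OF onb_cs[OF l]]) (rule H1D[OF l w])
  ultimately show ?thesis
    using sums_unique2 by fastforce
qed

text \<open>Mode by mode, differentiation multiplies the modulus of a coefficient by
  \<open>freq l n\<close>, which is at least \<open>freq l 1\<close> for n >= 1.\<close>

lemma poincare_H1_0: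
  assumes l: "l > 0" and p: "p \<in> H1_0 l"
  shows "freq l 1 * norm p \<le> norm (weak_deriv l p)"
proof -
  have "(\<lambda>n. (freq l 1)\<^sup>2 * (cmod (cinner p (sn l (Suc n))))\<^sup>2) sums ((freq l 1)\<^sup>2 * (norm p)\<^sup>2)"
    by (intro sums_mult parseval_norm[OF onb_sn[OF l]] H1_0D[OF l p])
  moreover have "(\<lambda>n. (cmod (cinner (weak_deriv l p) (cs l n)))\<^sup>2) sums (norm (weak_deriv l p))\<^sup>2"
    by (rule parseval_norm[OF onb_cs[OF l]]) (rule H1_0D[OF l p])
  then have "(\<lambda>n. (cmod (cinner (weak_deriv l p) (cs l (Suc n))))\<^sup>2) sums (norm (weak_deriv l p))\<^sup>2"
    by (subst sums_Suc_iff) (simp add: H1_0D[OF l p])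
  moreover have "(freq l 1)\<^sup>2 * (cmod (cinner p (sn l (Suc n))))\<^sup>2
      \<le> (cmod (cinner (weak_deriv l p) (cs l (Suc n))))\<^sup>2" for n
    using freq_mono[OF l, of 1 "Suc n"] freq_pos[OF l, of 1]
    by (simp add: H1_0D[OF l p] norm_mult power_mult_distrib mult_right_mono power_mono)
  ultimately have "(freq l 1)\<^sup>2 * (norm p)\<^sup>2 \<le> (norm (weak_deriv l p))\<^sup>2"
    by (rule sums_le[rotated])
  then have "(freq l 1 * norm p)\<^sup>2 \<le> (norm (weak_deriv l p))\<^sup>2"
    by (simp add: power_mult_distrib)
  then show ?thesis
    by (rule power2_le_imp_le) simp
qed

lemma H1_deriv_inner_sums:
  assumes l: "l > 0" and v: "v \<in> H1 l" "w \<in> H1 l"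
  shows "(\<lambda>n. (freq l (Suc n))\<^sup>2 * Re (cinner v (cs l (Suc n)) * cnj (cinner w (cs l (Suc n)))))
     sums inner (weak_deriv l v) (weak_deriv l w)"
proof -
  have "(\<lambda>n. Re (cinner (weak_deriv l v) (sn l (Suc n)) * cnj (cinner (weak_deriv l w) (sn l (Suc n)))))
      sums inner (weak_deriv l v) (weak_deriv l w)"
    by (rule parseval_inner[OF onb_sn[OF l]]) (rule H1D[OF l v(1)])
  moreover have "Re (cinner (weak_deriv l v) (sn l (Suc n)) * cnj (cinner (weak_deriv l w) (sn l (Suc n))))
      = (freq l (Suc n))\<^sup>2 * Re (cinner v (cs l (Suc n)) * cnj (cinner w (cs l (Suc n))))" for n
    unfolding H1D(3)[OF l v(1)] H1D(3)[OF l v(2)] by (simp add: power2_eq_square algebra_simps)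
  ultimately show ?thesis
    by (simp only:)
qed

lemma H1_deriv_norm_sums:
  assumes l: "l > 0" and v: "v \<in> H1 l"
  shows "(\<lambda>n. (freq l (Suc n))\<^sup>2 * (cmod (cinner v (cs l (Suc n))))\<^sup>2) sums (norm (weak_deriv l v))\<^sup>2"
  using H1_deriv_inner_sums[OF l v v]
  by (simp only: power2_norm_eq_inner Re_complex_of_real flip: complex_norm_square)

text \<open>Zero mean removes the constant mode, the only one that differentiation
  annihilates.\<close>

lemma poincare_H1_star:
  assumes l: "l > 0" and v: "v \<in> H1_star l"
  shows "freq l 1 * norm v \<le> norm (weak_deriv l v)"
proof -
  have "(\<lambda>n. (freq l 1)\<^sup>2 * (cmod (cinner v (cs l (Suc n))))\<^sup>2) sums ((freq l 1)\<^sup>2 * (norm v)\<^sup>2)"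
    by (intro sums_mult parseval_norm[OF onb_cs_star[OF l]] H1_star_D[OF l v])
  moreover have "(\<lambda>n. (freq l (Suc n))\<^sup>2 * (cmod (cinner v (cs l (Suc n))))\<^sup>2) sums (norm (weak_deriv l v))\<^sup>2"
    by (rule H1_deriv_norm_sums[OF l]) (rule H1_star_D[OF l v])
  moreover have "(freq l 1)\<^sup>2 * (cmod (cinner v (cs l (Suc n))))\<^sup>2
      \<le> (freq l (Suc n))\<^sup>2 * (cmod (cinner v (cs l (Suc n))))\<^sup>2" for n
    using freq_mono[OF l, of 1 "Suc n"] freq_pos[OF l, of 1]
    by (simp add: mult_right_mono power_mono)
  ultimately have "(freq l 1)\<^sup>2 * (norm v)\<^sup>2 \<le> (norm (weak_deriv l v))\<^sup>2"
    by (rule sums_le[rotated])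
  then have "(freq l 1 * norm v)\<^sup>2 \<le> (norm (weak_deriv l v))\<^sup>2"
    by (simp add: power_mult_distrib)
  then show ?thesis
    by (rule power2_le_imp_le) simp
qed

section \<open>Trigonometric eigenfunctions of the two operators\<close>

lemma sn_0: "sn l 0 = 0"
proof -
  have "L2_fun l (\<lambda>x. 0 * (0::real)) = 0 *\<^sub>R L2_fun l (\<lambda>x. 0)"
    by (rule L2_fun_cmult) simp
  then show ?thesis
    by (simp add: sn_def)
qed

lemma cinner_sn_sn': "l > 0 \<Longrightarrow> cinner (sn l i) (sn l j) = (if i = j \<and> i > 0 then 1 else 0)"
  by (cases "i = 0") (auto simp: sn_0 cinner_simps cinner_sn_sn)

lemma cs_weak_deriv:
  assumes l: "l > 0"
  shows "cs l n \<in> H1 l" "weak_deriv l (cs l n) = (- freq l n) *\<^sub>R sn l n"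
  using H1_I[OF l cs_mem[of l n] L2_on_scaleR[OF sn_mem[of l n], of "- freq l n"]]
  by (auto simp: cinner_simps cinner_sn_sn'[OF l] cinner_cs_cs[OF l])

lemma sn_weak_deriv:
  assumes l: "l > 0"
  shows "sn l n \<in> H1_0 l" "weak_deriv l (sn l n) = freq l n *\<^sub>R cs l n"
  using H1_0I[OF l sn_mem[of l n] L2_on_scaleR[OF cs_mem[of l n], of "freq l n"]]
  by (auto simp: cinner_simps cinner_sn_sn'[OF l] cinner_cs_cs[OF l])

text \<open>Neumann conditions are Dirichlet conditions for the derivative, so the coefficient
  description of \<open>H1_0\<close> covers them.\<close>

lemma domA_star_iff: "q \<in> domA_star l \<longleftrightarrow> q \<in> H1_star l \<and> weak_deriv l q \<in> H1_0 l"
  by (auto simp: domA_star_def H2_def H1_star_def H1_0_def)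

lemma domA_iff: "p \<in> domA l \<longleftrightarrow> p \<in> H1_0 l \<and> weak_deriv l p \<in> H1 l"
  by (auto simp: domA_def H2_def H1_0_def)

lemma cs_domA_star:
  assumes l: "l > 0" and n: "n > 0"
  shows "cs l n \<in> domA_star l" "opA_star l (cs l n) = (freq l n)\<^sup>2 *\<^sub>R cs l n"
proof -
  show "cs l n \<in> domA_star l"
    unfolding domA_star_iff H1_star_def cs_weak_deriv(2)[OF l]
    using n H1_0_scaleR[OF l sn_weak_deriv(1)[OF l], of "- freq l n" n]
    by (simp add: cs_weak_deriv(1)[OF l] L2_star_iff[OF l] cs_mem cinner_cs_cs[OF l])
  show "opA_star l (cs l n) = (freq l n)\<^sup>2 *\<^sub>R cs l n"
    using H1_scaleR(2)[OF l H1_0D(1)[OF l sn_weak_deriv(1)[OF l]], of "- freq l n" n]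
    by (simp add: opA_star_def cs_weak_deriv[OF l] sn_weak_deriv[OF l] power2_eq_square)
qed

lemma sn_domA: "l > 0 \<Longrightarrow> sn l n \<in> domA l"
  by (simp add: domA_iff sn_weak_deriv H1_scaleR cs_weak_deriv)

lemma inner_opA:
  assumes l: "l > 0" and p: "p \<in> domA l" and q: "q \<in> H1_0 l"
  shows "inner (opA l p) q = inner (weak_deriv l p) (weak_deriv l q)"
  using inner_weak_deriv[OF l _ q, of "weak_deriv l p"] p by (simp add: opA_def domA_iff)

text \<open>The boundary terms vanish by the Neumann condition on \<open>p\<close>, whereas in
  \<open>inner_opA\<close> it is the test function that vanishes at the ends.\<close>

lemma inner_opA_star:
  assumes l: "l > 0" and p: "p \<in> domA_star l" and q: "q \<in> H1_star l"
  shows "inner (opA_star l p) q = inner (weak_deriv l p) (weak_deriv l q)"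
  using inner_weak_deriv[OF l H1_star_D(1)[OF l q], of "weak_deriv l p"] p
  by (simp add: opA_star_def domA_star_iff inner_commute)

lemma eigenbasis_cs:
  assumes l: "l > 0"
  shows "eigenbasis (L2_star l) (domA_star l) (opA_star l) (\<lambda>n. cs l (Suc n)) (\<lambda>n. (freq l (Suc n))\<^sup>2)"
  unfolding eigenbasis_def
  using cs_domA_star[OF l] L2_onbD(5-7)[OF onb_cs_star[OF l]] freq_pos[OF l] by (simp add: less_imp_neq[symmetric])

text \<open>The eigenvalues of \<open>A\<^sub>*\<close> are simple, so every eigenbasis consists of multiples of cosines.\<close>

lemma eigenbasis_cs_multiple:
  assumes l: "l > 0" and E: "eigenbasis (L2_star l) (domA_star l) (opA_star l) e \<mu>"
  obtains i a where "a \<noteq> 0" "e i = a *\<^sub>C cs l (Suc n)" "\<mu> i = (freq l (Suc n))\<^sup>2"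
proof -
  have cn: "cs l (Suc n) \<in> L2_star l" "cs l (Suc n) \<noteq> 0"
    using L2_onbD(5)[OF onb_cs_star[OF l]] cinner_cs_cs[OF l, of "Suc n" "Suc n"]
    by (auto simp: cinner_simps)
  then obtain i where "cinner (cs l (Suc n)) (e i) \<noteq> 0"
    using E unfolding eigenbasis_def by blast
  then have i: "cinner (e i) (cs l (Suc n)) \<noteq> 0"
    by (subst cinner_commute) simp
  have ei: "e i \<in> L2_star l" "e i \<in> domA_star l" "opA_star l (e i) = \<mu> i *\<^sub>R e i"
    using E unfolding eigenbasis_def by auto
  \<comment> \<open>Comparison of the k-th cosine coefficients in the eigenvalue equation: a nonzero
    coefficient forces the eigenvalue to be the square of \<open>freq l k\<close>.\<close>
  have *: "complex_of_real (\<mu> i) * cinner (e i) (cs l k) = complex_of_real ((freq l k)\<^sup>2) * cinner (e i) (cs l k)" for k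
  proof -
    have d: "e i \<in> H1 l" "weak_deriv l (e i) \<in> H1_0 l"
      using ei(2) H1_star_D(1)[OF l] by (auto simp: domA_star_iff)
    have "complex_of_real (\<mu> i) * cinner (e i) (cs l k) = cinner (opA_star l (e i)) (cs l k)"
      by (simp add: ei(3) cinner_simps)
    also have "\<dots> = complex_of_real ((freq l k)\<^sup>2) * cinner (e i) (cs l k)"
      by (simp add: opA_star_def cinner_simps H1_0D(4)[OF l d(2)] H1D(3)[OF l d(1)] power2_eq_square)
    finally show ?thesis .
  qed
  have \<mu>: "\<mu> i = (freq l (Suc n))\<^sup>2"
    using *[of "Suc n"] i by (simp del: of_real_power)
  define a where "a = cinner (e i) (cs l (Suc n))"
  have "e i = a *\<^sub>C cs l (Suc n)"
  proof (rule L2_onb_eqI[OF onb_cs_star[OF l] ei(1)])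
    show "a *\<^sub>C cs l (Suc n) \<in> L2_star l"
      using cn L2_star_props[OF l] by auto
    fix k
    show "cinner (e i) (cs l (Suc k)) = cinner (a *\<^sub>C cs l (Suc n)) (cs l (Suc k))"
    proof (cases "k = n")
      case False
      then have "freq l (Suc n) \<noteq> freq l (Suc k)"
        using freq_eq_iff[OF l] by simp
      then have "(freq l (Suc n))\<^sup>2 \<noteq> (freq l (Suc k))\<^sup>2"
        using freq_pos[OF l, of "Suc n"] freq_pos[OF l, of "Suc k"] by (simp add: power2_eq_iff)
      then have "cinner (e i) (cs l (Suc k)) = 0"
        using *[of "Suc k"] unfolding \<mu> by (simp del: of_real_power)
      then show ?thesis
        using False by (simp add: cinner_cs_cs[OF l])
    qed (simp add: cinner_cs_cs[OF l] a_def)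
  qed
  then show ?thesis
    using that i \<mu> by (auto simp: a_def)
qed

text \<open>Every cosine of positive frequency is a multiple of a member of any given eigenbasis,
  with the same eigenvalue, and the factor cancels from the relation; hence the cosines may replace
  the eigenbasis.\<close>

lemma has_frac_pow_star_iff:
  assumes l: "l > 0"
  shows "has_frac_pow (L2_star l) (domA_star l) (opA_star l) \<sigma> f g \<longleftrightarrow>
     f \<in> L2_star l \<and> g \<in> L2_star l \<and>
     (\<forall>n. cinner g (cs l (Suc n)) = complex_of_real (((freq l (Suc n))\<^sup>2) powr \<sigma>) * cinner f (cs l (Suc n)))"
proof
  assume "has_frac_pow (L2_star l) (domA_star l) (opA_star l) \<sigma> f g"
  then obtain e \<mu> where fg: "f \<in> L2_star l" "g \<in> L2_star l"
    and E: "eigenbasis (L2_star l) (domA_star l) (opA_star l) e \<mu>"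
    and co: "\<And>n. cinner g (e n) = complex_of_real (\<mu> n powr \<sigma>) * cinner f (e n)"
    unfolding has_frac_pow_def by blast
  have "cinner g (cs l (Suc n)) = complex_of_real (((freq l (Suc n))\<^sup>2) powr \<sigma>) * cinner f (cs l (Suc n))" for n
  proof -
    obtain i a where "a \<noteq> 0" "e i = a *\<^sub>C cs l (Suc n)" "\<mu> i = (freq l (Suc n))\<^sup>2"
      using eigenbasis_cs_multiple[OF l E] by blast
    then show ?thesis
      using co[of i] by simp
  qed
  with fg show "f \<in> L2_star l \<and> g \<in> L2_star l \<and>
     (\<forall>n. cinner g (cs l (Suc n)) = complex_of_real (((freq l (Suc n))\<^sup>2) powr \<sigma>) * cinner f (cs l (Suc n)))"
    by blast
next
  assume "f \<in> L2_star l \<and> g \<in> L2_star l \<and>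
     (\<forall>n. cinner g (cs l (Suc n)) = complex_of_real (((freq l (Suc n))\<^sup>2) powr \<sigma>) * cinner f (cs l (Suc n)))"
  then show "has_frac_pow (L2_star l) (domA_star l) (opA_star l) \<sigma> f g"
    unfolding has_frac_pow_def using eigenbasis_cs[OF l] by blast
qed

section \<open>Fractional powers of the Neumann operator\<close>

lemma A_star_pow_eqI:
  assumes l: "l > 0" and fg: "f \<in> L2_star l" "g \<in> L2_star l"
    and co: "\<And>n. cinner g (cs l (Suc n)) = complex_of_real (((freq l (Suc n))\<^sup>2) powr \<sigma>) * cinner f (cs l (Suc n))"
  shows "A_star_pow l \<sigma> f = g"
  unfolding A_star_pow_def has_frac_pow_star_iff[OF l]
proof (rule the_equality)
  show "h = g" if "f \<in> L2_star l \<and> h \<in> L2_star l \<and> (\<forall>n. cinner h (cs l (Suc n))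
      = complex_of_real (((freq l (Suc n))\<^sup>2) powr \<sigma>) * cinner f (cs l (Suc n)))" for h
    using that by (intro L2_onb_eqI[OF onb_cs_star[OF l]]) (auto simp: co fg)
qed (use assms in auto)

lemma A_star_pow:
  assumes l: "l > 0" and f: "f \<in> L2_star l"
    and sum: "summable (\<lambda>n. (((freq l (Suc n))\<^sup>2) powr \<sigma>)\<^sup>2 * (cmod (cinner f (cs l (Suc n))))\<^sup>2)"
  shows "A_star_pow l \<sigma> f \<in> L2_star l"
    "cinner (A_star_pow l \<sigma> f) (cs l (Suc n))
       = complex_of_real (((freq l (Suc n))\<^sup>2) powr \<sigma>) * cinner f (cs l (Suc n))"
proof -
  have "summable (\<lambda>n. (cmod (complex_of_real (((freq l (Suc n))\<^sup>2) powr \<sigma>) * cinner f (cs l (Suc n))))\<^sup>2)"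
    using sum by (simp add: norm_mult power_mult_distrib)
  then obtain g where g: "g \<in> L2_star l"
      "\<And>n. cinner g (cs l (Suc n)) = complex_of_real (((freq l (Suc n))\<^sup>2) powr \<sigma>) * cinner f (cs l (Suc n))"
    by (rule riesz_fischer[OF onb_cs_star[OF l]]) blast
  then have "A_star_pow l \<sigma> f = g"
    by (rule A_star_pow_eqI[OF l f])
  with g show "A_star_pow l \<sigma> f \<in> L2_star l"
    "cinner (A_star_pow l \<sigma> f) (cs l (Suc n))
       = complex_of_real (((freq l (Suc n))\<^sup>2) powr \<sigma>) * cinner f (cs l (Suc n))"
    by auto
qed

text \<open>By Parseval both squared norms are the same series, since the weight of the power 1/2 is
  \<open>freq\<close> itself. The energy norm can thus be written with weak derivatives
  only.\<close>

lemma A_star_sqrt_norm: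
  assumes l: "l > 0" and v: "v \<in> H1_star l"
  shows "norm (A_star_pow l (1/2) v) = norm (weak_deriv l v)"
proof -
  have root: "((freq l (Suc n))\<^sup>2) powr (1/2) = freq l (Suc n)" for n
    using freq_pos[OF l, of "Suc n"] by (simp add: powr_half_sqrt)
  note D = H1_deriv_norm_sums[OF l H1_star_D(1)[OF l v]]
  have "summable (\<lambda>n. (((freq l (Suc n))\<^sup>2) powr (1/2))\<^sup>2 * (cmod (cinner v (cs l (Suc n))))\<^sup>2)"
    unfolding root using D by (rule sums_summable)
  note P = A_star_pow[OF l H1_star_D(2)[OF l v] this]
  have "(\<lambda>n. (cmod (cinner (A_star_pow l (1/2) v) (cs l (Suc n))))\<^sup>2) sums (norm (A_star_pow l (1/2) v))\<^sup>2"
    by (rule parseval_norm[OF onb_cs_star[OF l] P(1)])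
  then have "(\<lambda>n. (freq l (Suc n))\<^sup>2 * (cmod (cinner v (cs l (Suc n))))\<^sup>2) sums (norm (A_star_pow l (1/2) v))\<^sup>2"
    unfolding P(2) root by (simp add: norm_mult power_mult_distrib)
  then have "(norm (A_star_pow l (1/2) v))\<^sup>2 = (norm (weak_deriv l v))\<^sup>2"
    using D sums_unique2 by blast
  then show ?thesis
    by simp
qed

lemma powr_freq_antimono:
  assumes l: "l > 0" and "\<sigma> \<le> 0"
  shows "((freq l (Suc n))\<^sup>2) powr \<sigma> \<le> ((freq l 1)\<^sup>2) powr \<sigma>"
  using freq_mono[OF l, of 1 "Suc n"] freq_pos[OF l, of 1] assms
  by (intro powr_mono2' power_mono) auto

text \<open>For nonpositive exponents the weights are bounded by that of the lowest frequency, so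
  the power exists on all of \<open>L2_star\<close>.\<close>

lemma A_star_pow_nonpos:
  assumes l: "l > 0" and f: "f \<in> L2_star l" and \<sigma>: "\<sigma> \<le> 0"
  shows "A_star_pow l \<sigma> f \<in> L2_star l"
    "cinner (A_star_pow l \<sigma> f) (cs l (Suc n))
       = complex_of_real (((freq l (Suc n))\<^sup>2) powr \<sigma>) * cinner f (cs l (Suc n))"
proof -
  have s: "summable (\<lambda>n. ((((freq l 1)\<^sup>2) powr \<sigma>)\<^sup>2) * (cmod (cinner f (cs l (Suc n))))\<^sup>2)"
    by (intro summable_mult bessel_summable[OF onb_cs_star[OF l]])
  have "summable (\<lambda>n. (((freq l (Suc n))\<^sup>2) powr \<sigma>)\<^sup>2 * (cmod (cinner f (cs l (Suc n))))\<^sup>2)"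
    by (rule summable_comparison_test'[OF s, of 0])
      (use powr_freq_antimono[OF l \<sigma>] in \<open>auto intro!: mult_right_mono power_mono\<close>)
  from A_star_pow[OF l f this] show "A_star_pow l \<sigma> f \<in> L2_star l"
    "cinner (A_star_pow l \<sigma> f) (cs l (Suc n))
       = complex_of_real (((freq l (Suc n))\<^sup>2) powr \<sigma>) * cinner f (cs l (Suc n))"
    by auto
qed

text \<open>Let ev_n be the eigenvalues and X_n the squared moduli of the coefficients of
  \<open>x\<close>. The inner product is the sum of ev_n^\<alpha> X_n, the squared norm that of
  ev_n^(\<alpha>-1) ev_n^\<alpha> X_n. Because \<alpha> >= 0 the first weight is smallest at the
  lowest frequency; because \<alpha> <= 1 the extra factor of the second is largest there.\<close>

lemma A_star_pow_damping:
  assumes l: "l > 0" and \<alpha>: "\<alpha> \<in> {0..1}" and x: "x \<in> H1_star l"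
    and w: "A_star_pow l (\<alpha> - 1) x \<in> H1 l"
  shows "((freq l 1)\<^sup>2) powr \<alpha> * (norm x)\<^sup>2 \<le> inner (weak_deriv l (A_star_pow l (\<alpha> - 1) x)) (weak_deriv l x)"
    "(norm (weak_deriv l (A_star_pow l (\<alpha> - 1) x)))\<^sup>2
       \<le> ((freq l 1)\<^sup>2) powr (\<alpha> - 1) * inner (weak_deriv l (A_star_pow l (\<alpha> - 1) x)) (weak_deriv l x)"
proof -
  define w where "w = A_star_pow l (\<alpha> - 1) x"
  define ev where "ev n = (freq l (Suc n))\<^sup>2" for n
  define X where "X n = (cmod (cinner x (cs l (Suc n))))\<^sup>2" for n
  have ev: "ev n > 0" for n
    using freq_pos[OF l, of "Suc n"] by (simp add: ev_def)
  have ev0: "ev 0 \<le> ev n" for n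
    unfolding ev_def using freq_mono[OF l, of 1 "Suc n"] freq_pos[OF l, of 1] by (intro power_mono) auto
  have co: "cinner w (cs l (Suc n)) = complex_of_real (ev n powr (\<alpha> - 1)) * cinner x (cs l (Suc n))" for n
    unfolding w_def ev_def using \<alpha> by (intro A_star_pow_nonpos[OF l H1_star_D(2)[OF l x]]) auto
  have pow: "ev n * ev n powr (\<alpha> - 1) = ev n powr \<alpha>" for n
    using ev[of n] by (simp add: powr_diff)
  have "ev n * Re (cinner w (cs l (Suc n)) * cnj (cinner x (cs l (Suc n)))) = ev n powr \<alpha> * X n" for n
  proof -
    have "cinner w (cs l (Suc n)) * cnj (cinner x (cs l (Suc n))) = complex_of_real (ev n powr (\<alpha> - 1) * X n)"
      unfolding co X_def of_real_mult complex_norm_square by (simp only: mult.assoc)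
    then show ?thesis
      by (simp only: Re_complex_of_real mult.assoc[symmetric] pow)
  qed
  then have S1: "(\<lambda>n. ev n powr \<alpha> * X n) sums inner (weak_deriv l w) (weak_deriv l x)"
    using H1_deriv_inner_sums[OF l assms(4) H1_star_D(1)[OF l x]]
    unfolding w_def[symmetric] ev_def[symmetric] by simp
  have "ev n * (cmod (cinner w (cs l (Suc n))))\<^sup>2 = ev n powr (\<alpha> - 1) * (ev n powr \<alpha> * X n)" for n
    unfolding pow[symmetric] co X_def by (simp add: norm_mult power_mult_distrib power2_eq_square)
  then have S2: "(\<lambda>n. ev n powr (\<alpha> - 1) * (ev n powr \<alpha> * X n)) sums (norm (weak_deriv l w))\<^sup>2"
    using H1_deriv_norm_sums[OF l assms(4)] unfolding w_def[symmetric] ev_def[symmetric] by simp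
  have S3: "(\<lambda>n. ev 0 powr \<alpha> * X n) sums (ev 0 powr \<alpha> * (norm x)\<^sup>2)"
    unfolding X_def by (intro sums_mult parseval_norm[OF onb_cs_star[OF l]] H1_star_D[OF l x])
  have S4: "(\<lambda>n. ev 0 powr (\<alpha> - 1) * (ev n powr \<alpha> * X n)) sums
      (ev 0 powr (\<alpha> - 1) * inner (weak_deriv l w) (weak_deriv l x))"
    by (rule sums_mult[OF S1])
  have "ev 0 powr \<alpha> * X n \<le> ev n powr \<alpha> * X n" for n
    using ev0[of n] ev[of 0] \<alpha> by (intro mult_right_mono powr_mono2) (auto simp: X_def)
  from sums_le[OF this S3 S1]
  show "((freq l 1)\<^sup>2) powr \<alpha> * (norm x)\<^sup>2 \<le> inner (weak_deriv l (A_star_pow l (\<alpha> - 1) x)) (weak_deriv l x)"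
    by (simp add: ev_def w_def)
  have "ev n powr (\<alpha> - 1) * (ev n powr \<alpha> * X n) \<le> ev 0 powr (\<alpha> - 1) * (ev n powr \<alpha> * X n)" for n
    using ev0[of n] ev[of 0] \<alpha> by (intro mult_right_mono powr_mono2') (auto simp: X_def)
  from sums_le[OF this S2 S4]
  show "(norm (weak_deriv l (A_star_pow l (\<alpha> - 1) x)))\<^sup>2
       \<le> ((freq l 1)\<^sup>2) powr (\<alpha> - 1) * inner (weak_deriv l (A_star_pow l (\<alpha> - 1) x)) (weak_deriv l x)"
    by (simp add: ev_def w_def)
qed

text \<open>The coefficient relations survive limits, so the weak derivative is a closed operator on
  \<open>H1_0\<close>; the completeness of the phase space rests on this.\<close>

lemma H1_0_closed:
  assumes l: "l > 0" and X: "\<And>n. X n \<in> H1_0 l" "X \<longlonglongrightarrow> f" "(\<lambda>n. weak_deriv l (X n)) \<longlonglongrightarrow> g"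
  shows "f \<in> H1_0 l \<and> weak_deriv l f = g"
proof (rule H1_0I[OF l])
  show "f \<in> L2_on l"
    by (rule closed_sequentially[OF closed_L2_on _ X(2)]) (rule H1_0D[OF l X(1)])
  show "g \<in> L2_on l"
    by (rule closed_sequentially[OF closed_L2_on _ X(3)]) (rule H1_0D[OF l X(1)])
  fix n
  show "cinner g (cs l n) = complex_of_real (freq l n) * cinner f (sn l n)"
  proof (rule LIMSEQ_unique)
    show "(\<lambda>k. cinner (weak_deriv l (X k)) (cs l n)) \<longlonglongrightarrow> cinner g (cs l n)"
      by (rule tendsto_cinner_left[OF X(3)])
    show "(\<lambda>k. cinner (weak_deriv l (X k)) (cs l n)) \<longlonglongrightarrow> complex_of_real (freq l n) * cinner f (sn l n)"
      unfolding H1_0D(4)[OF l X(1)] by (intro tendsto_intros tendsto_cinner_left X(2))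
  qed
qed

lemma H1_star_closed:
  assumes l: "l > 0" and X: "\<And>n. X n \<in> H1_star l" "X \<longlonglongrightarrow> f" "(\<lambda>n. weak_deriv l (X n)) \<longlonglongrightarrow> g"
  shows "f \<in> H1_star l \<and> weak_deriv l f = g"
proof -
  have Xn: "X n \<in> H1 l" "X n \<in> L2_star l" for n
    using H1_star_D[OF l X(1)[of n]] by auto
  have star: "f \<in> L2_star l"
    by (rule closed_sequentially[OF closed_L2_star[OF l] _ X(2)]) (rule Xn(2))
  have "f \<in> H1 l \<and> weak_deriv l f = g"
  proof (rule H1_I[OF l])
    show "f \<in> L2_on l"
      using star by (simp add: L2_star_def)
    show "g \<in> L2_on l"
      by (rule closed_sequentially[OF closed_L2_on _ X(3)]) (rule H1D[OF l Xn(1)])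
    fix n
    show "cinner g (sn l n) = - complex_of_real (freq l n) * cinner f (cs l n)"
    proof (rule LIMSEQ_unique)
      show "(\<lambda>k. cinner (weak_deriv l (X k)) (sn l n)) \<longlonglongrightarrow> cinner g (sn l n)"
        by (rule tendsto_cinner_left[OF X(3)])
      show "(\<lambda>k. cinner (weak_deriv l (X k)) (sn l n)) \<longlonglongrightarrow> - complex_of_real (freq l n) * cinner f (cs l n)"
        unfolding H1D(3)[OF l Xn(1)] by (intro tendsto_intros tendsto_cinner_left X(2))
    qed
  qed
  with star show ?thesis
    by (simp add: H1_star_def)
qed

section \<open>Approximation by trigonometric sums\<close>

lemma domA_zero: "l > 0 \<Longrightarrow> 0 \<in> domA l"
  by (simp add: domA_iff H1_0_zero H1_0)

lemma domA_add: "l > 0 \<Longrightarrow> p \<in> domA l \<Longrightarrow> q \<in> domA l \<Longrightarrow> p + q \<in> domA l"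
  using H1_0D(1)[of l p] H1_0D(1)[of l q] by (simp add: domA_iff H1_0_add H1_add)

lemma domA_scaleC: "l > 0 \<Longrightarrow> p \<in> domA l \<Longrightarrow> c *\<^sub>C p \<in> domA l"
  using H1_0D(1)[of l p] by (simp add: domA_iff H1_0_scaleC H1_scaleC)

lemma domA_star_zero: "l > 0 \<Longrightarrow> 0 \<in> domA_star l"
  by (simp add: domA_star_iff H1_star_zero H1_0 H1_0_zero)

lemma domA_star_add: "l > 0 \<Longrightarrow> p \<in> domA_star l \<Longrightarrow> q \<in> domA_star l \<Longrightarrow> p + q \<in> domA_star l"
  using H1_star_D(1)[of l p] H1_star_D(1)[of l q] by (simp add: domA_star_iff H1_star_add H1_0_add H1_add)

lemma domA_star_scaleC: "l > 0 \<Longrightarrow> p \<in> domA_star l \<Longrightarrow> c *\<^sub>C p \<in> domA_star l"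
  using H1_star_D(1)[of l p] by (simp add: domA_star_iff H1_star_scaleC H1_0_scaleC H1_scaleC)

lemma domA_sum: "l > 0 \<Longrightarrow> (\<Sum>n<k. a n *\<^sub>C sn l (Suc n)) \<in> domA l"
  by (induction k) (auto intro: domA_zero domA_add domA_scaleC sn_domA)

lemma domA_star_sum: "l > 0 \<Longrightarrow> (\<Sum>n<k. a n *\<^sub>C cs l (Suc n)) \<in> domA_star l"
  by (induction k) (auto intro: domA_star_zero domA_star_add domA_star_scaleC cs_domA_star)

lemma domA_scaleR: "l > 0 \<Longrightarrow> p \<in> domA l \<Longrightarrow> r *\<^sub>R p \<in> domA l"
  and domA_star_scaleR: "l > 0 \<Longrightarrow> q \<in> domA_star l \<Longrightarrow> r *\<^sub>R q \<in> domA_star l"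
  unfolding scaleR_scaleC by (simp_all add: domA_scaleC domA_star_scaleC)

lemma weak_deriv_sn_sum:
  assumes l: "l > 0"
  shows "weak_deriv l (\<Sum>n<k. a n *\<^sub>C sn l (Suc n))
     = (\<Sum>n<k. (complex_of_real (freq l (Suc n)) * a n) *\<^sub>C cs l (Suc n))"
proof (induction k)
  case 0
  then show ?case
    by (simp add: H1_0[OF l])
next
  case (Suc k)
  have 1: "(\<Sum>n<k. a n *\<^sub>C sn l (Suc n)) \<in> H1 l" "sn l (Suc k) \<in> H1 l"
    using domA_sum[OF l] sn_weak_deriv(1)[OF l] H1_0D(1)[OF l] by (auto simp: domA_iff)
  then show ?case
    using Suc by (simp add: H1_add[OF l] H1_scaleC[OF l] sn_weak_deriv[OF l] scaleR_scaleC
        scaleC_scaleC mult.commute)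
qed

lemma weak_deriv_cs_sum:
  assumes l: "l > 0"
  shows "weak_deriv l (\<Sum>n<k. a n *\<^sub>C cs l (Suc n))
     = (\<Sum>n<k. (- complex_of_real (freq l (Suc n)) * a n) *\<^sub>C sn l (Suc n))"
proof (induction k)
  case 0
  then show ?case
    by (simp add: H1_0[OF l])
next
  case (Suc k)
  have 1: "(\<Sum>n<k. a n *\<^sub>C cs l (Suc n)) \<in> H1 l"
    using domA_star_sum[OF l] H1_star_D(1)[OF l] by (auto simp: domA_star_iff)
  then show ?case
    using Suc by (simp add: H1_add[OF l] H1_scaleC[OF l] cs_weak_deriv[OF l] scaleR_scaleC
        scaleC_scaleC mult.commute)
qed

text \<open>The derivative of a partial sine sum of \<open>u\<close> is a partial cosine sum of the
  derivative, which has no constant mode. Partial sums thus converge in the H^1 norm, not only in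
  L^2.\<close>

lemma H1_0_approx:
  assumes l: "l > 0" and u: "u \<in> H1_0 l"
  shows "(\<lambda>k. weak_deriv l (\<Sum>n<k. cinner u (sn l (Suc n)) *\<^sub>C sn l (Suc n))) \<longlonglongrightarrow> weak_deriv l u"
proof -
  have "weak_deriv l u \<in> L2_star l"
    using H1_0D(3)[OF l u] H1_0D(4)[OF l u, of 0] by (simp add: L2_star_iff[OF l])
  then have "(\<lambda>n. cinner (weak_deriv l u) (cs l (Suc n)) *\<^sub>C cs l (Suc n)) sums weak_deriv l u"
    by (rule onb_expansion[OF onb_cs_star[OF l]])
  then show ?thesis
    unfolding weak_deriv_sn_sum[OF l] sums_def H1_0D(4)[OF l u] .
qed

lemma H1_star_approx:
  assumes l: "l > 0" and v: "v \<in> H1_star l"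
  shows "(\<lambda>k. weak_deriv l (\<Sum>n<k. cinner v (cs l (Suc n)) *\<^sub>C cs l (Suc n))) \<longlonglongrightarrow> weak_deriv l v"
proof -
  note H = H1_star_D(1)[OF l v]
  have "(\<lambda>n. cinner (weak_deriv l v) (sn l (Suc n)) *\<^sub>C sn l (Suc n)) sums weak_deriv l v"
    by (rule onb_expansion[OF onb_sn[OF l]]) (rule H1D[OF l H])
  then show ?thesis
    unfolding weak_deriv_cs_sum[OF l] sums_def H1D(3)[OF l H] .
qed

text \<open>Powers act diagonally, so for every exponent the result is again a finite cosine
  sum.\<close>

lemma A_star_pow_sum:
  assumes l: "l > 0"
  shows "A_star_pow l \<sigma> (\<Sum>n<k. a n *\<^sub>C cs l (Suc n)) \<in> domA_star l"
proof -
  have mem: "(\<Sum>n<k. b n *\<^sub>C cs l (Suc n)) \<in> L2_star l" for b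
    by (rule L2_onb_sum_mem[OF onb_cs_star[OF l]])
  have "A_star_pow l \<sigma> (\<Sum>n<k. a n *\<^sub>C cs l (Suc n))
      = (\<Sum>n<k. (complex_of_real (((freq l (Suc n))\<^sup>2) powr \<sigma>) * a n) *\<^sub>C cs l (Suc n))"
    by (rule A_star_pow_eqI[OF l mem mem]) (simp add: cinner_onb_sum[OF onb_cs_star[OF l]])
  then show ?thesis
    using domA_star_sum[OF l] by simp
qed

section \<open>Energy estimates for a single beam\<close>

text \<open>Integrating the \<open>v\<close> terms by parts merges them with the displacement terms
  into the shear \<open>weak_deriv l u - v\<close> and its rate.\<close>

lemma beam_displacement_eq:
  assumes l: "l > 0" and u: "u \<in> H1_0 l" "u' \<in> H1_0 l" and v: "v \<in> H1_star l" "v' \<in> H1_star l"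
    and dom: "\<kappa> *\<^sub>R u + \<gamma> *\<^sub>R u' \<in> domA l" and \<phi>: "\<phi> \<in> H1_0 l"
  shows "inner (- opA l (\<kappa> *\<^sub>R u + \<gamma> *\<^sub>R u') - \<kappa> *\<^sub>R weak_deriv l v - \<gamma> *\<^sub>R weak_deriv l v') \<phi>
     = - \<kappa> * inner (weak_deriv l u - v) (weak_deriv l \<phi>)
       - \<gamma> * inner (weak_deriv l u' - v') (weak_deriv l \<phi>)"
proof -
  note H = H1_0D(1)[OF l u(1)] H1_0D(1)[OF l u(2)] H1_star_D(1)[OF l v(1)] H1_star_D(1)[OF l v(2)]
  have "inner (opA l (\<kappa> *\<^sub>R u + \<gamma> *\<^sub>R u')) \<phi>
      = \<kappa> * inner (weak_deriv l u) (weak_deriv l \<phi>) + \<gamma> * inner (weak_deriv l u') (weak_deriv l \<phi>)"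
    by (simp add: inner_opA[OF l dom \<phi>] H1_add[OF l] H1_scaleR[OF l] H inner_add_left)
  then show ?thesis
    by (simp add: inner_diff_left inner_weak_deriv[OF l _ \<phi>] H algebra_simps)
qed

lemma beam_rotation_eq:
  assumes l: "l > 0" and v: "v \<in> H1_star l" and w: "w \<in> H1_star l"
    and dom: "b *\<^sub>R v + \<gamma> *\<^sub>R w \<in> domA_star l" and \<phi>: "\<phi> \<in> H1_star l"
  shows "inner (- opA_star l (b *\<^sub>R v + \<gamma> *\<^sub>R w) + \<kappa> *\<^sub>R s + \<gamma>' *\<^sub>R s') \<phi>
     = - b * inner (weak_deriv l v) (weak_deriv l \<phi>) - \<gamma> * inner (weak_deriv l w) (weak_deriv l \<phi>)
       + \<kappa> * inner s \<phi> + \<gamma>' * inner s' \<phi>"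
proof -
  have "inner (opA_star l (b *\<^sub>R v + \<gamma> *\<^sub>R w)) \<phi>
      = b * inner (weak_deriv l v) (weak_deriv l \<phi>) + \<gamma> * inner (weak_deriv l w) (weak_deriv l \<phi>)"
    using H1_star_D(1)[OF l v] H1_star_D(1)[OF l w]
    by (simp add: inner_opA_star[OF l dom \<phi>] H1_add[OF l] H1_scaleR[OF l] inner_add_left)
  then show ?thesis
    by (simp add: inner_add_left inner_diff_left)
qed

text \<open>The domain of the system constrains the damping term only in combination with the
  rotation; solving for it places it in \<open>H1_star\<close>, so that its weak derivative may be
  used on its own.\<close>

lemma damped_domain:
  assumes l: "l > 0" and v: "v \<in> H1_star l" and dom: "b *\<^sub>R v + \<gamma> *\<^sub>R w \<in> domA_star l" and "\<gamma> \<noteq> 0"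
  shows "w \<in> H1_star l"
proof -
  have "(1 / \<gamma>) *\<^sub>R ((b *\<^sub>R v + \<gamma> *\<^sub>R w) + (- b) *\<^sub>R v) \<in> H1_star l"
    using dom by (intro H1_star_scaleR[OF l] H1_star_add[OF l _ H1_star_scaleR[OF l v]])
      (simp add: domA_star_iff)
  then show ?thesis
    using \<open>\<gamma> \<noteq> 0\<close> by simp
qed

text \<open>Expand the square of \<open>\<kappa> *\<^sub>R s + \<gamma> *\<^sub>R a\<close> and
  divide by 2 \<kappa>.\<close>

lemma inner_young:
  fixes a s :: "'a::real_inner"
  assumes "\<kappa> > 0"
  shows "- \<gamma> * inner a s \<le> \<kappa> / 2 * (norm s)\<^sup>2 + \<gamma>\<^sup>2 / (2 * \<kappa>) * (norm a)\<^sup>2"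
proof -
  have "0 \<le> (norm (\<kappa> *\<^sub>R s + \<gamma> *\<^sub>R a))\<^sup>2"
    by simp
  also have "\<dots> = \<kappa>\<^sup>2 * (norm s)\<^sup>2 + 2 * \<kappa> * \<gamma> * inner a s + \<gamma>\<^sup>2 * (norm a)\<^sup>2"
    unfolding power2_norm_eq_inner by (simp add: inner_add_left inner_add_right inner_commute power2_eq_square algebra_simps)
  finally have "0 \<le> (\<kappa>\<^sup>2 * (norm s)\<^sup>2 + 2 * \<kappa> * \<gamma> * inner a s + \<gamma>\<^sup>2 * (norm a)\<^sup>2) / (2 * \<kappa>)"
    using assms by simp
  also have "\<dots> = \<kappa> / 2 * (norm s)\<^sup>2 + \<gamma> * inner a s + \<gamma>\<^sup>2 / (2 * \<kappa>) * (norm a)\<^sup>2"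
    using assms by (simp add: power2_eq_square field_simps)
  finally show ?thesis
    by simp
qed

text \<open>With \<open>s\<close> the shear, the left side of the inequality is the contribution of
  one beam to the derivative of the multiplier, and \<open>\<delta>\<close> is its dissipation. The
  coupling through \<open>m\<close> is left out, so that both beams are instances.\<close>

definition beam_estimate ::
    "real \<Rightarrow> real \<Rightarrow> real \<Rightarrow> real \<Rightarrow> real \<Rightarrow> real \<Rightarrow> real \<Rightarrow> real \<Rightarrow> real \<Rightarrow> bool" where
  "beam_estimate l \<kappa> b \<rho> \<rho>' \<gamma> \<gamma>' \<alpha> C \<longleftrightarrow> (\<forall>u' v v' a s w \<delta>. u' \<in> H1_0 l \<longrightarrow> v' \<in> H1_star l \<longrightarrow>
     a = weak_deriv l u' - v' \<longrightarrow> w = A_star_pow l (\<alpha> - 1) v' \<longrightarrow> w \<in> H1_star l \<longrightarrow>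
     \<delta> = \<gamma> * (norm a)\<^sup>2 + \<gamma>' * inner (weak_deriv l w) (weak_deriv l v') \<longrightarrow>
     0 \<le> \<delta> \<and>
     \<rho> * (norm u')\<^sup>2 + \<rho>' * (norm v')\<^sup>2 - \<kappa> * (norm s)\<^sup>2 - \<gamma> * inner a s
       - b * (norm (weak_deriv l v))\<^sup>2 - \<gamma>' * inner (weak_deriv l w) (weak_deriv l v)
     \<le> - 1 / 2 * (\<rho> * (norm u')\<^sup>2 + \<rho>' * (norm v')\<^sup>2 + \<kappa> * (norm s)\<^sup>2 + b * (norm (weak_deriv l v))\<^sup>2)
        + C * \<delta>)"

text \<open>The dissipation \<open>\<delta>\<close> of a beam controls its kinetic energy, through the Poincare inequality and \<open>\<alpha> \<ge> 0\<close>,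
  and the damping terms in the equation for the multiplier \<open>(u, v)\<close>, because \<open>\<alpha> \<le> 1\<close>.\<close>

lemma beam_dissipation:
  assumes l: "l > 0" and \<alpha>: "\<alpha> \<in> {0..1}"
    and pos: "\<kappa> > 0" "b > 0" "\<rho> > 0" "\<rho>' > 0" "\<gamma> > 0" "\<gamma>' > 0"
  shows "\<exists>C\<ge>0. beam_estimate l \<kappa> b \<rho> \<rho>' \<gamma> \<gamma>' \<alpha> C"
proof -
  define k e0 e1 where "k = (freq l 1)\<^sup>2" and "e0 = k powr \<alpha>" and "e1 = k powr (\<alpha> - 1)"
  have k: "k > 0"
    using freq_pos[OF l, of 1] by (simp add: k_def)
  then have e: "e0 > 0" "e1 > 0"
    by (simp_all add: e0_def e1_def)
  \<comment> \<open>\<open>Cv\<close> and \<open>Cu\<close> bound the squared velocities by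
    \<delta>: the former comes from the lower bound e0 for the rotational damping, the latter from
    u'_x = a + v' and Poincare's inequality with constant k.\<close>
  define Cv where "Cv = 1 / (e0 * \<gamma>')"
  define Cu where "Cu = 2 / k * (1 / \<gamma> + Cv)"
  \<comment> \<open>The factor 3/2 pays for the kinetic energy on the left and the half of it
    demanded with negative sign on the right; the last two terms are left by Young's inequality
    after spending half of the elastic energy.\<close>
  define C where "C = 3 / 2 * (\<rho> * Cu + \<rho>' * Cv) + \<gamma> / (2 * \<kappa>) + \<gamma>' * e1 / (2 * b)"
  have C: "Cv \<ge> 0" "Cu \<ge> 0" "C \<ge> 0"
    using pos e k by (simp_all add: Cv_def Cu_def C_def)
  show ?thesis
  proof (intro exI[of _ C] conjI \<open>C \<ge> 0\<close>, unfold beam_estimate_def, intro allI impI conjI)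
    fix u' v v' a s w' \<delta>
    assume u': "u' \<in> H1_0 l" and v': "v' \<in> H1_star l" and a_def: "a = weak_deriv l u' - v'"
      and w': "w' = A_star_pow l (\<alpha> - 1) v'" "w' \<in> H1_star l"
      and \<delta>': "\<delta> = \<gamma> * (norm a)\<^sup>2 + \<gamma>' * inner (weak_deriv l w') (weak_deriv l v')"
    define w where "w = weak_deriv l w'"
    have \<delta>_def: "\<delta> = \<gamma> * (norm a)\<^sup>2 + \<gamma>' * inner w (weak_deriv l v')"
      by (simp add: \<delta>' w_def)
    have damp: "e0 * (norm v')\<^sup>2 \<le> inner w (weak_deriv l v')" "(norm w)\<^sup>2 \<le> e1 * inner w (weak_deriv l v')"
      using A_star_pow_damping[OF l \<alpha> v'] H1_star_D(1)[OF l w'(2)]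
      by (simp_all add: w_def w'(1) e0_def e1_def k_def)
    have "0 \<le> e0 * (norm v')\<^sup>2"
      using e by simp
    then have i: "inner w (weak_deriv l v') \<ge> 0"
      using damp(1) by linarith
    have d1: "\<gamma> * (norm a)\<^sup>2 \<le> \<delta>" "\<gamma>' * inner w (weak_deriv l v') \<le> \<delta>" "0 \<le> \<delta>"
      using pos i by (simp_all add: \<delta>_def)
    have a2: "(norm a)\<^sup>2 \<le> 1 / \<gamma> * \<delta>" and w2: "inner w (weak_deriv l v') \<le> 1 / \<gamma>' * \<delta>"
      using d1 pos by (simp_all add: field_simps)
    have "e0 * (norm v')\<^sup>2 \<le> 1 / \<gamma>' * \<delta>"
      using damp(1) w2 by linarith
    then have nv: "(norm v')\<^sup>2 \<le> Cv * \<delta>"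
      using e pos by (simp add: Cv_def field_simps)
    have nu: "(norm u')\<^sup>2 \<le> Cu * \<delta>"
    proof -
      have "(norm (weak_deriv l u'))\<^sup>2 \<le> (norm a + norm v')\<^sup>2"
        using norm_triangle_ineq[of a v'] by (intro power_mono) (simp_all add: a_def)
      also have "\<dots> \<le> 2 * ((norm a)\<^sup>2 + (norm v')\<^sup>2)"
        using sum_squares_bound[of "norm a" "norm v'"] by (simp add: power2_sum)
      also have "\<dots> \<le> 2 * ((1 / \<gamma> + Cv) * \<delta>)"
        using a2 nv by (simp add: distrib_right)
      finally have "(norm (weak_deriv l u'))\<^sup>2 \<le> 2 * ((1 / \<gamma> + Cv) * \<delta>)" .
      moreover have "(freq l 1 * norm u')\<^sup>2 \<le> (norm (weak_deriv l u'))\<^sup>2"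
        using poincare_H1_0[OF l u'] freq_pos[OF l, of 1] by (intro power_mono) auto
      then have "k * (norm u')\<^sup>2 \<le> (norm (weak_deriv l u'))\<^sup>2"
        by (simp add: k_def power_mult_distrib)
      ultimately have "k * (norm u')\<^sup>2 \<le> 2 * ((1 / \<gamma> + Cv) * \<delta>)"
        by linarith
      then show ?thesis
        using k by (simp add: Cu_def field_simps)
    qed
    have y1: "- \<gamma> * inner a s \<le> \<kappa> / 2 * (norm s)\<^sup>2 + \<gamma> / (2 * \<kappa>) * \<delta>"
    proof -
      have "\<gamma>\<^sup>2 / (2 * \<kappa>) * (norm a)\<^sup>2 = \<gamma> / (2 * \<kappa>) * (\<gamma> * (norm a)\<^sup>2)"
        by (simp add: power2_eq_square)
      also have "\<dots> \<le> \<gamma> / (2 * \<kappa>) * \<delta>"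
        using d1(1) pos by (intro mult_left_mono) auto
      finally show ?thesis
        using inner_young[OF pos(1), of \<gamma> a s] by linarith
    qed
    have y2: "- \<gamma>' * inner w (weak_deriv l v) \<le> b / 2 * (norm (weak_deriv l v))\<^sup>2 + \<gamma>' * e1 / (2 * b) * \<delta>"
    proof -
      have "\<gamma>'\<^sup>2 / (2 * b) * (norm w)\<^sup>2 \<le> \<gamma>'\<^sup>2 / (2 * b) * (e1 * inner w (weak_deriv l v'))"
        using pos by (intro mult_left_mono damp(2)) auto
      also have "\<dots> = \<gamma>' * e1 / (2 * b) * (\<gamma>' * inner w (weak_deriv l v'))"
        by (simp add: power2_eq_square)
      also have "\<dots> \<le> \<gamma>' * e1 / (2 * b) * \<delta>"
        using d1(2) pos e by (intro mult_left_mono) auto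
      finally show ?thesis
        using inner_young[OF pos(2), of \<gamma>' w "weak_deriv l v"] by linarith
    qed
    have ku: "\<rho> * (norm u')\<^sup>2 \<le> \<rho> * Cu * \<delta>" and kv: "\<rho>' * (norm v')\<^sup>2 \<le> \<rho>' * Cv * \<delta>"
      using mult_left_mono[OF nu, of \<rho>] mult_left_mono[OF nv, of \<rho>'] pos by (simp_all add: mult.assoc)
    have "C * \<delta> = 3 / 2 * (\<rho> * Cu * \<delta>) + 3 / 2 * (\<rho>' * Cv * \<delta>) + \<gamma> / (2 * \<kappa>) * \<delta> + \<gamma>' * e1 / (2 * b) * \<delta>"
      by (simp add: C_def algebra_simps)
    then have "\<rho> * (norm u')\<^sup>2 + \<rho>' * (norm v')\<^sup>2 - \<kappa> * (norm s)\<^sup>2 - \<gamma> * inner a s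
           - b * (norm (weak_deriv l v))\<^sup>2 - \<gamma>' * inner w (weak_deriv l v)
         \<le> - 1 / 2 * (\<rho> * (norm u')\<^sup>2 + \<rho>' * (norm v')\<^sup>2 + \<kappa> * (norm s)\<^sup>2 + b * (norm (weak_deriv l v))\<^sup>2)
            + C * \<delta>"
      using y1 y2 ku kv by (simp add: algebra_simps)
    then show "\<rho> * (norm u')\<^sup>2 + \<rho>' * (norm v')\<^sup>2 - \<kappa> * (norm s)\<^sup>2 - \<gamma> * inner a s
           - b * (norm (weak_deriv l v))\<^sup>2 - \<gamma>' * inner (weak_deriv l w') (weak_deriv l v)
         \<le> - 1 / 2 * (\<rho> * (norm u')\<^sup>2 + \<rho>' * (norm v')\<^sup>2 + \<kappa> * (norm s)\<^sup>2 + b * (norm (weak_deriv l v))\<^sup>2)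
            + C * \<delta>"
      by (simp only: w_def)
    show "0 \<le> \<delta>"
      by (rule d1(3))
  qed
qed

section \<open>Lyapunov functionals for strongly continuous semigroups\<close>

text \<open>The function exp (\<omega> t) g(t) is nonincreasing. Orbits will be differentiated at
  positive times only; continuity takes care of t = 0.\<close>

lemma decay_differential_inequality:
  fixes g :: "real \<Rightarrow> real"
  assumes cont: "continuous_on {0..} g"
    and deriv: "\<And>t. t > 0 \<Longrightarrow> (g has_real_derivative g' t) (at t)"
    and le: "\<And>t. t > 0 \<Longrightarrow> g' t \<le> - \<omega> * g t" and t: "t \<ge> 0"
  shows "g t \<le> exp (- \<omega> * t) * g 0"
proof -
  have "exp (\<omega> * t) * g t \<le> exp (\<omega> * 0) * g 0"
  proof (rule DERIV_nonpos_imp_decreasing_open[OF t])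
    fix s assume s: "0 < s" "s < t"
    have "((\<lambda>s. exp (\<omega> * s) * g s) has_real_derivative
        exp (\<omega> * s) * \<omega> * g s + g' s * exp (\<omega> * s)) (at s)"
      by (rule derivative_eq_intros deriv s refl | simp)+
    moreover have "exp (\<omega> * s) * \<omega> * g s + g' s * exp (\<omega> * s) \<le> 0"
      using mult_left_mono[OF le[OF s(1)], of "exp (\<omega> * s)"] by (simp add: algebra_simps)
    ultimately show "\<exists>y. ((\<lambda>s. exp (\<omega> * s) * g s) has_real_derivative y) (at s) \<and> y \<le> 0"
      by blast
  next
    show "continuous_on {0..t} (\<lambda>s. exp (\<omega> * s) * g s)"
      by (intro continuous_intros continuous_on_subset[OF cont]) auto
  qed
  then show ?thesis
    by (simp add: exp_minus field_simps)
qed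

text \<open>Norms on a subspace \<open>X\<close> are given as pullbacks along a linear map \<open>J\<close> into an inner product space.\<close>

locale linear_normed_subspace =
  fixes X :: "'a::complex_vector set" and J :: "'a \<Rightarrow> 'b::real_inner"
  assumes X_zero: "0 \<in> X" and X_add: "U \<in> X \<Longrightarrow> V \<in> X \<Longrightarrow> U + V \<in> X"
    and X_scaleC: "U \<in> X \<Longrightarrow> c *\<^sub>C U \<in> X"
    and J_add: "U \<in> X \<Longrightarrow> V \<in> X \<Longrightarrow> J (U + V) = J U + J V"
    and J_scaleR: "U \<in> X \<Longrightarrow> J (r *\<^sub>R U) = r *\<^sub>R J U"
begin

text \<open>Real linearity on \<open>X\<close> and a bound by the energy norm are what allows an
  orbit to be differentiated through \<open>K\<close>. Instances are \<open>J\<close>, single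
  components, and both factors of the multiplier.\<close>

definition bounded_on :: "('a \<Rightarrow> 'c::real_normed_vector) \<Rightarrow> real \<Rightarrow> bool" where
  "bounded_on K C \<longleftrightarrow> (\<forall>U\<in>X. \<forall>V\<in>X. K (U + V) = K U + K V) \<and>
     (\<forall>U\<in>X. \<forall>r. K (r *\<^sub>R U) = r *\<^sub>R K U) \<and> (\<forall>U\<in>X. norm (K U) \<le> C * norm (J U))"

lemma bounded_onD:
  assumes "bounded_on K C"
  shows "U \<in> X \<Longrightarrow> V \<in> X \<Longrightarrow> K (U + V) = K U + K V" "U \<in> X \<Longrightarrow> K (r *\<^sub>R U) = r *\<^sub>R K U"
    "U \<in> X \<Longrightarrow> norm (K U) \<le> C * norm (J U)"
  using assms by (auto simp: bounded_on_def)

lemma bounded_on_J: "bounded_on J 1"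
  by (simp add: bounded_on_def J_add J_scaleR)

lemma X_scaleR: "U \<in> X \<Longrightarrow> r *\<^sub>R U \<in> X"
  by (simp add: scaleR_scaleC X_scaleC)

lemma X_diff: "U \<in> X \<Longrightarrow> V \<in> X \<Longrightarrow> U - V \<in> X"
  using X_add[of U "(- 1) *\<^sub>R V"] X_scaleR[of V "- 1"] by simp

lemma bounded_on_diff: "bounded_on K C \<Longrightarrow> U \<in> X \<Longrightarrow> V \<in> X \<Longrightarrow> K (U - V) = K U - K V"
  using bounded_onD(1)[of K C U "(- 1) *\<^sub>R V"] bounded_onD(2)[of K C V "- 1"] X_scaleR[of V "- 1"] by simp

lemmas J_diff = bounded_on_diff[OF bounded_on_J]

lemma bounded_on_cong:
  assumes "bounded_on K C" "\<And>U. U \<in> X \<Longrightarrow> K' U = K U"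
  shows "bounded_on K' C"
  using assms(1) by (simp add: bounded_on_def assms(2) X_add X_scaleR)

lemma bounded_on_fst: "bounded_on K C \<Longrightarrow> bounded_on (\<lambda>U. fst (K U)) C"
  and bounded_on_snd: "bounded_on K' C \<Longrightarrow> bounded_on (\<lambda>U. snd (K' U)) C"
  for K :: "'a \<Rightarrow> 'c::real_normed_vector \<times> 'd::real_normed_vector"
    and K' :: "'a \<Rightarrow> 'e::real_normed_vector \<times> 'f::real_normed_vector"
proof -
  have "norm (fst p) \<le> norm p" for p :: "'c::real_normed_vector \<times> 'd::real_normed_vector"
    by (simp add: norm_prod_def real_sqrt_ge_abs1)
  then show "bounded_on K C \<Longrightarrow> bounded_on (\<lambda>U. fst (K U)) C"
    by (simp add: bounded_on_def) (meson order_trans)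
  have "norm (snd p) \<le> norm p" for p :: "'e::real_normed_vector \<times> 'f::real_normed_vector"
    by (simp add: norm_prod_def real_sqrt_ge_abs2)
  then show "bounded_on K' C \<Longrightarrow> bounded_on (\<lambda>U. snd (K' U)) C"
    by (simp add: bounded_on_def) (meson order_trans)
qed

lemma bounded_on_scaleR:
  assumes "bounded_on K C"
  shows "bounded_on (\<lambda>U. r *\<^sub>R K U) (\<bar>r\<bar> * C)"
  using bounded_onD[OF assms] by (auto simp: bounded_on_def scaleR_add_right mult.assoc intro: mult_left_mono)

lemma bounded_on_add:
  assumes "bounded_on K C" "bounded_on K' C'"
  shows "bounded_on (\<lambda>U. K U + K' U) (C + C')"
  using bounded_onD[OF assms(1)] bounded_onD[OF assms(2)]
  by (auto simp: bounded_on_def scaleR_add_right distrib_right intro: norm_triangle_mono)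

lemma bounded_on_Pair:
  assumes "bounded_on K C" "bounded_on K' C'"
  shows "bounded_on (\<lambda>U. (K U, K' U)) (C + C')"
proof -
  have "norm (K U, K' U) \<le> (C + C') * norm (J U)" if "U \<in> X" for U
    using bounded_onD(3)[OF assms(1) that] bounded_onD(3)[OF assms(2) that]
      norm_Pair_le[of "K U" "K' U"] by (simp add: distrib_right)
  then show ?thesis
    using assms by (simp add: bounded_on_def)
qed

lemma bounded_on_dominated:
  assumes "bounded_on K C" "r \<ge> 0"
    and "\<And>U V. U \<in> X \<Longrightarrow> V \<in> X \<Longrightarrow> K' (U + V) = K' U + K' V"
    and "\<And>U r. U \<in> X \<Longrightarrow> K' (r *\<^sub>R U) = r *\<^sub>R K' U"
    and "\<And>U. U \<in> X \<Longrightarrow> norm (K' U) \<le> r * norm (K U)"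
  shows "bounded_on K' (r * C)"
proof -
  have "norm (K' U) \<le> r * C * norm (J U)" if "U \<in> X" for U
    using assms(5)[OF that] mult_left_mono[OF bounded_onD(3)[OF assms(1) that] assms(2)] by simp
  then show ?thesis
    using assms by (simp add: bounded_on_def)
qed

lemma bounded_on_Cauchy:
  assumes K: "bounded_on K C" and U: "\<And>n. U n \<in> X" and c: "Cauchy (\<lambda>n. J (U n))"
  shows "Cauchy (\<lambda>n. K (U n))"
proof (rule metric_CauchyI)
  fix e :: real assume "e > 0"
  \<comment> \<open>\<open>C\<close> may be 0 or negative; |C| + 1 is a bound that can be divided
    by.\<close>
  then have "e / (\<bar>C\<bar> + 1) > 0"
    by simp
  then obtain M where M: "\<And>m n. m \<ge> M \<Longrightarrow> n \<ge> M \<Longrightarrow> dist (J (U m)) (J (U n)) < e / (\<bar>C\<bar> + 1)"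
    using metric_CauchyD[OF c] by metis
  have "dist (K (U m)) (K (U n)) < e" if "m \<ge> M" "n \<ge> M" for m n
  proof -
    have "norm (K (U m - U n)) \<le> C * norm (J (U m - U n))"
      by (intro bounded_onD(3)[OF K] X_diff U)
    also have "\<dots> \<le> (\<bar>C\<bar> + 1) * norm (J (U m - U n))"
      by (intro mult_right_mono) auto
    also have "\<dots> < (\<bar>C\<bar> + 1) * (e / (\<bar>C\<bar> + 1))"
      using M[OF that] by (intro mult_strict_left_mono) (auto simp: dist_norm J_diff U)
    finally show ?thesis
      by (simp add: dist_norm bounded_on_diff[OF K] U)
  qed
  then show "\<exists>M. \<forall>m\<ge>M. \<forall>n\<ge>M. dist (K (U m)) (K (U n)) < e"
    by blast
qed

end

text \<open>The type of \<open>X\<close> need not be normed, so completeness of \<open>X\<close> in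
  \<open>N\<close> is expressed through the image under \<open>J\<close>. It feeds the uniform
  boundedness argument.\<close>

locale normed_c0_semigroup = linear_normed_subspace X J
  for X :: "'a::complex_vector set" and J :: "'a \<Rightarrow> 'b::real_inner" +
  fixes N :: "'a \<Rightarrow> real" and S :: "real \<Rightarrow> 'a \<Rightarrow> 'a"
  assumes N_eq: "U \<in> X \<Longrightarrow> N U = norm (J U)"
    and complete_image: "complete (J ` X)"
    and semigroup: "c0_semigroup X N S"
begin

section \<open>Uniform boundedness of the semigroup\<close>

lemma S_mem: "t \<ge> 0 \<Longrightarrow> U \<in> X \<Longrightarrow> S t U \<in> X"
  and S_add: "t \<ge> 0 \<Longrightarrow> U \<in> X \<Longrightarrow> V \<in> X \<Longrightarrow> S t (U + V) = S t U + S t V"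
  and S_scaleC: "t \<ge> 0 \<Longrightarrow> U \<in> X \<Longrightarrow> S t (c *\<^sub>C U) = c *\<^sub>C S t U"
  and S_bounded: "t \<ge> 0 \<Longrightarrow> \<exists>C. \<forall>U\<in>X. N (S t U) \<le> C * N U"
  and S_0: "U \<in> X \<Longrightarrow> S 0 U = U"
  and S_semigroup: "s \<ge> 0 \<Longrightarrow> t \<ge> 0 \<Longrightarrow> U \<in> X \<Longrightarrow> S (s + t) U = S s (S t U)"
  and S_cont: "U \<in> X \<Longrightarrow> ((\<lambda>t. N (S t U - U)) \<longlongrightarrow> 0) (at_right 0)"
  using semigroup unfolding c0_semigroup_def by blast+

lemma S_scaleR: "t \<ge> 0 \<Longrightarrow> U \<in> X \<Longrightarrow> S t (r *\<^sub>R U) = r *\<^sub>R S t U"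
  by (simp add: scaleR_scaleC S_scaleC)

lemma S_diff: "t \<ge> 0 \<Longrightarrow> U \<in> X \<Longrightarrow> V \<in> X \<Longrightarrow> S t (U - V) = S t U - S t V"
  using S_add[of t U "(- 1) *\<^sub>R V"] S_scaleR[of t V "- 1"] X_scaleR[of V "- 1"] by simp

lemma S_J_bounded: "t \<ge> 0 \<Longrightarrow> \<exists>C. \<forall>U\<in>X. norm (J (S t U)) \<le> C * norm (J U)"
  using S_bounded[of t] by (auto simp: N_eq S_mem)

lemma S_J_cont:
  assumes U: "U \<in> X" and "e > 0"
  obtains d where "d > 0" "\<And>h. 0 \<le> h \<Longrightarrow> h < d \<Longrightarrow> norm (J (S h U - U)) < e"
proof -
  have "eventually (\<lambda>t. \<bar>N (S t U - U)\<bar> < e) (at_right 0)"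
    using S_cont[OF U] \<open>e > 0\<close> by (auto dest: tendstoD simp: dist_real_def)
  then obtain d where d: "d > 0" "\<And>h. 0 < h \<Longrightarrow> h < d \<Longrightarrow> \<bar>N (S h U - U)\<bar> < e"
    unfolding eventually_at_right_field by auto
  have "norm (J (S h U - U)) < e" if "0 \<le> h" "h < d" for h
  proof (cases "h = 0")
    case True
    then show ?thesis
      using J_diff[OF U U] \<open>e > 0\<close> by (simp add: S_0[OF U])
  next
    case False
    then show ?thesis
      using d(2)[of h] that by (simp add: N_eq X_diff S_mem U)
  qed
  with d(1) show ?thesis
    using that by blast
qed

text \<open>\<open>L\<close> is the operator norm of \<open>S t\<close>, a supremum over unit
  vectors, and \<open>V\<close> nearly attains it. Any factor between 1/2 and 1 in place of 2/3
  would serve the gliding hump.\<close>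

lemma S_near_norm:
  assumes t: "t \<ge> 0" and U: "U \<in> X" "norm (J (S t U)) > K * norm (J U)" and K: "K > 0"
  obtains L V where "L \<ge> K" "\<And>W. W \<in> X \<Longrightarrow> norm (J (S t W)) \<le> L * norm (J W)"
    "V \<in> X" "norm (J V) = 1" "norm (J (S t V)) \<ge> 2 / 3 * L"
proof -
  obtain C where C: "\<And>W. W \<in> X \<Longrightarrow> norm (J (S t W)) \<le> C * norm (J W)"
    using S_J_bounded[OF t] by blast
  define A where "A = {norm (J (S t W)) | W. W \<in> X \<and> norm (J W) = 1}"
  define L where "L = Sup A"
  have bdd: "bdd_above A"
    unfolding A_def by (rule bdd_aboveI[of _ C]) (use C in fastforce)
  have upper: "norm (J (S t W)) \<le> L" if "W \<in> X" "norm (J W) = 1" for W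
    unfolding L_def by (rule cSup_upper[OF _ bdd]) (use that in \<open>auto simp: A_def\<close>)
  have scale: "norm (J (S t W)) \<le> L * norm (J W)" if W: "W \<in> X" for W
  proof (cases "norm (J W) = 0")
    case True
    then show ?thesis
      using C[OF W] by simp
  next
    case False
    define W' where "W' = (1 / norm (J W)) *\<^sub>R W"
    have W': "W' \<in> X" "norm (J W') = 1"
      using W False by (simp_all add: W'_def X_scaleR J_scaleR)
    have "norm (J (S t W')) = norm (J (S t W)) / norm (J W)"
      using t W by (simp add: W'_def S_scaleR J_scaleR S_mem)
    then show ?thesis
      using upper[OF W'] False by (simp add: field_simps)
  qed
  have "K * norm (J U) < L * norm (J U)"
    using U(2) scale[OF U(1)] by simp
  then have KL: "K < L" and nz: "norm (J U) \<noteq> 0"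
    by (auto simp: mult_less_cancel_right)
  have "(1 / norm (J U)) *\<^sub>R U \<in> X" "norm (J ((1 / norm (J U)) *\<^sub>R U)) = 1"
    using nz U(1) by (simp_all add: X_scaleR J_scaleR)
  then have "A \<noteq> {}"
    unfolding A_def by blast
  moreover have "2 / 3 * L < L"
    using KL K by simp
  ultimately obtain a where "a \<in> A" "2 / 3 * L < a"
    unfolding L_def by (metis less_cSup_iff[OF _ bdd])
  then obtain V where "V \<in> X" "norm (J V) = 1" "norm (J (S t V)) \<ge> 2 / 3 * L"
    unfolding A_def by auto
  then show ?thesis
    using that scale KL by (meson less_imp_le)
qed

text \<open>Uniform boundedness near \<open>0\<close>, by the gliding hump argument: if the norms \<open>L\<^sub>n\<close> of
  \<open>S (t\<^sub>n)\<close>, \<open>t\<^sub>n \<rightarrow> 0\<close>, exceed \<open>4 ^ n\<close>, a series with steps of size \<open>3 ^ (-n)\<close> in nearly norming directions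
  converges to a point at which \<open>S (t\<^sub>n)\<close> is unbounded.\<close>

lemma S_bounded_near_0:
  "\<exists>d>0. \<exists>M>0. \<forall>t. 0 \<le> t \<longrightarrow> t \<le> d \<longrightarrow> (\<forall>U\<in>X. norm (J (S t U)) \<le> M * norm (J U))"
proof (rule ccontr)
  assume neg: "\<not> ?thesis"
  have "\<exists>t L V. 0 \<le> t \<and> t \<le> 1 / real (Suc n) \<and> L \<ge> 4 ^ n \<and>
      (\<forall>W\<in>X. norm (J (S t W)) \<le> L * norm (J W)) \<and>
      V \<in> X \<and> norm (J V) = 1 \<and> norm (J (S t V)) \<ge> 2 / 3 * L" for n
  proof -
    have "(1::real) / real (Suc n) > 0" "(4::real) ^ n > 0"
      by auto
    then obtain t U where tU: "0 \<le> t" "t \<le> 1 / real (Suc n)" "U \<in> X" "norm (J (S t U)) > 4 ^ n * norm (J U)"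
      using neg by (meson not_le)
    show ?thesis
      using S_near_norm[OF tU(1,3,4)] tU(1,2) by (metis zero_less_numeral zero_less_power)
  qed
  then obtain t L V where t: "\<And>n. 0 \<le> t n" "\<And>n. t n \<le> 1 / real (Suc n)"
    and L: "\<And>n. L n \<ge> 4 ^ n" "\<And>n W. W \<in> X \<Longrightarrow> norm (J (S (t n) W)) \<le> L n * norm (J W)"
    and V: "\<And>n. V n \<in> X" "\<And>n. norm (J (V n)) = 1" "\<And>n. norm (J (S (t n) (V n))) \<ge> 2 / 3 * L n"
    by metis
  define b where "b n = ((1/3) ^ n :: real) *\<^sub>R V n" for n
  have bX: "b n \<in> X" and nb: "norm (J (b n)) = (1/3) ^ n" for n
    by (simp_all add: b_def X_scaleR V J_scaleR)
  have nSb: "norm (J (S (t n) (b n))) \<ge> (1/3) ^ n * (2 / 3 * L n)" for n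
    using mult_left_mono[OF V(3)[of n], of "(1/3) ^ n"]
    by (simp add: b_def S_scaleR t V J_scaleR S_mem)
  \<comment> \<open>The sign of each step is chosen so that the image of the new point under
    \<open>S (t n)\<close> is at least as large as that of \<open>b n\<close>; one sign works
    because 2 S b = S (x + b) - S (x - b).\<close>
  define x where "x = rec_nat 0 (\<lambda>n y. if norm (J (S (t n) (b n))) \<le> norm (J (S (t n) (y + b n)))
      then y + b n else y - b n)"
  have x_0: "x 0 = 0" and x_Suc: "x (Suc n) = (if norm (J (S (t n) (b n))) \<le> norm (J (S (t n) (x n + b n)))
      then x n + b n else x n - b n)" for n
    by (simp_all add: x_def)
  have xX: "x n \<in> X" for n
    by (induction n) (auto simp: x_0 x_Suc X_zero X_add X_diff bX)
  have step: "norm (J (x (Suc n)) - J (x n)) = (1/3) ^ n" for n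
    using nb[of n] by (simp add: x_Suc J_add J_diff xX bX)
  have big: "norm (J (S (t n) (x (Suc n)))) \<ge> (1/3) ^ n * (2 / 3 * L n)" for n
  proof -
    define p q where "p = J (S (t n) (x n))" and "q = J (S (t n) (b n))"
    have "norm q \<le> norm (J (S (t n) (x (Suc n))))"
    proof (cases "norm q \<le> norm (p + q)")
      case True
      then show ?thesis
        by (simp add: x_Suc p_def q_def S_add t xX bX J_add S_mem)
    next
      case False
      have "norm ((p + q) - (p - q)) \<le> norm (p + q) + norm (p - q)"
        by (rule norm_triangle_ineq4)
      then have "2 * norm q \<le> norm (p + q) + norm (p - q)"
        by (simp add: scaleR_2[symmetric])
      with False show ?thesis
        by (simp add: x_Suc p_def q_def S_add S_diff t xX bX J_add J_diff S_mem)
    qed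
    then show ?thesis
      using nSb[of n] by (simp add: q_def)
  qed
  \<comment> \<open>The right side is the exact sum of the step sizes from n to n + k - 1, which
    gives the tail bound 3/2 * 3^(-n).\<close>
  have dist: "norm (J (x (n + k)) - J (x n)) \<le> 3 / 2 * ((1/3) ^ n - (1/3) ^ (n + k))" for n k
  proof (induction k)
    case (Suc k)
    have "norm (J (x (n + Suc k)) - J (x n)) \<le> norm (J (x (Suc (n + k))) - J (x (n + k))) + norm (J (x (n + k)) - J (x n))"
      using norm_triangle_ineq[of "J (x (Suc (n + k))) - J (x (n + k))" "J (x (n + k)) - J (x n)"] by simp
    also have "\<dots> \<le> (1/3) ^ (n + k) + 3 / 2 * ((1/3) ^ n - (1/3) ^ (n + k))"
      using Suc step[of "n + k"] by simp
    finally show ?case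
      by (simp add: algebra_simps)
  qed simp
  have dist': "norm (J (x m) - J (x n)) \<le> 3 / 2 * (1/3) ^ n" if "m \<ge> n" for m n
  proof -
    have "norm (J (x m) - J (x n)) \<le> 3 / 2 * ((1/3) ^ n - (1/3) ^ m)"
      using dist[of n "m - n"] that by simp
    also have "\<dots> \<le> 3 / 2 * (1/3) ^ n"
      by simp
    finally show ?thesis .
  qed
  have "Cauchy (\<lambda>n. J (x n))"
  proof (rule CauchyI')
    fix e :: real assume "e > 0"
    then have "\<exists>n. (1/3) ^ n < e * (2/3)"
      by (intro real_arch_pow_inv) auto
    then obtain n where n: "3 / 2 * (1/3) ^ n < e"
      by (auto simp: field_simps)
    have "dist (J (x i)) (J (x j)) < e" if "i \<ge> n" "j > i" for i j
    proof -
      have "(1/3 :: real) ^ i \<le> (1/3) ^ n"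
        using that by (intro power_decreasing) auto
      moreover have "norm (J (x j) - J (x i)) \<le> 3 / 2 * (1/3) ^ i"
        using that by (intro dist') simp
      ultimately show ?thesis
        using n unfolding dist_norm norm_minus_commute[of "J (x i)"] by linarith
    qed
    then show "\<exists>M. \<forall>m\<ge>M. \<forall>n>m. dist (J (x m)) (J (x n)) < e"
      by blast
  qed
  moreover have "\<forall>n. J (x n) \<in> J ` X"
    using xX by blast
  ultimately have "\<exists>w\<in>J ` X. (\<lambda>n. J (x n)) \<longlonglongrightarrow> w"
    using complete_image unfolding complete_def by (elim allE[of _ "\<lambda>n. J (x n)"]) simp
  then obtain z where z: "z \<in> X" "(\<lambda>n. J (x n)) \<longlonglongrightarrow> J z"
    by blast
  have near: "norm (J (z - x n)) \<le> 3 / 2 * (1/3) ^ n" for n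
  proof -
    have "(\<lambda>m. norm (J (x m) - J (x n))) \<longlonglongrightarrow> norm (J z - J (x n))"
      by (intro tendsto_intros z)
    then have "norm (J z - J (x n)) \<le> 3 / 2 * (1/3) ^ n"
      by (rule LIMSEQ_le_const2) (use dist' in blast)
    then show ?thesis
      by (simp add: J_diff z xX)
  qed
  \<comment> \<open>In units of L_n 3^(-n), the point after step n has an image of size at least
    2/3, and all later steps change it by at most 3/2 * 1/3 = 1/2. The remaining 1/6, with L_n >=
    4^n, grows like (4/3)^n.\<close>
  have low: "norm (J (S (t n) z)) \<ge> 1 / 6 * (4/3) ^ n" for n
  proof -
    have Lpos: "L n \<ge> 0"
      using L(1)[of n] zero_le_power[of "4::real" n] by linarith
    have "norm (J (S (t n) (z - x (Suc n)))) \<le> L n * norm (J (z - x (Suc n)))"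
      by (rule L(2)) (simp add: X_diff z xX)
    also have "\<dots> \<le> L n * (3 / 2 * (1/3) ^ Suc n)"
      by (rule mult_left_mono[OF near Lpos])
    finally have 1: "norm (J (S (t n) (z - x (Suc n)))) \<le> (1/3) ^ n * (1 / 2 * L n)"
      by (simp add: algebra_simps)
    have "J (S (t n) z) = J (S (t n) (x (Suc n))) + J (S (t n) (z - x (Suc n)))"
      by (simp add: S_diff t z xX J_diff S_mem)
    then have "norm (J (S (t n) z)) \<ge> norm (J (S (t n) (x (Suc n)))) - norm (J (S (t n) (z - x (Suc n))))"
      using norm_diff_ineq[of "J (S (t n) (x (Suc n)))" "J (S (t n) (z - x (Suc n)))"] by simp
    also have "norm (J (S (t n) (x (Suc n)))) - norm (J (S (t n) (z - x (Suc n)))) \<ge> (1/3) ^ n * (1 / 6 * L n)"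
      using big[of n] 1 by (simp add: algebra_simps)
    also have "(1/3) ^ n * (1 / 6 * L n) \<ge> (1/3) ^ n * (1 / 6 * 4 ^ n)"
      using L(1)[of n] by (intro mult_left_mono) auto
    also have "(1/3) ^ n * (1 / 6 * 4 ^ n) = 1 / 6 * (4/3 :: real) ^ n"
      by (simp add: power_divide)
    finally show ?thesis .
  qed
  \<comment> \<open>Strong continuity at \<open>z\<close> bounds the images for small times, against
    the growth along \<open>t n\<close>.\<close>
  obtain d where d: "d > 0" "\<And>h. 0 \<le> h \<Longrightarrow> h < d \<Longrightarrow> norm (J (S h z - z)) < 1"
    using S_J_cont[OF z(1), of 1] by auto
  obtain n1 where n1: "1 / real (Suc n1) < d"
    using d(1) nat_approx_posE by blast
  obtain n2 where n2: "6 * (norm (J z) + 1) < (4/3 :: real) ^ n2"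
    using real_arch_pow[of "4/3 :: real"] by auto
  define n where "n = max n1 n2"
  have "t n \<le> 1 / real (Suc n)"
    by (rule t)
  also have "\<dots> \<le> 1 / real (Suc n1)"
    by (rule divide_left_mono) (auto simp: n_def)
  finally have "norm (J (S (t n) z - z)) < 1"
    using n1 t(1)[of n] d(2)[of "t n"] by simp
  then have "norm (J (S (t n) z)) < norm (J z) + 1"
    using norm_triangle_ineq2[of "J (S (t n) z)" "J z"] by (simp add: J_diff S_mem t z)
  moreover have "(4/3 :: real) ^ n2 \<le> (4/3) ^ n"
    by (rule power_increasing) (auto simp: n_def)
  ultimately show False
  proof -
    assume a: "norm (J (S (t n) z)) < norm (J z) + 1" "(4/3 :: real) ^ n2 \<le> (4/3) ^ n"
    have "(4/3) ^ n \<le> 6 * norm (J (S (t n) z))"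
      using low[of n] by simp
    also have "\<dots> < 6 * (norm (J z) + 1)"
      using a(1) by simp
    also note n2
    finally show False
      using a(2) by simp
  qed
qed

text \<open>Cut the time into steps of length at most \<open>d\<close> and multiply the bounds of
  the steps.\<close>

lemma S_bounded_upto:
  "\<exists>M>0. \<forall>t. 0 \<le> t \<longrightarrow> t \<le> T \<longrightarrow> (\<forall>U\<in>X. norm (J (S t U)) \<le> M * norm (J U))"
proof -
  obtain d M where d: "d > 0" and M: "M > 0"
    and dM: "\<And>t U. 0 \<le> t \<Longrightarrow> t \<le> d \<Longrightarrow> U \<in> X \<Longrightarrow> norm (J (S t U)) \<le> M * norm (J U)"
    using S_bounded_near_0 by blast
  have "norm (J (S t U)) \<le> (max 1 M) ^ Suc n * norm (J U)"
    if "0 \<le> t" "t \<le> real (Suc n) * d" "U \<in> X" for n t U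
    using that
  proof (induction n arbitrary: t)
    case 0
    then have "norm (J (S t U)) \<le> M * norm (J U)"
      by (intro dM) auto
    also have "\<dots> \<le> max 1 M * norm (J U)"
      by (intro mult_right_mono) auto
    finally show ?case
      by simp
  next
    case (Suc n)
    define s where "s = min t d"
    have s: "0 \<le> s" "s \<le> d" "0 \<le> t - s" "t - s \<le> real (Suc n) * d"
      using Suc.prems d by (auto simp: s_def min_def algebra_simps)
    have "S t U = S s (S (t - s) U)"
      using S_semigroup[of s "t - s" U] s Suc.prems by simp
    then have "norm (J (S t U)) \<le> M * norm (J (S (t - s) U))"
      using dM[of s "S (t - s) U"] s S_mem[of "t - s" U] Suc.prems by simp
    also have "\<dots> \<le> max 1 M * ((max 1 M) ^ Suc n * norm (J U))"
      using Suc.IH[OF s(3,4)] Suc.prems M by (intro mult_mono) auto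
    finally show ?case
      by (simp add: mult.assoc)
  qed
  moreover obtain n where "T / d \<le> real n"
    using real_arch_simple by blast
  then have "T \<le> real (Suc n) * d"
    using d by (simp add: field_simps)
  ultimately show ?thesis
    by (intro exI[of _ "(max 1 M) ^ Suc n"]) (auto intro: order_trans)
qed

section \<open>Regularity of orbits\<close>

lemma orbit_diff_bound:
  assumes K: "bounded_on K C" "C \<ge> 0" and U: "U \<in> X" and V: "V \<in> X"
    and t: "0 \<le> t"
    and M: "\<And>U. U \<in> X \<Longrightarrow> norm (J (S t U)) \<le> M * norm (J U)"
  shows "norm (K (S t U) - K (S t V)) \<le> C * (M * norm (J (U - V)))"
proof -
  have "norm (K (S t U) - K (S t V)) = norm (K (S t (U - V)))"
    using bounded_on_diff[OF K(1), of "S t U" "S t V"] by (simp add: S_diff S_mem U V t)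
  also have "\<dots> \<le> C * norm (J (S t (U - V)))"
    by (intro bounded_onD(3)[OF K(1)] S_mem t X_diff U V)
  also have "\<dots> \<le> C * (M * norm (J (U - V)))"
    by (intro mult_left_mono M K X_diff U V)
  finally show ?thesis .
qed

text \<open>Right continuity at 0 gives continuity from both sides at t: the difference of two orbit
  points is the semigroup at the earlier time applied to S h U - U, and the semigroup is uniformly
  bounded on [0, t + 1].\<close>

lemma orbit_continuous:
  assumes K: "bounded_on K C" "C \<ge> 0" and U: "U \<in> X"
  shows "continuous_on {0..} (\<lambda>t. K (S t U))"
  unfolding continuous_on_iff
proof (intro ballI allI impI)
  fix t e :: real assume t: "t \<in> {0..}" and e: "e > 0"
  obtain M where M: "M > 0"
      "\<And>s U. 0 \<le> s \<Longrightarrow> s \<le> t + 1 \<Longrightarrow> U \<in> X \<Longrightarrow> norm (J (S s U)) \<le> M * norm (J U)"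
    using S_bounded_upto[of "t + 1"] by blast
  have pos: "C * M + 1 > 0"
    using M K by (simp add: add_nonneg_pos)
  then obtain d where d: "d > 0" "\<And>h. 0 \<le> h \<Longrightarrow> h < d \<Longrightarrow> norm (J (S h U - U)) < e / (C * M + 1)"
    using S_J_cont[OF U, of "e / (C * M + 1)"] e by auto
  have *: "norm (K (S r U) - K (S s U)) < e" if "0 \<le> s" "s \<le> r" "s \<le> t + 1" "r - s < d" for r s
  proof -
    have "S r U = S s (S (r - s) U)"
      using S_semigroup[of s "r - s" U] that U by simp
    then have "norm (K (S r U) - K (S s U)) \<le> C * (M * norm (J (S (r - s) U - U)))"
      using that U by (simp add: orbit_diff_bound[OF K] S_mem M(2))
    also have "\<dots> \<le> C * (M * (e / (C * M + 1)))"
      using d(2)[of "r - s"] that M(1) K(2) by (intro mult_left_mono) auto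
    also have "\<dots> < e"
      using pos e by (simp add: field_simps)
    finally show ?thesis .
  qed
  show "\<exists>d>0. \<forall>s\<in>{0..}. dist s t < d \<longrightarrow> dist (K (S s U)) (K (S t U)) < e"
  proof (intro exI[of _ "min d 1"] conjI ballI impI)
    fix s :: real assume "s \<in> {0..}" "dist s t < min d 1"
    then show "dist (K (S s U)) (K (S t U)) < e"
      using *[of s t] *[of t s] t by (cases "s \<le> t") (auto simp: dist_norm norm_minus_commute)
  qed (use d in auto)
qed

text \<open>The generator provides only a right derivative at 0. To the left of t the quotient is
  based at the earlier time y and yields K (S y V), which continuity of the orbit of
  \<open>V\<close> moves to time t.\<close>

lemma orbit_derivative:
  assumes K: "bounded_on K C" "C \<ge> 0" and UV: "(U, V) \<in> generator_graph X N S" and t: "t > 0"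
  shows "((\<lambda>s. K (S s U)) has_vector_derivative K (S t V)) (at t)"
  unfolding has_vector_derivative_def has_derivative_at_alt
proof (intro conjI allI impI)
  show "bounded_linear (\<lambda>h. h *\<^sub>R K (S t V))"
    by (rule bounded_linear_scaleR_left)
  fix e :: real assume e: "e > 0"
  have U: "U \<in> X" and V: "V \<in> X"
    and gen: "((\<lambda>t. N ((S t U - U) /\<^sub>R t - V)) \<longlongrightarrow> 0) (at_right 0)"
    using UV by (auto simp: generator_graph_def)
  obtain M where M: "M > 0"
      "\<And>s U. 0 \<le> s \<Longrightarrow> s \<le> t + 1 \<Longrightarrow> U \<in> X \<Longrightarrow> norm (J (S s U)) \<le> M * norm (J U)"
    using S_bounded_upto[of "t + 1"] by blast
  \<comment> \<open>Scaled so that the quotient error costs at most e / 2; the other half is kept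
    for the continuity of the orbit of \<open>V\<close>.\<close>
  define e' where "e' = e / (2 * (C * M + 1))"
  have pos: "C * M + 1 > 0"
    using M K by (simp add: add_nonneg_pos)
  then have e': "e' > 0"
    using e by (simp add: e'_def)
  have CMe: "C * (M * e') \<le> e / 2"
    using pos e by (simp add: e'_def field_simps)
  have "eventually (\<lambda>t. \<bar>N ((S t U - U) /\<^sub>R t - V)\<bar> < e') (at_right 0)"
    using gen e' by (auto dest: tendstoD simp: dist_real_def)
  then obtain d1 where d1: "d1 > 0" "\<And>h. 0 < h \<Longrightarrow> h < d1 \<Longrightarrow> \<bar>N ((S h U - U) /\<^sub>R h - V)\<bar> < e'"
    unfolding eventually_at_right_field by auto
  have quot: "norm (J (S h U - (U + h *\<^sub>R V))) \<le> h * e'" if "0 < h" "h < d1" for h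
  proof -
    let ?Q = "(S h U - U) /\<^sub>R h - V"
    have Q: "?Q \<in> X"
      using that by (intro X_diff X_scaleR S_mem U V) auto
    have "S h U - (U + h *\<^sub>R V) = h *\<^sub>R ?Q"
      using that by (simp add: scaleR_diff_right)
    then have "norm (J (S h U - (U + h *\<^sub>R V))) = h * norm (J ?Q)"
      using that by (simp only: J_scaleR[OF Q]) simp
    also have "\<dots> \<le> h * e'"
      using d1(2)[OF that] that N_eq[OF Q] by (intro mult_left_mono) auto
    finally show ?thesis .
  qed
  have cont: "continuous_on {0..} (\<lambda>t. K (S t V))"
    by (rule orbit_continuous[OF K V])
  obtain d2 where d2: "d2 > 0" "\<And>s. s \<ge> 0 \<Longrightarrow> dist s t < d2 \<Longrightarrow> dist (K (S s V)) (K (S t V)) < e / 2"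
    using cont t e unfolding continuous_on_iff by (metis atLeast_iff half_gt_zero less_imp_le)
  have core: "norm (K (S (s + h) U) - K (S s U) - h *\<^sub>R K (S s V)) \<le> h * (e / 2)"
    if "0 \<le> s" "s \<le> t + 1" "0 < h" "h < d1" for s h
  proof -
    have Y: "U + h *\<^sub>R V \<in> X" "S h U \<in> X"
      using that by (auto intro: X_add X_scaleR U V S_mem)
    have "K (S s (U + h *\<^sub>R V)) = K (S s U) + h *\<^sub>R K (S s V)"
      using that by (simp add: S_add S_scaleR U V X_scaleR bounded_onD(1,2)[OF K(1)] S_mem)
    moreover have "S (s + h) U = S s (S h U)"
      using S_semigroup[of s h U] that U by simp
    ultimately have "norm (K (S (s + h) U) - K (S s U) - h *\<^sub>R K (S s V))
        = norm (K (S s (S h U)) - K (S s (U + h *\<^sub>R V)))"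
      by (simp add: algebra_simps)
    also have "\<dots> \<le> C * (M * norm (J (S h U - (U + h *\<^sub>R V))))"
      using that Y by (intro orbit_diff_bound[OF K] M(2)) auto
    also have "\<dots> \<le> C * (M * (h * e'))"
      using quot that M(1) K(2) by (intro mult_left_mono) auto
    also have "\<dots> = h * (C * (M * e'))"
      by simp
    also have "\<dots> \<le> h * (e / 2)"
      using CMe that by (intro mult_left_mono) auto
    finally show ?thesis .
  qed
  show "\<exists>d>0. \<forall>y. norm (y - t) < d \<longrightarrow>
      norm (K (S y U) - K (S t U) - (y - t) *\<^sub>R K (S t V)) \<le> e * norm (y - t)"
  proof (intro exI[of _ "min (min d1 d2) (min 1 t)"] conjI allI impI)
    fix y assume y: "norm (y - t) < min (min d1 d2) (min 1 t)"
    consider "y = t" | "y > t" | "y < t" by linarith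
    then show "norm (K (S y U) - K (S t U) - (y - t) *\<^sub>R K (S t V)) \<le> e * norm (y - t)"
    proof cases
      case 1
      then show ?thesis by simp
    next
      case 2
      have "norm (K (S (t + (y - t)) U) - K (S t U) - (y - t) *\<^sub>R K (S t V)) \<le> (y - t) * (e / 2)"
        by (rule core) (use y 2 t in auto)
      also have "\<dots> \<le> e * norm (y - t)"
        using 2 e by simp
      finally show ?thesis by simp
    next
      case 3
      define h where "h = t - y"
      have h: "0 < h" "h < d1" "y \<ge> 0" "y \<le> t + 1" "t = y + h" "dist y t < d2"
        using 3 y by (auto simp: h_def dist_real_def)
      have a: "norm (K (S t U) - K (S y U) - h *\<^sub>R K (S y V)) \<le> h * (e / 2)"
        using core[of y h] h by simp
      have b: "norm (h *\<^sub>R (K (S y V) - K (S t V))) \<le> h * (e / 2)"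
        using d2(2)[of y] h by (simp add: dist_norm)
      have "K (S y U) - K (S t U) - (y - t) *\<^sub>R K (S t V)
          = - ((K (S t U) - K (S y U) - h *\<^sub>R K (S y V)) + h *\<^sub>R (K (S y V) - K (S t V)))"
        by (simp add: h_def algebra_simps)
      then have "norm (K (S y U) - K (S t U) - (y - t) *\<^sub>R K (S t V))
          \<le> norm (K (S t U) - K (S y U) - h *\<^sub>R K (S y V)) + norm (h *\<^sub>R (K (S y V) - K (S t V)))"
        by (simp only: norm_minus_cancel norm_triangle_ineq)
      also have "\<dots> \<le> h * (e / 2) + h * (e / 2)"
        by (rule add_mono[OF a b])
      also have "\<dots> = e * norm (y - t)"
        using 3 by (simp add: h_def)
      finally show ?thesis .
    qed
  qed (use d1 d2 t in auto)
qed

text \<open>\<open>S t\<close> is bounded and commutes with the difference quotients at 0.\<close>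

lemma generator_invariant:
  assumes UV: "(U, V) \<in> generator_graph X N S" and t: "t \<ge> 0"
  shows "(S t U, S t V) \<in> generator_graph X N S"
proof -
  have U: "U \<in> X" and V: "V \<in> X"
    and gen: "((\<lambda>t. N ((S t U - U) /\<^sub>R t - V)) \<longlongrightarrow> 0) (at_right 0)"
    using UV by (auto simp: generator_graph_def)
  obtain C where C: "\<And>U. U \<in> X \<Longrightarrow> N (S t U) \<le> C * N U"
    using S_bounded[OF t] by blast
  have lim: "((\<lambda>h. C * N ((S h U - U) /\<^sub>R h - V)) \<longlongrightarrow> C * 0) (at_right 0)"
    by (intro tendsto_intros gen)
  have pos: "eventually (\<lambda>h. h > (0::real)) (at_right 0)"
    by (rule eventually_at_right_less)
  have "((\<lambda>h. N ((S h (S t U) - S t U) /\<^sub>R h - S t V)) \<longlongrightarrow> 0) (at_right 0)"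
  proof (rule tendsto_sandwich[OF _ _ tendsto_const])
    show "\<forall>\<^sub>F h in at_right 0. 0 \<le> N ((S h (S t U) - S t U) /\<^sub>R h - S t V)"
      using pos by eventually_elim (simp add: N_eq X_diff X_scaleR S_mem U V t)
    show "\<forall>\<^sub>F h in at_right 0. N ((S h (S t U) - S t U) /\<^sub>R h - S t V) \<le> C * N ((S h U - U) /\<^sub>R h - V)"
      using pos
    proof eventually_elim
      case (elim h)
      have "S h (S t U) = S t (S h U)"
        using S_semigroup[of h t U] S_semigroup[of t h U] elim t U by (simp add: add.commute)
      then have "(S h (S t U) - S t U) /\<^sub>R h - S t V = S t ((S h U - U) /\<^sub>R h - V)"
        using elim t U V by (simp add: S_diff S_scaleR X_diff X_scaleR S_mem)
      then show ?case
        using C[of "(S h U - U) /\<^sub>R h - V"] elim by (simp add: X_diff X_scaleR S_mem U V)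
    qed
    show "((\<lambda>h. C * N ((S h U - U) /\<^sub>R h - V)) \<longlongrightarrow> 0) (at_right 0)"
      using lim by simp
  qed
  then show ?thesis
    using U V t by (simp add: generator_graph_def S_mem)
qed

text \<open>\<open>J\<close> measures the energy, and the inner product of \<open>K1\<close> and
  \<open>K2\<close> is the multiplier; \<open>energy\<close> and \<open>cross\<close> bound their
  derivatives along orbits. One small weight on the multiplier serves both the decay of the sum and
  its equivalence with the energy.\<close>

theorem lyapunov_exponential_stability:
  fixes K1 K2 :: "'a \<Rightarrow> 'c::real_inner"
  assumes graph: "generator_graph X N S = {(U, B U) | U. U \<in> D}"
    and dense: "\<And>U e. U \<in> X \<Longrightarrow> e > 0 \<Longrightarrow> \<exists>V\<in>D. norm (J (U - V)) < e"
    and K1: "bounded_on K1 C1" "C1 \<ge> 0" and K2: "bounded_on K2 C2" "C2 \<ge> 0"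
    and d_nonneg: "\<And>U. U \<in> D \<Longrightarrow> d U \<ge> 0"
    and energy: "\<And>U. U \<in> D \<Longrightarrow> inner (J U) (J (B U)) \<le> - d U"
    and cross: "\<And>U. U \<in> D \<Longrightarrow>
      inner (K1 U) (K2 (B U)) + inner (K1 (B U)) (K2 U) \<le> - c * (norm (J U))\<^sup>2 + C * d U"
    and c: "c > 0"
  shows "\<exists>M\<ge>1. \<exists>\<omega>>0. \<forall>t\<ge>0. op_norm X N (S t) \<le> M * exp (- \<omega> * t)"
proof -
  \<comment> \<open>Small enough for two purposes: the dissipation absorbs
    \<open>\<epsilon> * C * d U\<close>, and the multiplier term stays within a quarter of the
    squared norm.\<close>
  define \<epsilon> where "\<epsilon> = 1 / (1 + \<bar>C\<bar> + 4 * C1 * C2)"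
  have den: "1 + \<bar>C\<bar> + 4 * C1 * C2 > 0"
    using K1(2) K2(2) by (simp add: add_pos_nonneg)
  have \<epsilon>: "\<epsilon> > 0"
    using den by (simp add: \<epsilon>_def)
  have \<epsilon>C: "\<epsilon> * C \<le> 1"
    using den K1(2) K2(2) by (simp add: \<epsilon>_def field_simps) (smt (verit) mult_nonneg_nonneg)
  have \<epsilon>K: "\<epsilon> * (C1 * C2) \<le> 1 / 4"
    using den by (simp add: \<epsilon>_def field_simps)
  define \<Phi> where "\<Phi> U = 1 / 2 * (norm (J U))\<^sup>2 + \<epsilon> * inner (K1 U) (K2 U)" for U
  have cross_bound: "\<bar>\<epsilon> * inner (K1 U) (K2 U)\<bar> \<le> 1 / 4 * (norm (J U))\<^sup>2" if U: "U \<in> X" for U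
  proof -
    have "\<bar>inner (K1 U) (K2 U)\<bar> \<le> norm (K1 U) * norm (K2 U)"
      by (rule Cauchy_Schwarz_ineq2)
    also have "\<dots> \<le> (C1 * norm (J U)) * (C2 * norm (J U))"
      using bounded_onD(3)[OF K1(1) U] bounded_onD(3)[OF K2(1) U] K1(2) by (intro mult_mono) auto
    finally have "\<epsilon> * \<bar>inner (K1 U) (K2 U)\<bar> \<le> \<epsilon> * ((C1 * norm (J U)) * (C2 * norm (J U)))"
      using \<epsilon> by (intro mult_left_mono) auto
    also have "\<dots> = \<epsilon> * (C1 * C2) * (norm (J U))\<^sup>2"
      by (simp add: power2_eq_square)
    also have "\<dots> \<le> 1 / 4 * (norm (J U))\<^sup>2"
      by (intro mult_right_mono \<epsilon>K) simp
    finally show ?thesis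
      using \<epsilon> by (simp add: abs_mult)
  qed
  \<comment> \<open>\<open>\<Phi>\<close> is quadratic in the norm and decays at rate
    \<open>\<epsilon> * c\<close>, so the norm decays at half that rate.\<close>
  define \<omega> where "\<omega> = \<epsilon> * c / 2"
  have \<omega>: "\<omega> > 0"
    using \<epsilon> c by (simp add: \<omega>_def)
  \<comment> \<open>The factor 2 is the root of 4, from |J U|^2 / 4 <= \<Phi> U <= |J U|^2.\<close>
  have decayD: "norm (J (S t U)) \<le> 2 * exp (- \<omega> * t) * norm (J U)" if U: "U \<in> D" and t: "t \<ge> 0" for U t
  proof -
    have UB: "(U, B U) \<in> generator_graph X N S"
      using graph U by auto
    then have UX: "U \<in> X" "B U \<in> X"
      by (auto simp: generator_graph_def)
    have inv: "S s U \<in> D" "S s (B U) = B (S s U)" if "s \<ge> 0" for s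
      using generator_invariant[OF UB that] graph by auto
    define g' where "g' s = inner (J (S s U)) (J (S s (B U)))
        + \<epsilon> * (inner (K1 (S s U)) (K2 (S s (B U))) + inner (K1 (S s (B U))) (K2 (S s U)))" for s
    note one = zero_le_one[where 'a = real]
    have "\<Phi> (S t U) \<le> exp (- (\<epsilon> * c) * t) * \<Phi> (S 0 U)"
    proof (rule decay_differential_inequality[where g' = g'])
      show "continuous_on {0..} (\<lambda>s. \<Phi> (S s U))"
        unfolding \<Phi>_def
        by (intro continuous_intros orbit_continuous[OF bounded_on_J one] orbit_continuous[OF K1]
            orbit_continuous[OF K2] UX)
      fix s :: real assume s: "s > 0"
      have dJ: "((\<lambda>s. J (S s U)) has_derivative (\<lambda>h. h *\<^sub>R J (S s (B U)))) (at s)"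
        using orbit_derivative[OF bounded_on_J one UB s] by (simp add: has_vector_derivative_def)
      have d1: "((\<lambda>s. K1 (S s U)) has_derivative (\<lambda>h. h *\<^sub>R K1 (S s (B U)))) (at s)"
        using orbit_derivative[OF K1 UB s] by (simp add: has_vector_derivative_def)
      have d2: "((\<lambda>s. K2 (S s U)) has_derivative (\<lambda>h. h *\<^sub>R K2 (S s (B U)))) (at s)"
        using orbit_derivative[OF K2 UB s] by (simp add: has_vector_derivative_def)
      show "((\<lambda>s. \<Phi> (S s U)) has_real_derivative g' s) (at s)"
        unfolding \<Phi>_def power2_norm_eq_inner has_field_derivative_def
        by (rule derivative_eq_intros dJ d1 d2 refl)+
          (auto simp: g'_def inner_commute algebra_simps fun_eq_iff)
      have sD: "S s U \<in> D" "S s (B U) = B (S s U)" "S s U \<in> X"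
        using inv[of s] s S_mem[OF _ UX(1)] by auto
      have "g' s \<le> - d (S s U) + \<epsilon> * (- c * (norm (J (S s U)))\<^sup>2 + C * d (S s U))"
        unfolding g'_def sD(2)
        by (intro add_mono energy[OF sD(1)] mult_left_mono cross[OF sD(1)]) (use \<epsilon> in simp)
      also have "\<dots> = (\<epsilon> * C - 1) * d (S s U) - \<epsilon> * c * (norm (J (S s U)))\<^sup>2"
        by (simp add: algebra_simps)
      also have "\<dots> \<le> - (\<epsilon> * c) * (norm (J (S s U)))\<^sup>2"
        using \<epsilon>C d_nonneg[OF sD(1)] by (simp add: mult_nonpos_nonneg)
      also have "\<dots> \<le> - (\<epsilon> * c) * \<Phi> (S s U)"
      proof (rule mult_left_mono_neg)
        show "\<Phi> (S s U) \<le> (norm (J (S s U)))\<^sup>2"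
          using cross_bound[OF sD(3)] zero_le_power2[of "norm (J (S s U))"] unfolding \<Phi>_def by linarith
        show "- (\<epsilon> * c) \<le> 0"
          using \<epsilon> c by simp
      qed
      finally show "g' s \<le> - (\<epsilon> * c) * \<Phi> (S s U)" .
    qed (use t in auto)
    moreover have "1 / 4 * (norm (J (S t U)))\<^sup>2 \<le> \<Phi> (S t U)"
      using cross_bound[OF S_mem[OF t UX(1)]] unfolding \<Phi>_def by linarith
    moreover have "\<Phi> (S 0 U) \<le> (norm (J U))\<^sup>2"
      using cross_bound[OF UX(1)] zero_le_power2[of "norm (J U)"] unfolding \<Phi>_def S_0[OF UX(1)] by linarith
    then have "exp (- (\<epsilon> * c) * t) * \<Phi> (S 0 U) \<le> exp (- (\<epsilon> * c) * t) * (norm (J U))\<^sup>2"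
      by (intro mult_left_mono) auto
    ultimately have "(norm (J (S t U)))\<^sup>2 \<le> 4 * (exp (- (\<epsilon> * c) * t) * (norm (J U))\<^sup>2)"
      by linarith
    also have "exp (- (\<epsilon> * c) * t) = (exp (- \<omega> * t))\<^sup>2"
      by (simp add: \<omega>_def power2_eq_square mult_exp_exp)
    also have "4 * ((exp (- \<omega> * t))\<^sup>2 * (norm (J U))\<^sup>2) = (2 * exp (- \<omega> * t) * norm (J U))\<^sup>2"
      by (simp add: power_mult_distrib)
    finally show ?thesis
      by (rule power2_le_imp_le) simp
  qed
  \<comment> \<open>For each fixed time the bound passes from \<open>D\<close> to \<open>X\<close>
    by density and boundedness of \<open>S t\<close>; the bound \<open>C\<close> may depend on t
    because e is arbitrary.\<close>
  have decay: "norm (J (S t U)) \<le> 2 * exp (- \<omega> * t) * norm (J U)" if U: "U \<in> X" and t: "t \<ge> 0" for U t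
  proof (rule field_le_epsilon)
    fix e :: real assume e: "e > 0"
    obtain C where C: "\<And>W. W \<in> X \<Longrightarrow> norm (J (S t W)) \<le> C * norm (J W)"
      using S_J_bounded[OF t] by blast
    define E where "E = 2 * exp (- \<omega> * t)"
    have E: "E > 0" by (simp add: E_def)
    have den: "\<bar>C\<bar> + E + 1 > 0"
      using E by simp
    then obtain V where V: "V \<in> D" "norm (J (U - V)) < e / (\<bar>C\<bar> + E + 1)"
      using dense[OF U, of "e / (\<bar>C\<bar> + E + 1)"] e by auto
    have "(V, B V) \<in> generator_graph X N S"
      using graph V(1) by blast
    then have VX: "V \<in> X"
      by (simp add: generator_graph_def)
    have "J (S t U) = J (S t (U - V)) + J (S t V)"
      by (simp add: S_diff J_diff S_mem U VX t)
    then have "norm (J (S t U)) \<le> norm (J (S t (U - V))) + norm (J (S t V))"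
      by (simp add: norm_triangle_ineq)
    also have "\<dots> \<le> \<bar>C\<bar> * norm (J (U - V)) + E * norm (J V)"
    proof (rule add_mono)
      have "norm (J (S t (U - V))) \<le> C * norm (J (U - V))"
        by (intro C X_diff U VX)
      also have "\<dots> \<le> \<bar>C\<bar> * norm (J (U - V))"
        by (intro mult_right_mono) auto
      finally show "norm (J (S t (U - V))) \<le> \<bar>C\<bar> * norm (J (U - V))" .
      show "norm (J (S t V)) \<le> E * norm (J V)"
        using decayD[OF V(1) t] by (simp add: E_def)
    qed
    also have "\<dots> \<le> \<bar>C\<bar> * norm (J (U - V)) + E * (norm (J U) + norm (J (U - V)))"
      using norm_triangle_sub[of "J V" "J U"] E
      by (intro add_left_mono mult_left_mono) (auto simp: J_diff U VX norm_minus_commute)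
    also have "\<dots> = E * norm (J U) + (\<bar>C\<bar> + E) * norm (J (U - V))"
      by (simp add: algebra_simps)
    also have "(\<bar>C\<bar> + E) * norm (J (U - V)) \<le> (\<bar>C\<bar> + E + 1) * norm (J (U - V))"
      by (intro mult_right_mono) auto
    also have "\<dots> \<le> e"
      using V(2) den by (simp add: field_simps)
    finally show "norm (J (S t U)) \<le> 2 * exp (- \<omega> * t) * norm (J U) + e"
      by (simp add: E_def)
  qed
  have "op_norm X N (S t) \<le> 2 * exp (- \<omega> * t)" if t: "t \<ge> 0" for t
    unfolding op_norm_def
  proof (rule cSUP_least)
    \<comment> \<open>The supremum in \<open>op_norm\<close> is taken over a nonempty set because it
      contains 0.\<close>
    have "J 0 = 0"
      using J_scaleR[OF X_zero, of 0] by simp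
    then show "{U \<in> X. N U \<le> 1} \<noteq> {}"
      using X_zero N_eq[OF X_zero] by auto
    fix U assume "U \<in> {U \<in> X. N U \<le> 1}"
    then have U: "U \<in> X" "norm (J U) \<le> 1"
      by (auto simp: N_eq)
    have "norm (J (S t U)) \<le> 2 * exp (- \<omega> * t) * norm (J U)"
      by (rule decay[OF U(1) t])
    also have "\<dots> \<le> 2 * exp (- \<omega> * t) * 1"
      using U(2) by (intro mult_left_mono) auto
    finally show "N (S t U) \<le> 2 * exp (- \<omega> * t)"
      by (simp add: N_eq S_mem t U)
  qed
  then show ?thesis
    using \<omega> by (intro exI[of _ 2]) auto
qed

end

section \<open>The phase space\<close>

abbreviation (input) "cu U \<equiv> fst U"
abbreviation (input) "cu' U \<equiv> fst (snd U)"
abbreviation (input) "cv U \<equiv> fst (snd (snd U))"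
abbreviation (input) "cv' U \<equiv> fst (snd (snd (snd U)))"
abbreviation (input) "cy U \<equiv> fst (snd (snd (snd (snd U))))"
abbreviation (input) "cy' U \<equiv> fst (snd (snd (snd (snd (snd U)))))"
abbreviation (input) "cz U \<equiv> fst (snd (snd (snd (snd (snd (snd U))))))"
abbreviation (input) "cz' U \<equiv> snd (snd (snd (snd (snd (snd (snd U))))))"

locale double_beam =
  fixes l m b\<^sub>1 b\<^sub>2 \<kappa>\<^sub>1 \<kappa>\<^sub>2 \<rho>\<^sub>1 \<rho>\<^sub>2 \<rho>\<^sub>3 \<rho>\<^sub>4 :: real
  assumes pos: "l > 0" "m > 0" "b\<^sub>1 > 0" "b\<^sub>2 > 0" "\<kappa>\<^sub>1 > 0" "\<kappa>\<^sub>2 > 0"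
    "\<rho>\<^sub>1 > 0" "\<rho>\<^sub>2 > 0" "\<rho>\<^sub>3 > 0" "\<rho>\<^sub>4 > 0"
begin

text \<open>One component per term of \<open>phase_norm\<close>, with the square roots of the
  weights as factors. The derivatives of \<open>v\<close> and \<open>z\<close> stand in for their
  images under the square root of \<open>opA_star\<close>, which have the same norms.\<close>

definition J :: "state \<Rightarrow> L2 \<times> L2 \<times> L2 \<times> L2 \<times> L2 \<times> L2 \<times> L2 \<times> L2 \<times> L2" where
  "J U = (sqrt \<rho>\<^sub>1 *\<^sub>R cu' U, sqrt \<rho>\<^sub>2 *\<^sub>R cv' U, sqrt \<rho>\<^sub>3 *\<^sub>R cy' U, sqrt \<rho>\<^sub>4 *\<^sub>R cz' U,
     sqrt \<kappa>\<^sub>1 *\<^sub>R (weak_deriv l (cu U) - cv U), sqrt \<kappa>\<^sub>2 *\<^sub>R (weak_deriv l (cy U) - cz U),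
     sqrt m *\<^sub>R (cy U - cu U), sqrt b\<^sub>1 *\<^sub>R weak_deriv l (cv U), sqrt b\<^sub>2 *\<^sub>R weak_deriv l (cz U))"

lemma phase_space_iff: "U \<in> phase_space l \<longleftrightarrow>
    cu U \<in> H1_0 l \<and> cu' U \<in> L2_on l \<and> cv U \<in> H1_star l \<and> cv' U \<in> L2_star l \<and>
    cy U \<in> H1_0 l \<and> cy' U \<in> L2_on l \<and> cz U \<in> H1_star l \<and> cz' U \<in> L2_star l"
  by (simp add: phase_space_def mem_Times_iff)

lemma phase_space_H1:
  assumes "U \<in> phase_space l"
  shows "cu U \<in> H1 l" "cv U \<in> H1 l" "cy U \<in> H1 l" "cz U \<in> H1 l"
  using assms H1_0D(1)[OF pos(1)] H1_star_D(1)[OF pos(1)] by (auto simp: phase_space_iff)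

lemma J_inner: "inner (J U) (J V) =
    \<rho>\<^sub>1 * inner (cu' U) (cu' V) + \<rho>\<^sub>2 * inner (cv' U) (cv' V)
    + \<rho>\<^sub>3 * inner (cy' U) (cy' V) + \<rho>\<^sub>4 * inner (cz' U) (cz' V)
    + \<kappa>\<^sub>1 * inner (weak_deriv l (cu U) - cv U) (weak_deriv l (cu V) - cv V)
    + \<kappa>\<^sub>2 * inner (weak_deriv l (cy U) - cz U) (weak_deriv l (cy V) - cz V)
    + m * inner (cy U - cu U) (cy V - cu V)
    + b\<^sub>1 * inner (weak_deriv l (cv U)) (weak_deriv l (cv V))
    + b\<^sub>2 * inner (weak_deriv l (cz U)) (weak_deriv l (cz V))"
proof -
  have s: "inner (sqrt r *\<^sub>R f) (sqrt r *\<^sub>R g) = r * inner f g" if "r > 0" for r and f g :: L2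
    using that by (simp add: mult.assoc[symmetric])
  show ?thesis
    unfolding J_def inner_Pair by (simp only: s pos)
qed

lemma J_norm_sq: "(norm (J U))\<^sup>2 =
    \<rho>\<^sub>1 * (norm (cu' U))\<^sup>2 + \<rho>\<^sub>2 * (norm (cv' U))\<^sup>2 + \<rho>\<^sub>3 * (norm (cy' U))\<^sup>2 + \<rho>\<^sub>4 * (norm (cz' U))\<^sup>2
    + \<kappa>\<^sub>1 * (norm (weak_deriv l (cu U) - cv U))\<^sup>2 + \<kappa>\<^sub>2 * (norm (weak_deriv l (cy U) - cz U))\<^sup>2
    + m * (norm (cy U - cu U))\<^sup>2
    + b\<^sub>1 * (norm (weak_deriv l (cv U)))\<^sup>2 + b\<^sub>2 * (norm (weak_deriv l (cz U)))\<^sup>2"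
  unfolding power2_norm_eq_inner by (rule J_inner)

lemma phase_norm_eq:
  assumes "U \<in> phase_space l"
  shows "phase_norm l m b\<^sub>1 b\<^sub>2 \<kappa>\<^sub>1 \<kappa>\<^sub>2 \<rho>\<^sub>1 \<rho>\<^sub>2 \<rho>\<^sub>3 \<rho>\<^sub>4 U = norm (J U)"
proof -
  have "phase_norm l m b\<^sub>1 b\<^sub>2 \<kappa>\<^sub>1 \<kappa>\<^sub>2 \<rho>\<^sub>1 \<rho>\<^sub>2 \<rho>\<^sub>3 \<rho>\<^sub>4 U = sqrt ((norm (J U))\<^sup>2)"
    using assms unfolding J_norm_sq phase_norm_def case_prod_unfold
    by (simp add: A_star_sqrt_norm[OF pos(1)] phase_space_iff)
  then show ?thesis
    by simp
qed

sublocale linear_normed_subspace "phase_space l" J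
proof
  note l = pos(1)
  show "0 \<in> phase_space l"
    by (simp add: phase_space_iff H1_0_zero[OF l] H1_star_zero[OF l] L2_star_props[OF l] L2_on_0)
  fix U V :: state and c r
  assume U: "U \<in> phase_space l"
  note HU = phase_space_H1[OF U]
  show "c *\<^sub>C U \<in> phase_space l"
    using U by (simp add: phase_space_iff scaleC_prod_def H1_0_scaleC[OF l] H1_star_scaleC[OF l]
        L2_star_props[OF l] L2_on_scaleC)
  show "J (r *\<^sub>R U) = r *\<^sub>R J U"
    by (simp add: J_def H1_scaleR[OF l] HU algebra_simps)
  assume V: "V \<in> phase_space l"
  note HV = phase_space_H1[OF V]
  show "U + V \<in> phase_space l"
    using U V by (simp add: phase_space_iff H1_0_add[OF l] H1_star_add[OF l] L2_star_props[OF l] L2_on_add)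
  show "J (U + V) = J U + J V"
    by (simp add: J_def H1_add[OF l] HU HV algebra_simps)
qed

section \<open>Control of all components by the energy norm, and completeness\<close>

lemma bounded_on_component:
  assumes "bounded_on (\<lambda>U. r *\<^sub>R K U) C" "r \<noteq> 0"
  shows "bounded_on K (\<bar>1 / r\<bar> * C)"
  using bounded_on_scaleR[OF assms(1), of "1 / r"] assms(2) by simp

text \<open>The order of the bounds matters: the derivative of \<open>v\<close> is a component of
  \<open>J\<close>, Poincare's inequality gives \<open>v\<close>, adding \<open>v\<close> to the
  shear gives the derivative of \<open>u\<close>, and Poincare's inequality gives \<open>u\<close>.
  The second beam is treated alike.\<close>

lemma bounded_components:
  shows "\<exists>C\<ge>0. bounded_on cu' C" "\<exists>C\<ge>0. bounded_on cv' C" "\<exists>C\<ge>0. bounded_on cy' C" "\<exists>C\<ge>0. bounded_on cz' C"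
    "\<exists>C\<ge>0. bounded_on cu C" "\<exists>C\<ge>0. bounded_on cv C" "\<exists>C\<ge>0. bounded_on cy C" "\<exists>C\<ge>0. bounded_on cz C"
    "\<exists>C\<ge>0. bounded_on (\<lambda>U. weak_deriv l (cu U)) C" "\<exists>C\<ge>0. bounded_on (\<lambda>U. weak_deriv l (cv U)) C"
    "\<exists>C\<ge>0. bounded_on (\<lambda>U. weak_deriv l (cy U)) C" "\<exists>C\<ge>0. bounded_on (\<lambda>U. weak_deriv l (cz U)) C"
proof -
  note l = pos(1)
  note s1 = bounded_on_snd[OF bounded_on_J] note s2 = bounded_on_snd[OF s1] note s3 = bounded_on_snd[OF s2]
  note s4 = bounded_on_snd[OF s3] note s5 = bounded_on_snd[OF s4] note s6 = bounded_on_snd[OF s5]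
  note s7 = bounded_on_snd[OF s6] note s8 = bounded_on_snd[OF s7]
  have proj: "bounded_on (\<lambda>U. sqrt \<rho>\<^sub>1 *\<^sub>R cu' U) 1"
    "bounded_on (\<lambda>U. sqrt \<rho>\<^sub>2 *\<^sub>R cv' U) 1"
    "bounded_on (\<lambda>U. sqrt \<rho>\<^sub>3 *\<^sub>R cy' U) 1"
    "bounded_on (\<lambda>U. sqrt \<rho>\<^sub>4 *\<^sub>R cz' U) 1"
    "bounded_on (\<lambda>U. sqrt \<kappa>\<^sub>1 *\<^sub>R (weak_deriv l (cu U) - cv U)) 1"
    "bounded_on (\<lambda>U. sqrt \<kappa>\<^sub>2 *\<^sub>R (weak_deriv l (cy U) - cz U)) 1"
    "bounded_on (\<lambda>U. sqrt b\<^sub>1 *\<^sub>R weak_deriv l (cv U)) 1"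
    "bounded_on (\<lambda>U. sqrt b\<^sub>2 *\<^sub>R weak_deriv l (cz U)) 1"
    by (rule bounded_on_cong[OF bounded_on_fst[OF bounded_on_J]], simp add: J_def,
      rule bounded_on_cong[OF bounded_on_fst[OF s1]], simp add: J_def,
      rule bounded_on_cong[OF bounded_on_fst[OF s2]], simp add: J_def,
      rule bounded_on_cong[OF bounded_on_fst[OF s3]], simp add: J_def,
      rule bounded_on_cong[OF bounded_on_fst[OF s4]], simp add: J_def,
      rule bounded_on_cong[OF bounded_on_fst[OF s5]], simp add: J_def,
      rule bounded_on_cong[OF bounded_on_fst[OF s7]], simp add: J_def,
      rule bounded_on_cong[OF s8], simp add: J_def)
  have ex: "\<exists>C\<ge>0. bounded_on K C" if "bounded_on (\<lambda>U. sqrt r *\<^sub>R K U) 1" "r > 0" for r and K :: "state \<Rightarrow> L2"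
    using bounded_on_component[OF that(1)] that(2) by (intro exI[of _ "\<bar>1 / sqrt r\<bar> * 1"]) auto
  show "\<exists>C\<ge>0. bounded_on cu' C" "\<exists>C\<ge>0. bounded_on cv' C" "\<exists>C\<ge>0. bounded_on cy' C" "\<exists>C\<ge>0. bounded_on cz' C"
    by (rule ex[OF proj(1) pos(7)], rule ex[OF proj(2) pos(8)], rule ex[OF proj(3) pos(9)], rule ex[OF proj(4) pos(10)])
  show Dv: "\<exists>C\<ge>0. bounded_on (\<lambda>U. weak_deriv l (cv U)) C" and Dz: "\<exists>C\<ge>0. bounded_on (\<lambda>U. weak_deriv l (cz U)) C"
    by (rule ex[OF proj(7) pos(3)], rule ex[OF proj(8) pos(4)])
  have k: "freq l 1 > 0"
    by (rule freq_pos[OF l]) simp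
  have dom: "\<exists>C\<ge>0. bounded_on K C"
    if K: "\<exists>C\<ge>0. bounded_on (\<lambda>U. weak_deriv l (K U)) C" "\<And>U V. K (U + V) = K U + K V" "\<And>U r. K (r *\<^sub>R U) = r *\<^sub>R K U"
      "\<And>U. U \<in> phase_space l \<Longrightarrow> freq l 1 * norm (K U) \<le> norm (weak_deriv l (K U))" for K :: "state \<Rightarrow> L2"
  proof -
    obtain C where C: "C \<ge> 0" "bounded_on (\<lambda>U. weak_deriv l (K U)) C"
      using K(1) by blast
    have "bounded_on K (1 / freq l 1 * C)"
      by (rule bounded_on_dominated[OF C(2)]) (use K k in \<open>auto simp: field_simps\<close>)
    then show ?thesis
      using C(1) k by (intro exI[of _ "1 / freq l 1 * C"]) auto
  qed
  have add: "\<exists>C\<ge>0. bounded_on K' C"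
    if K: "\<exists>C\<ge>0. bounded_on (\<lambda>U. K' U - K U) C" "\<exists>C\<ge>0. bounded_on K C" for K K' :: "state \<Rightarrow> L2"
  proof -
    obtain C C' where "C \<ge> 0" "C' \<ge> 0" "bounded_on (\<lambda>U. K' U - K U) C" "bounded_on K C'"
      using K by blast
    then show ?thesis
      using bounded_on_add[of "\<lambda>U. K' U - K U" C K C'] by (intro exI[of _ "C + C'"]) auto
  qed
  have P: "freq l 1 * norm (cu U) \<le> norm (weak_deriv l (cu U))" "freq l 1 * norm (cv U) \<le> norm (weak_deriv l (cv U))"
    "freq l 1 * norm (cy U) \<le> norm (weak_deriv l (cy U))" "freq l 1 * norm (cz U) \<le> norm (weak_deriv l (cz U))"
    if "U \<in> phase_space l" for U
    using that poincare_H1_0[OF l] poincare_H1_star[OF l] unfolding phase_space_iff by blast+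
  show v: "\<exists>C\<ge>0. bounded_on cv C" and z: "\<exists>C\<ge>0. bounded_on cz C"
    by (rule dom[OF Dv _ _ P(2)]; simp) (rule dom[OF Dz _ _ P(4)]; simp)
  show Du: "\<exists>C\<ge>0. bounded_on (\<lambda>U. weak_deriv l (cu U)) C" and Dy: "\<exists>C\<ge>0. bounded_on (\<lambda>U. weak_deriv l (cy U)) C"
    by (rule add[OF ex[OF proj(5) pos(5)] v], rule add[OF ex[OF proj(6) pos(6)] z])
  show "\<exists>C\<ge>0. bounded_on cu C" "\<exists>C\<ge>0. bounded_on cy C"
    by (rule dom[OF Du _ _ P(1)]; simp) (rule dom[OF Dy _ _ P(3)]; simp)
qed

lemma J_tendsto:
  assumes "(\<lambda>n. cu' (U n)) \<longlonglongrightarrow> cu' W" "(\<lambda>n. cv' (U n)) \<longlonglongrightarrow> cv' W"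
    "(\<lambda>n. cy' (U n)) \<longlonglongrightarrow> cy' W" "(\<lambda>n. cz' (U n)) \<longlonglongrightarrow> cz' W"
    "(\<lambda>n. cu (U n)) \<longlonglongrightarrow> cu W" "(\<lambda>n. cv (U n)) \<longlonglongrightarrow> cv W"
    "(\<lambda>n. cy (U n)) \<longlonglongrightarrow> cy W" "(\<lambda>n. cz (U n)) \<longlonglongrightarrow> cz W"
    "(\<lambda>n. weak_deriv l (cu (U n))) \<longlonglongrightarrow> weak_deriv l (cu W)"
    "(\<lambda>n. weak_deriv l (cv (U n))) \<longlonglongrightarrow> weak_deriv l (cv W)"
    "(\<lambda>n. weak_deriv l (cy (U n))) \<longlonglongrightarrow> weak_deriv l (cy W)"
    "(\<lambda>n. weak_deriv l (cz (U n))) \<longlonglongrightarrow> weak_deriv l (cz W)"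
  shows "(\<lambda>n. J (U n)) \<longlonglongrightarrow> J W"
  unfolding J_def by (intro tendsto_Pair tendsto_scaleR tendsto_const tendsto_diff assms)

text \<open>The twelve maps of \<open>bounded_components\<close> send a Cauchy sequence to
  convergent ones, and closedness of the weak derivative makes the limits fit together.\<close>

lemma complete_J: "complete (J ` phase_space l)"
  unfolding complete_def
proof (intro allI impI, elim conjE)
  note l = pos(1)
  fix f assume mem: "\<forall>n. f n \<in> J ` phase_space l" and c: "Cauchy f"
  have "\<forall>n. \<exists>V. V \<in> phase_space l \<and> f n = J V"
    using mem by blast
  then obtain U where U: "\<And>n. U n \<in> phase_space l" "\<And>n. f n = J (U n)"
    by metis
  then have f: "f = (\<lambda>n. J (U n))"
    by auto
  have conv: "\<exists>L. (\<lambda>n. K (U n)) \<longlonglongrightarrow> L" if K: "\<exists>C\<ge>0. bounded_on K C" for K :: "state \<Rightarrow> L2"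
  proof -
    obtain C where "bounded_on K C"
      using K by blast
    then have "Cauchy (\<lambda>n. K (U n))"
      using U(1) c unfolding f by (rule bounded_on_Cauchy)
    then show ?thesis
      using Cauchy_convergent convergent_def by blast
  qed
  obtain u' where lim1: "(\<lambda>n. cu' (U n)) \<longlonglongrightarrow> u'"
    using conv[OF bounded_components(1)] by blast
  obtain v' where lim2: "(\<lambda>n. cv' (U n)) \<longlonglongrightarrow> v'"
    using conv[OF bounded_components(2)] by blast
  obtain y' where lim3: "(\<lambda>n. cy' (U n)) \<longlonglongrightarrow> y'"
    using conv[OF bounded_components(3)] by blast
  obtain z' where lim4: "(\<lambda>n. cz' (U n)) \<longlonglongrightarrow> z'"
    using conv[OF bounded_components(4)] by blast
  obtain u where lim5: "(\<lambda>n. cu (U n)) \<longlonglongrightarrow> u"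
    using conv[OF bounded_components(5)] by blast
  obtain v where lim6: "(\<lambda>n. cv (U n)) \<longlonglongrightarrow> v"
    using conv[OF bounded_components(6)] by blast
  obtain y where lim7: "(\<lambda>n. cy (U n)) \<longlonglongrightarrow> y"
    using conv[OF bounded_components(7)] by blast
  obtain z where lim8: "(\<lambda>n. cz (U n)) \<longlonglongrightarrow> z"
    using conv[OF bounded_components(8)] by blast
  obtain du where lim9: "(\<lambda>n. weak_deriv l (cu (U n))) \<longlonglongrightarrow> du"
    using conv[OF bounded_components(9)] by blast
  obtain dv where lim10: "(\<lambda>n. weak_deriv l (cv (U n))) \<longlonglongrightarrow> dv"
    using conv[OF bounded_components(10)] by blast
  obtain dy where lim11: "(\<lambda>n. weak_deriv l (cy (U n))) \<longlonglongrightarrow> dy"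
    using conv[OF bounded_components(11)] by blast
  obtain dz where lim12: "(\<lambda>n. weak_deriv l (cz (U n))) \<longlonglongrightarrow> dz"
    using conv[OF bounded_components(12)] by blast
  note lim = lim1 lim2 lim3 lim4 lim5 lim6 lim7 lim8 lim9 lim10 lim11 lim12
  have mem: "cu (U n) \<in> H1_0 l" "cu' (U n) \<in> L2_on l" "cv (U n) \<in> H1_star l" "cv' (U n) \<in> L2_star l"
    "cy (U n) \<in> H1_0 l" "cy' (U n) \<in> L2_on l" "cz (U n) \<in> H1_star l" "cz' (U n) \<in> L2_star l" for n
    using U(1)[of n] by (simp_all add: phase_space_iff)
  note H = H1_0_closed[OF l mem(1) lim(5,9)] H1_star_closed[OF l mem(3) lim(6,10)]
    H1_0_closed[OF l mem(5) lim(7,11)] H1_star_closed[OF l mem(7) lim(8,12)]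
  define W where "W = (u, u', v, v', y, y', z, z')"
  have "W \<in> phase_space l"
    using H closed_sequentially[OF closed_L2_on mem(2) lim(1)] closed_sequentially[OF closed_L2_on mem(6) lim(3)]
      closed_sequentially[OF closed_L2_star[OF l] mem(4) lim(2)]
      closed_sequentially[OF closed_L2_star[OF l] mem(8) lim(4)]
    by (simp add: phase_space_iff W_def)
  moreover have "f \<longlonglongrightarrow> J W"
    unfolding f by (rule J_tendsto) (use lim H in \<open>simp_all add: W_def\<close>)
  ultimately show "\<exists>x\<in>J ` phase_space l. f \<longlonglongrightarrow> x"
    by blast
qed

section \<open>The domain of the system operator and its density\<close>

lemma sys_dom_iff: "U \<in> sys_dom l b\<^sub>1 b\<^sub>2 \<kappa>\<^sub>1 \<kappa>\<^sub>2 \<gamma>\<^sub>1 \<gamma>\<^sub>2 \<gamma>\<^sub>3 \<gamma>\<^sub>4 \<alpha> \<beta> \<longleftrightarrow> U \<in> phase_space l \<and>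
    cu' U \<in> H1_0 l \<and> cv' U \<in> H1_star l \<and> cy' U \<in> H1_0 l \<and> cz' U \<in> H1_star l \<and>
    \<kappa>\<^sub>1 *\<^sub>R cu U + \<gamma>\<^sub>1 *\<^sub>R cu' U \<in> domA l \<and> \<kappa>\<^sub>2 *\<^sub>R cy U + \<gamma>\<^sub>3 *\<^sub>R cy' U \<in> domA l \<and>
    b\<^sub>1 *\<^sub>R cv U + \<gamma>\<^sub>2 *\<^sub>R A_star_pow l (\<alpha> - 1) (cv' U) \<in> domA_star l \<and>
    b\<^sub>2 *\<^sub>R cz U + \<gamma>\<^sub>4 *\<^sub>R A_star_pow l (\<beta> - 1) (cz' U) \<in> domA_star l"
  unfolding sys_dom_def case_prod_unfold by simp

text \<open>Truncated Fourier series converge in the energy norm. Each component, and each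
  fractional power of a rotation, is then a finite trigonometric sum and satisfies the domain
  conditions separately, not only in combination.\<close>

lemma sys_dom_dense:
  assumes U: "U \<in> phase_space l" and "e > 0"
  shows "\<exists>V\<in>sys_dom l b\<^sub>1 b\<^sub>2 \<kappa>\<^sub>1 \<kappa>\<^sub>2 \<gamma>\<^sub>1 \<gamma>\<^sub>2 \<gamma>\<^sub>3 \<gamma>\<^sub>4 \<alpha> \<beta>. norm (J (U - V)) < e"
proof -
  note l = pos(1)
  define ps where "ps k f = (\<Sum>n<k. cinner f (sn l (Suc n)) *\<^sub>C sn l (Suc n))" for k f
  define pc where "pc k f = (\<Sum>n<k. cinner f (cs l (Suc n)) *\<^sub>C cs l (Suc n))" for k f
  define P where "P k = (ps k (cu U), ps k (cu' U), pc k (cv U), pc k (cv' U),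
      ps k (cy U), ps k (cy' U), pc k (cz U), pc k (cz' U))" for k
  have ps: "ps k f \<in> domA l" "ps k f \<in> H1_0 l" "ps k f \<in> L2_on l" for k f
    using domA_sum[OF l] H1_0D(2)[OF l] by (auto simp: ps_def domA_iff)
  have pc: "pc k f \<in> domA_star l" "pc k f \<in> H1_star l" "pc k f \<in> L2_star l"
    "A_star_pow l \<sigma> (pc k f) \<in> domA_star l" for k f \<sigma>
    using domA_star_sum[OF l] H1_star_D(2)[OF l] A_star_pow_sum[OF l] by (auto simp: pc_def domA_star_iff)
  have PX: "P k \<in> phase_space l" for k
    by (simp add: phase_space_iff P_def ps pc)
  have PD: "P k \<in> sys_dom l b\<^sub>1 b\<^sub>2 \<kappa>\<^sub>1 \<kappa>\<^sub>2 \<gamma>\<^sub>1 \<gamma>\<^sub>2 \<gamma>\<^sub>3 \<gamma>\<^sub>4 \<alpha> \<beta>" for k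
    unfolding sys_dom_iff
    by (intro conjI PX domA_add[OF l] domA_scaleR[OF l] domA_star_add[OF l] domA_star_scaleR[OF l])
      (simp_all add: P_def ps pc)
  have lim_ps: "(\<lambda>k. ps k f) \<longlonglongrightarrow> f" if "f \<in> L2_on l" for f
    using onb_expansion[OF onb_sn[OF l] that] by (simp add: sums_def ps_def)
  have lim_pc: "(\<lambda>k. pc k f) \<longlonglongrightarrow> f" if "f \<in> L2_star l" for f
    using onb_expansion[OF onb_cs_star[OF l] that] by (simp add: sums_def pc_def)
  have "(\<lambda>k. J (P k)) \<longlonglongrightarrow> J U"
  proof (rule J_tendsto)
    show "(\<lambda>k. weak_deriv l (cu (P k))) \<longlonglongrightarrow> weak_deriv l (cu U)"
      "(\<lambda>k. weak_deriv l (cy (P k))) \<longlonglongrightarrow> weak_deriv l (cy U)"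
      using U H1_0_approx[OF l] by (auto simp: P_def phase_space_iff ps_def)
    show "(\<lambda>k. weak_deriv l (cv (P k))) \<longlonglongrightarrow> weak_deriv l (cv U)"
      "(\<lambda>k. weak_deriv l (cz (P k))) \<longlonglongrightarrow> weak_deriv l (cz U)"
      using U H1_star_approx[OF l] by (auto simp: P_def phase_space_iff pc_def)
  qed (use U H1_0D(2)[OF l] H1_star_D(2)[OF l] in \<open>auto simp: P_def phase_space_iff intro!: lim_ps lim_pc\<close>)
  then obtain k where "norm (J (P k) - J U) < e"
    using \<open>e > 0\<close> LIMSEQ_D by blast
  then have "norm (J (U - P k)) < e"
    by (simp add: J_diff U PX norm_minus_commute)
  then show ?thesis
    using PD by blast
qed

text \<open>Weighted velocities; the inner product with the displacements in
  \<open>K\<^sub>2\<close> is the multiplier F.\<close>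

definition K\<^sub>1 :: "state \<Rightarrow> L2 \<times> L2 \<times> L2 \<times> L2" where
  "K\<^sub>1 U = (\<rho>\<^sub>1 *\<^sub>R cu' U, \<rho>\<^sub>2 *\<^sub>R cv' U, \<rho>\<^sub>3 *\<^sub>R cy' U, \<rho>\<^sub>4 *\<^sub>R cz' U)"

definition K\<^sub>2 :: "state \<Rightarrow> L2 \<times> L2 \<times> L2 \<times> L2" where
  "K\<^sub>2 U = (cu U, cv U, cy U, cz U)"

lemma K_inner: "inner (K\<^sub>1 U) (K\<^sub>2 V) = \<rho>\<^sub>1 * inner (cu' U) (cu V) + \<rho>\<^sub>2 * inner (cv' U) (cv V)
    + \<rho>\<^sub>3 * inner (cy' U) (cy V) + \<rho>\<^sub>4 * inner (cz' U) (cz V)"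
  by (simp add: K\<^sub>1_def K\<^sub>2_def)

lemma K_bounded: "\<exists>C\<ge>0. bounded_on K\<^sub>1 C" "\<exists>C\<ge>0. bounded_on K\<^sub>2 C"
proof -
  have pair: "\<exists>C\<ge>0. bounded_on (\<lambda>U. (K U, K' U)) C" if K: "\<exists>C\<ge>0. bounded_on K C" "\<exists>C\<ge>0. bounded_on K' C"
    for K :: "state \<Rightarrow> 'p::real_normed_vector" and K' :: "state \<Rightarrow> 'q::real_normed_vector"
  proof -
    obtain C C' where "C \<ge> 0" "bounded_on K C" "C' \<ge> 0" "bounded_on K' C'"
      using K by blast
    then show ?thesis
      using bounded_on_Pair[of K C K' C'] by (intro exI[of _ "C + C'"]) simp
  qed
  have scale: "\<exists>C\<ge>0. bounded_on (\<lambda>U. r *\<^sub>R K U) C" if K: "\<exists>C\<ge>0. bounded_on K C"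
    for r and K :: "state \<Rightarrow> 'p::real_normed_vector"
  proof -
    obtain C where "C \<ge> 0" "bounded_on K C"
      using K by blast
    then show ?thesis
      using bounded_on_scaleR[of K C r] by (intro exI[of _ "\<bar>r\<bar> * C"]) simp
  qed
  show "\<exists>C\<ge>0. bounded_on K\<^sub>1 C"
    unfolding K\<^sub>1_def by (intro pair scale bounded_components)
  show "\<exists>C\<ge>0. bounded_on K\<^sub>2 C"
    unfolding K\<^sub>2_def by (intro pair bounded_components)
qed

end

section \<open>Exponential stability of the coupled beams\<close>

theorem theorem10:
  fixes l m b\<^sub>1 b\<^sub>2 \<kappa>\<^sub>1 \<kappa>\<^sub>2 \<rho>\<^sub>1 \<rho>\<^sub>2 \<rho>\<^sub>3 \<rho>\<^sub>4 \<gamma>\<^sub>1 \<gamma>\<^sub>2 \<gamma>\<^sub>3 \<gamma>\<^sub>4 \<alpha> \<beta> :: real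
    and S :: "real \<Rightarrow> state \<Rightarrow> state"
  assumes "l > 0" and "m > 0" and "b\<^sub>1 > 0" and "b\<^sub>2 > 0" and "\<kappa>\<^sub>1 > 0" and "\<kappa>\<^sub>2 > 0"
    and "\<rho>\<^sub>1 > 0" and "\<rho>\<^sub>2 > 0" and "\<rho>\<^sub>3 > 0" and "\<rho>\<^sub>4 > 0"
    and "\<gamma>\<^sub>1 > 0" and "\<gamma>\<^sub>2 > 0" and "\<gamma>\<^sub>3 > 0" and "\<gamma>\<^sub>4 > 0"
    and "\<alpha> \<in> {0..1}" and "\<beta> \<in> {0..1}"
    and "generates_c0 (phase_space l) (phase_norm l m b\<^sub>1 b\<^sub>2 \<kappa>\<^sub>1 \<kappa>\<^sub>2 \<rho>\<^sub>1 \<rho>\<^sub>2 \<rho>\<^sub>3 \<rho>\<^sub>4)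
           (sys_dom l b\<^sub>1 b\<^sub>2 \<kappa>\<^sub>1 \<kappa>\<^sub>2 \<gamma>\<^sub>1 \<gamma>\<^sub>2 \<gamma>\<^sub>3 \<gamma>\<^sub>4 \<alpha> \<beta>)
           (sys_op l m b\<^sub>1 b\<^sub>2 \<kappa>\<^sub>1 \<kappa>\<^sub>2 \<rho>\<^sub>1 \<rho>\<^sub>2 \<rho>\<^sub>3 \<rho>\<^sub>4 \<gamma>\<^sub>1 \<gamma>\<^sub>2 \<gamma>\<^sub>3 \<gamma>\<^sub>4 \<alpha> \<beta>) S"
  shows "\<exists>M\<ge>1. \<exists>\<omega>>0. \<forall>t\<ge>0.
           op_norm (phase_space l) (phase_norm l m b\<^sub>1 b\<^sub>2 \<kappa>\<^sub>1 \<kappa>\<^sub>2 \<rho>\<^sub>1 \<rho>\<^sub>2 \<rho>\<^sub>3 \<rho>\<^sub>4) (S t) \<le> M * exp (- \<omega> * t)"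
proof -
  interpret double_beam l m b\<^sub>1 b\<^sub>2 \<kappa>\<^sub>1 \<kappa>\<^sub>2 \<rho>\<^sub>1 \<rho>\<^sub>2 \<rho>\<^sub>3 \<rho>\<^sub>4
    by unfold_locales (use assms in auto)
  let ?N = "phase_norm l m b\<^sub>1 b\<^sub>2 \<kappa>\<^sub>1 \<kappa>\<^sub>2 \<rho>\<^sub>1 \<rho>\<^sub>2 \<rho>\<^sub>3 \<rho>\<^sub>4"
  let ?D = "sys_dom l b\<^sub>1 b\<^sub>2 \<kappa>\<^sub>1 \<kappa>\<^sub>2 \<gamma>\<^sub>1 \<gamma>\<^sub>2 \<gamma>\<^sub>3 \<gamma>\<^sub>4 \<alpha> \<beta>"
  let ?B = "sys_op l m b\<^sub>1 b\<^sub>2 \<kappa>\<^sub>1 \<kappa>\<^sub>2 \<rho>\<^sub>1 \<rho>\<^sub>2 \<rho>\<^sub>3 \<rho>\<^sub>4 \<gamma>\<^sub>1 \<gamma>\<^sub>2 \<gamma>\<^sub>3 \<gamma>\<^sub>4 \<alpha> \<beta>"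
  interpret normed_c0_semigroup "phase_space l" J ?N S
    by unfold_locales (use assms phase_norm_eq complete_J in \<open>auto simp: generates_c0_def\<close>)
  note l = \<open>l > 0\<close>
  \<comment> \<open>Index 1 belongs to the beam (u, v), index 2 to (y, z): \<open>w\<close> is the
    fractional damping term, \<open>a\<close> the shear rate, \<open>s\<close> the shear and
    \<open>d\<close> the dissipation.\<close>
  define w\<^sub>1 where "w\<^sub>1 U = A_star_pow l (\<alpha> - 1) (cv' U)" for U :: state
  define w\<^sub>2 where "w\<^sub>2 U = A_star_pow l (\<beta> - 1) (cz' U)" for U :: state
  define a\<^sub>1 where "a\<^sub>1 U = weak_deriv l (cu' U) - cv' U" for U :: state
  define a\<^sub>2 where "a\<^sub>2 U = weak_deriv l (cy' U) - cz' U" for U :: state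
  define s\<^sub>1 where "s\<^sub>1 U = weak_deriv l (cu U) - cv U" for U :: state
  define s\<^sub>2 where "s\<^sub>2 U = weak_deriv l (cy U) - cz U" for U :: state
  define d\<^sub>1 where "d\<^sub>1 U = \<gamma>\<^sub>1 * (norm (a\<^sub>1 U))\<^sup>2 + \<gamma>\<^sub>2 * inner (weak_deriv l (w\<^sub>1 U)) (weak_deriv l (cv' U))" for U
  define d\<^sub>2 where "d\<^sub>2 U = \<gamma>\<^sub>3 * (norm (a\<^sub>2 U))\<^sup>2 + \<gamma>\<^sub>4 * inner (weak_deriv l (w\<^sub>2 U)) (weak_deriv l (cz' U))" for U
  have w\<^sub>1: "w\<^sub>1 U \<in> H1_star l" and w\<^sub>2: "w\<^sub>2 U \<in> H1_star l" if "U \<in> ?D" for U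
    using that assms(12,14) damped_domain[OF l] unfolding w\<^sub>1_def w\<^sub>2_def sys_dom_iff phase_space_iff
    by (metis less_irrefl)+
  \<comment> \<open>The equations of motion with free test functions: velocities will give the
    energy law, displacements the derivative of the multiplier.\<close>
  have weak: "\<rho>\<^sub>1 * inner (cu' (?B U)) \<phi> = - \<kappa>\<^sub>1 * inner (s\<^sub>1 U) (weak_deriv l \<phi>)
        - \<gamma>\<^sub>1 * inner (a\<^sub>1 U) (weak_deriv l \<phi>) + m * inner (cy U - cu U) \<phi>" (is "?W1")
      "\<rho>\<^sub>3 * inner (cy' (?B U)) \<phi> = - \<kappa>\<^sub>2 * inner (s\<^sub>2 U) (weak_deriv l \<phi>)
        - \<gamma>\<^sub>3 * inner (a\<^sub>2 U) (weak_deriv l \<phi>) - m * inner (cy U - cu U) \<phi>" (is "?W2")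
      "\<rho>\<^sub>2 * inner (cv' (?B U)) \<psi> = - b\<^sub>1 * inner (weak_deriv l (cv U)) (weak_deriv l \<psi>)
        - \<gamma>\<^sub>2 * inner (weak_deriv l (w\<^sub>1 U)) (weak_deriv l \<psi>) + \<kappa>\<^sub>1 * inner (s\<^sub>1 U) \<psi> + \<gamma>\<^sub>1 * inner (a\<^sub>1 U) \<psi>" (is "?W3")
      "\<rho>\<^sub>4 * inner (cz' (?B U)) \<psi> = - b\<^sub>2 * inner (weak_deriv l (cz U)) (weak_deriv l \<psi>)
        - \<gamma>\<^sub>4 * inner (weak_deriv l (w\<^sub>2 U)) (weak_deriv l \<psi>) + \<kappa>\<^sub>2 * inner (s\<^sub>2 U) \<psi> + \<gamma>\<^sub>3 * inner (a\<^sub>2 U) \<psi>" (is "?W4")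
    if U: "U \<in> ?D" and \<phi>: "\<phi> \<in> H1_0 l" and \<psi>: "\<psi> \<in> H1_star l" for U \<phi> \<psi>
  proof -
    have div: "r * inner (x /\<^sub>R r) f = inner x f" if "r > 0" for r and x f :: L2
      using that by simp
    note D = U[unfolded sys_dom_iff phase_space_iff]
    have B: "cu' (?B U) = (- opA l (\<kappa>\<^sub>1 *\<^sub>R cu U + \<gamma>\<^sub>1 *\<^sub>R cu' U) - \<kappa>\<^sub>1 *\<^sub>R weak_deriv l (cv U)
            - \<gamma>\<^sub>1 *\<^sub>R weak_deriv l (cv' U) + m *\<^sub>R (cy U - cu U)) /\<^sub>R \<rho>\<^sub>1"
        "cy' (?B U) = (- opA l (\<kappa>\<^sub>2 *\<^sub>R cy U + \<gamma>\<^sub>3 *\<^sub>R cy' U) - \<kappa>\<^sub>2 *\<^sub>R weak_deriv l (cz U)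
            - \<gamma>\<^sub>3 *\<^sub>R weak_deriv l (cz' U) - m *\<^sub>R (cy U - cu U)) /\<^sub>R \<rho>\<^sub>3"
        "cv' (?B U) = (- opA_star l (b\<^sub>1 *\<^sub>R cv U + \<gamma>\<^sub>2 *\<^sub>R w\<^sub>1 U) + \<kappa>\<^sub>1 *\<^sub>R s\<^sub>1 U + \<gamma>\<^sub>1 *\<^sub>R a\<^sub>1 U) /\<^sub>R \<rho>\<^sub>2"
        "cz' (?B U) = (- opA_star l (b\<^sub>2 *\<^sub>R cz U + \<gamma>\<^sub>4 *\<^sub>R w\<^sub>2 U) + \<kappa>\<^sub>2 *\<^sub>R s\<^sub>2 U + \<gamma>\<^sub>3 *\<^sub>R a\<^sub>2 U) /\<^sub>R \<rho>\<^sub>4"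
      by (simp_all add: sys_op_def case_prod_unfold w\<^sub>1_def w\<^sub>2_def s\<^sub>1_def s\<^sub>2_def a\<^sub>1_def a\<^sub>2_def)
    show ?W1
      unfolding B(1) div[OF \<open>\<rho>\<^sub>1 > 0\<close>] s\<^sub>1_def a\<^sub>1_def
      using D by (subst inner_add_left, subst beam_displacement_eq[OF l _ _ _ _ _ \<phi>]) auto
    show ?W2
      unfolding B(2) div[OF \<open>\<rho>\<^sub>3 > 0\<close>] s\<^sub>2_def a\<^sub>2_def
      using D by (subst inner_diff_left, subst beam_displacement_eq[OF l _ _ _ _ _ \<phi>]) auto
    show ?W3
      unfolding B(3) div[OF \<open>\<rho>\<^sub>2 > 0\<close>]
      by (rule beam_rotation_eq[OF l _ w\<^sub>1[OF U] _ \<psi>]) (use D in \<open>auto simp: w\<^sub>1_def\<close>)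
    show ?W4
      unfolding B(4) div[OF \<open>\<rho>\<^sub>4 > 0\<close>]
      by (rule beam_rotation_eq[OF l _ w\<^sub>2[OF U] _ \<psi>]) (use D in \<open>auto simp: w\<^sub>2_def\<close>)
  qed
  have vel: "cu (?B U) = cu' U" "cv (?B U) = cv' U" "cy (?B U) = cy' U" "cz (?B U) = cz' U" for U
    by (simp_all add: sys_op_def case_prod_unfold)
  have energy: "inner (J U) (J (?B U)) \<le> - (d\<^sub>1 U + d\<^sub>2 U)" if U: "U \<in> ?D" for U
  proof -
    have mem: "cu' U \<in> H1_0 l" "cv' U \<in> H1_star l" "cy' U \<in> H1_0 l" "cz' U \<in> H1_star l"
      using U by (auto simp: sys_dom_iff)
    have n: "(norm (a\<^sub>1 U))\<^sup>2 = inner (a\<^sub>1 U) (weak_deriv l (cu' U)) - inner (a\<^sub>1 U) (cv' U)"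
      "(norm (a\<^sub>2 U))\<^sup>2 = inner (a\<^sub>2 U) (weak_deriv l (cy' U)) - inner (a\<^sub>2 U) (cz' U)"
      unfolding power2_norm_eq_inner by (simp_all only: a\<^sub>1_def a\<^sub>2_def inner_diff_right)
    have "inner (J U) (J (?B U)) = inner (J (?B U)) (J U)"
      by (rule inner_commute)
    also have "\<dots> = \<rho>\<^sub>1 * inner (cu' (?B U)) (cu' U) + \<rho>\<^sub>2 * inner (cv' (?B U)) (cv' U)
        + \<rho>\<^sub>3 * inner (cy' (?B U)) (cy' U) + \<rho>\<^sub>4 * inner (cz' (?B U)) (cz' U)
        + \<kappa>\<^sub>1 * inner (a\<^sub>1 U) (s\<^sub>1 U) + \<kappa>\<^sub>2 * inner (a\<^sub>2 U) (s\<^sub>2 U)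
        + m * inner (cy' U - cu' U) (cy U - cu U)
        + b\<^sub>1 * inner (weak_deriv l (cv' U)) (weak_deriv l (cv U))
        + b\<^sub>2 * inner (weak_deriv l (cz' U)) (weak_deriv l (cz U))"
      by (simp only: J_inner vel a\<^sub>1_def a\<^sub>2_def s\<^sub>1_def s\<^sub>2_def)
    also have "inner (a\<^sub>1 U) (s\<^sub>1 U) = inner (s\<^sub>1 U) (weak_deriv l (cu' U)) - inner (s\<^sub>1 U) (cv' U)"
      by (simp add: a\<^sub>1_def inner_commute inner_diff_right)
    also have "inner (a\<^sub>2 U) (s\<^sub>2 U) = inner (s\<^sub>2 U) (weak_deriv l (cy' U)) - inner (s\<^sub>2 U) (cz' U)"
      by (simp add: a\<^sub>2_def inner_commute inner_diff_right)
    also have "inner (cy' U - cu' U) (cy U - cu U) = inner (cy U - cu U) (cy' U) - inner (cy U - cu U) (cu' U)"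
      by (simp add: inner_commute inner_diff_right)
    \<comment> \<open>The elastic and coupling terms cancel in pairs, so the energy law is an
      equation.\<close>
    finally have "inner (J U) (J (?B U)) = - (d\<^sub>1 U + d\<^sub>2 U)"
      unfolding weak(1)[OF U mem(1,2)] weak(2)[OF U mem(3,2)] weak(3)[OF U mem(1,2)] weak(4)[OF U mem(1,4)]
        d\<^sub>1_def d\<^sub>2_def n
      by (simp add: inner_commute algebra_simps)
    then show ?thesis
      by simp
  qed
  obtain C\<^sub>1 where C\<^sub>1: "C\<^sub>1 \<ge> 0" and "beam_estimate l \<kappa>\<^sub>1 b\<^sub>1 \<rho>\<^sub>1 \<rho>\<^sub>2 \<gamma>\<^sub>1 \<gamma>\<^sub>2 \<alpha> C\<^sub>1"
    using beam_dissipation[of l \<alpha> \<kappa>\<^sub>1 b\<^sub>1 \<rho>\<^sub>1 \<rho>\<^sub>2 \<gamma>\<^sub>1 \<gamma>\<^sub>2] assms by blast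
  note beam\<^sub>1 = this(2)[unfolded beam_estimate_def, rule_format]
  obtain C\<^sub>2 where C\<^sub>2: "C\<^sub>2 \<ge> 0" and "beam_estimate l \<kappa>\<^sub>2 b\<^sub>2 \<rho>\<^sub>3 \<rho>\<^sub>4 \<gamma>\<^sub>3 \<gamma>\<^sub>4 \<beta> C\<^sub>2"
    using beam_dissipation[of l \<beta> \<kappa>\<^sub>2 b\<^sub>2 \<rho>\<^sub>3 \<rho>\<^sub>4 \<gamma>\<^sub>3 \<gamma>\<^sub>4] assms by blast
  note beam\<^sub>2 = this(2)[unfolded beam_estimate_def, rule_format]
  have mem: "cu' U \<in> H1_0 l" "cv' U \<in> H1_star l" "cy' U \<in> H1_0 l" "cz' U \<in> H1_star l"
      "cu U \<in> H1_0 l" "cv U \<in> H1_star l" "cy U \<in> H1_0 l" "cz U \<in> H1_star l" if "U \<in> ?D" for U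
    using that by (auto simp: sys_dom_iff phase_space_iff)
  note beam\<^sub>1' = beam\<^sub>1[OF mem(1,2) a\<^sub>1_def w\<^sub>1_def w\<^sub>1 d\<^sub>1_def]
  note beam\<^sub>2' = beam\<^sub>2[OF mem(3,4) a\<^sub>2_def w\<^sub>2_def w\<^sub>2 d\<^sub>2_def]
  have d: "0 \<le> d\<^sub>1 U" "0 \<le> d\<^sub>2 U" if "U \<in> ?D" for U
    using beam\<^sub>1'[OF that that that] beam\<^sub>2'[OF that that that] by blast+
  have cross: "inner (K\<^sub>1 U) (K\<^sub>2 (?B U)) + inner (K\<^sub>1 (?B U)) (K\<^sub>2 U)
      \<le> - (1 / 2) * (norm (J U))\<^sup>2 + (C\<^sub>1 + C\<^sub>2) * (d\<^sub>1 U + d\<^sub>2 U)" if U: "U \<in> ?D" for U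
  proof -
    note M = mem[OF U]
    have n: "(norm (s\<^sub>1 U))\<^sup>2 = inner (s\<^sub>1 U) (weak_deriv l (cu U)) - inner (s\<^sub>1 U) (cv U)"
      "(norm (s\<^sub>2 U))\<^sup>2 = inner (s\<^sub>2 U) (weak_deriv l (cy U)) - inner (s\<^sub>2 U) (cz U)"
      "(norm (cy U - cu U))\<^sup>2 = inner (cy U - cu U) (cy U) - inner (cy U - cu U) (cu U)"
      unfolding power2_norm_eq_inner by (simp_all only: s\<^sub>1_def s\<^sub>2_def inner_diff_right)
    have as: "inner (a\<^sub>1 U) (s\<^sub>1 U) = inner (a\<^sub>1 U) (weak_deriv l (cu U)) - inner (a\<^sub>1 U) (cv U)"
      "inner (a\<^sub>2 U) (s\<^sub>2 U) = inner (a\<^sub>2 U) (weak_deriv l (cy U)) - inner (a\<^sub>2 U) (cz U)"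
      by (simp_all only: s\<^sub>1_def s\<^sub>2_def inner_diff_right)
    have "inner (K\<^sub>1 U) (K\<^sub>2 (?B U)) + inner (K\<^sub>1 (?B U)) (K\<^sub>2 U)
      = (\<rho>\<^sub>1 * (norm (cu' U))\<^sup>2 + \<rho>\<^sub>2 * (norm (cv' U))\<^sup>2 - \<kappa>\<^sub>1 * (norm (s\<^sub>1 U))\<^sup>2 - \<gamma>\<^sub>1 * inner (a\<^sub>1 U) (s\<^sub>1 U)
          - b\<^sub>1 * (norm (weak_deriv l (cv U)))\<^sup>2 - \<gamma>\<^sub>2 * inner (weak_deriv l (w\<^sub>1 U)) (weak_deriv l (cv U)))
        + (\<rho>\<^sub>3 * (norm (cy' U))\<^sup>2 + \<rho>\<^sub>4 * (norm (cz' U))\<^sup>2 - \<kappa>\<^sub>2 * (norm (s\<^sub>2 U))\<^sup>2 - \<gamma>\<^sub>3 * inner (a\<^sub>2 U) (s\<^sub>2 U)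
          - b\<^sub>2 * (norm (weak_deriv l (cz U)))\<^sup>2 - \<gamma>\<^sub>4 * inner (weak_deriv l (w\<^sub>2 U)) (weak_deriv l (cz U)))
        - m * (norm (cy U - cu U))\<^sup>2"
      unfolding K_inner vel weak(1)[OF U M(5,6)] weak(2)[OF U M(7,6)] weak(3)[OF U M(5,6)] weak(4)[OF U M(5,8)] n as
      by (simp add: power2_norm_eq_inner algebra_simps)
    also have "\<dots> \<le> (- 1 / 2 * (\<rho>\<^sub>1 * (norm (cu' U))\<^sup>2 + \<rho>\<^sub>2 * (norm (cv' U))\<^sup>2 + \<kappa>\<^sub>1 * (norm (s\<^sub>1 U))\<^sup>2
            + b\<^sub>1 * (norm (weak_deriv l (cv U)))\<^sup>2) + C\<^sub>1 * d\<^sub>1 U)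
        + (- 1 / 2 * (\<rho>\<^sub>3 * (norm (cy' U))\<^sup>2 + \<rho>\<^sub>4 * (norm (cz' U))\<^sup>2 + \<kappa>\<^sub>2 * (norm (s\<^sub>2 U))\<^sup>2
            + b\<^sub>2 * (norm (weak_deriv l (cz U)))\<^sup>2) + C\<^sub>2 * d\<^sub>2 U)
        - 1 / 2 * (m * (norm (cy U - cu U))\<^sup>2)"
    proof (intro diff_mono add_mono)
      \<comment> \<open>The coupling energy enters the multiplier identity with factor -1, of which
        the target uses only half.\<close>
      have "0 \<le> m * (norm (cy U - cu U))\<^sup>2"
        using \<open>m > 0\<close> by simp
      then show "1 / 2 * (m * (norm (cy U - cu U))\<^sup>2) \<le> m * (norm (cy U - cu U))\<^sup>2"
        by linarith
    qed (use beam\<^sub>1'[OF U U U] beam\<^sub>2'[OF U U U] in blast)+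
    also have "\<dots> = - (1 / 2) * (norm (J U))\<^sup>2 + (C\<^sub>1 * d\<^sub>1 U + C\<^sub>2 * d\<^sub>2 U)"
      unfolding J_norm_sq s\<^sub>1_def s\<^sub>2_def by (simp add: algebra_simps)
    \<comment> \<open>The abstract theorem takes a single dissipation with a single constant; the
      mixed products added are nonnegative.\<close>
    also have "C\<^sub>1 * d\<^sub>1 U + C\<^sub>2 * d\<^sub>2 U \<le> (C\<^sub>1 + C\<^sub>2) * (d\<^sub>1 U + d\<^sub>2 U)"
      using mult_nonneg_nonneg[OF C\<^sub>1 d(2)[OF U]] mult_nonneg_nonneg[OF C\<^sub>2 d(1)[OF U]]
      by (simp add: algebra_simps)
    finally show ?thesis
      by simp
  qed
  obtain M\<^sub>1 M\<^sub>2 where "M\<^sub>1 \<ge> 0" "bounded_on K\<^sub>1 M\<^sub>1" "M\<^sub>2 \<ge> 0" "bounded_on K\<^sub>2 M\<^sub>2"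
    using K_bounded by blast
  then show ?thesis
    by (intro lyapunov_exponential_stability[where D = ?D and B = ?B and ?K1.0 = K\<^sub>1 and ?K2.0 = K\<^sub>2
        and ?C1.0 = M\<^sub>1 and ?C2.0 = M\<^sub>2 and d = "\<lambda>U. d\<^sub>1 U + d\<^sub>2 U" and c = "1 / 2" and C = "C\<^sub>1 + C\<^sub>2"])
      (use assms(17) d energy cross sys_dom_dense in \<open>auto simp: generates_c0_def\<close>)
qed

end
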